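(* There is an algorithm which, given a block graph $G$ with $n$ vertices and $m$ edges (connected, with at least two vertices), computes a minimum cardinality semipaired dominating set of $G$ in $O(n+m)$ time.
   Context: All graphs are finite and simple. A block of a graph is a maximal induced subgraph without a cut vertex. A block graph is a connected graph every block of which is a complete graph. For a graph $G=(V,E)$ with no isolated vertices, a semipaired dominating set is a set $D\subseteq V$ such that every vertex of $V\setminus D$ has a neighbor in $D$ and $D$ can be partitioned into $2$-element subsets $\{u,v\}$ with the distance between $u$ and $v$ in $G$ at most $2$. The semipaired domination number $\gamma_{pr2}(G)$ is the minimum cardinality of such a set; a minimum cardinality semipaired dominating set is one of cardinality $\gamma_{pr2}(G)$. *)

theory Defs
  imports "Graph_Theory.Graph_Theory" "HOL-Library.Disjoint_Sets"
begin

section \<open>Graphs\<close>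

text \<open>Finite simple graphs are the finite symmetric loop-free digraphs without parallel arcs
  of the locale \<^locale>\<open>graph\<close>; every undirected edge is a pair of opposite arcs.\<close>

definition edges :: "('a, 'b) pre_digraph \<Rightarrow> 'a set set" where
  "edges G = (\<lambda>(u, v). {u, v}) ` arcs_ends G"

text \<open>A vertex separating two further vertices of its own component.\<close>

definition cut_vertex :: "('a, 'b) pre_digraph \<Rightarrow> 'a \<Rightarrow> bool" where
  "cut_vertex H v \<longleftrightarrow> v \<in> verts H \<and>
     (\<exists>x \<in> verts H - {v}. \<exists>y \<in> verts H - {v}.
        x \<rightarrow>\<^sup>*\<^bsub>H\<^esub> y \<and> \<not> x \<rightarrow>\<^sup>*\<^bsub>pre_digraph.del_vert H v\<^esub> y)"

text \<open>As usual for blocks, the subgraphs are required to be connected (hence nonempty).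
  Without this, two edges at distance at least two on a path would also induce
  a subgraph without a cut vertex.\<close>

definition connected_no_cut :: "('a, 'b) pre_digraph \<Rightarrow> bool" where
  "connected_no_cut H \<longleftrightarrow> Digraph_Component.connected H \<and> (\<nexists>v. cut_vertex H v)"

definition is_block :: "('a, 'b) pre_digraph \<Rightarrow> ('a, 'b) pre_digraph \<Rightarrow> bool" where
  "is_block G B \<longleftrightarrow> induced_subgraph B G \<and> connected_no_cut B \<and>
     \<not> (\<exists>B'. induced_subgraph B' G \<and> connected_no_cut B' \<and> verts B \<subset> verts B')"

definition block_graph :: "('a, 'b) pre_digraph \<Rightarrow> bool" where
  "block_graph G \<longleftrightarrow> graph G \<and> Digraph_Component.connected G \<and>
     (\<forall>B. is_block G B \<longrightarrow> (\<exists>k. complete_digraph k B))"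

abbreviation gdist :: "('a, 'b) pre_digraph \<Rightarrow> 'a \<Rightarrow> 'a \<Rightarrow> ereal" where
  "gdist G u v \<equiv> wf_digraph.\<mu> G (\<lambda>_. 1) u v"

definition semipaired_dominating :: "('a, 'b) pre_digraph \<Rightarrow> 'a set \<Rightarrow> bool" where
  "semipaired_dominating G D \<longleftrightarrow> D \<subseteq> verts G \<and>
     (\<forall>v \<in> verts G - D. \<exists>u \<in> D. v \<rightarrow>\<^bsub>G\<^esub> u) \<and>
     (\<exists>P. partition_on D P \<and>
        (\<forall>p \<in> P. \<exists>u v. p = {u, v} \<and> u \<noteq> v \<and> gdist G u v \<le> 2))"

definition semipaired_domination_number :: "('a, 'b) pre_digraph \<Rightarrow> nat" where
  "semipaired_domination_number G = (LEAST k. \<exists>D. semipaired_dominating G D \<and> card D = k)"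

definition min_semipaired_dominating :: "('a, 'b) pre_digraph \<Rightarrow> 'a set \<Rightarrow> bool" where
  "min_semipaired_dominating G D \<longleftrightarrow>
     semipaired_dominating G D \<and> card D = semipaired_domination_number G"


section \<open>Random access machine programs\<close>

text \<open>Structured programs over finitely many scalar registers and finitely many arrays with
  constant-time indexed access. All values are natural numbers, subtraction is truncated.
  There is no multiplication, and every number handled has to stay below a word limit \<open>W\<close>
  (see \<open>exec\<close>), so that the unit-cost measure cannot be exploited with huge numbers.\<close>

record store =
  reg :: "string \<Rightarrow> nat"
  arr :: "string \<Rightarrow> nat \<Rightarrow> nat"

datatype aexp =
    Const nat
  | Reg string
  | Get string aexp
  | Add aexp aexp
  | Sub aexp aexp

datatype bexp =
    Less aexp aexp
  | Equal aexp aexp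
  | Neg bexp
  | Conj bexp bexp

datatype com =
    Skip
  | Assign string aexp
  | Put string aexp aexp
  | Seq com com
  | Cond bexp com com
  | While bexp com

fun aval :: "aexp \<Rightarrow> store \<Rightarrow> nat" where
  "aval (Const k) s = k"
| "aval (Reg x) s = reg s x"
| "aval (Get a i) s = arr s a (aval i s)"
| "aval (Add e f) s = aval e s + aval f s"
| "aval (Sub e f) s = aval e s - aval f s"

fun bval :: "bexp \<Rightarrow> store \<Rightarrow> bool" where
  "bval (Less e f) s = (aval e s < aval f s)"
| "bval (Equal e f) s = (aval e s = aval f s)"
| "bval (Neg b) s = (\<not> bval b s)"
| "bval (Conj b c) s = (bval b s \<and> bval c s)"

text \<open>All values occurring in the evaluation of an expression, indices included,
  are below the word limit.\<close>

fun afits :: "nat \<Rightarrow> aexp \<Rightarrow> store \<Rightarrow> bool" where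
  "afits W (Const k) s = (k < W)"
| "afits W (Reg x) s = (reg s x < W)"
| "afits W (Get a i) s = (afits W i s \<and> arr s a (aval i s) < W)"
| "afits W (Add e f) s = (afits W e s \<and> afits W f s \<and> aval e s + aval f s < W)"
| "afits W (Sub e f) s = (afits W e s \<and> afits W f s)"

fun bfits :: "nat \<Rightarrow> bexp \<Rightarrow> store \<Rightarrow> bool" where
  "bfits W (Less e f) s = (afits W e s \<and> afits W f s)"
| "bfits W (Equal e f) s = (afits W e s \<and> afits W f s)"
| "bfits W (Neg b) s = bfits W b s"
| "bfits W (Conj b c) s = (bfits W b s \<and> bfits W c s)"

text \<open>Every operation and every operand costs one time unit.\<close>

fun acost :: "aexp \<Rightarrow> nat" where
  "acost (Const k) = 1"
| "acost (Reg x) = 1"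
| "acost (Get a i) = 1 + acost i"
| "acost (Add e f) = 1 + acost e + acost f"
| "acost (Sub e f) = 1 + acost e + acost f"

fun bcost :: "bexp \<Rightarrow> nat" where
  "bcost (Less e f) = 1 + acost e + acost f"
| "bcost (Equal e f) = 1 + acost e + acost f"
| "bcost (Neg b) = 1 + bcost b"
| "bcost (Conj b c) = 1 + bcost b + bcost c"

text \<open>\<open>exec W c s t s'\<close>: started in \<open>s\<close>, the program \<open>c\<close> halts in \<open>s'\<close> after \<open>t\<close> time units.
  There is no such derivation if a number reaches the word limit or the program diverges.\<close>

inductive exec :: "nat \<Rightarrow> com \<Rightarrow> store \<Rightarrow> nat \<Rightarrow> store \<Rightarrow> bool" for W :: nat where
  exec_Skip: "exec W Skip s 1 s"
| exec_Assign: "afits W e s \<Longrightarrow>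
    exec W (Assign x e) s (1 + acost e) (s\<lparr>reg := (reg s)(x := aval e s)\<rparr>)"
| exec_Put: "afits W i s \<Longrightarrow> afits W e s \<Longrightarrow>
    exec W (Put a i e) s (1 + acost i + acost e)
      (s\<lparr>arr := (arr s)(a := (arr s a)(aval i s := aval e s))\<rparr>)"
| exec_Seq: "exec W c s t s' \<Longrightarrow> exec W d s' t' s'' \<Longrightarrow> exec W (Seq c d) s (t + t') s''"
| exec_CondTrue: "bfits W b s \<Longrightarrow> bval b s \<Longrightarrow> exec W c s t s' \<Longrightarrow>
    exec W (Cond b c d) s (1 + bcost b + t) s'"
| exec_CondFalse: "bfits W b s \<Longrightarrow> \<not> bval b s \<Longrightarrow> exec W d s t s' \<Longrightarrow>
    exec W (Cond b c d) s (1 + bcost b + t) s'"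
| exec_WhileFalse: "bfits W b s \<Longrightarrow> \<not> bval b s \<Longrightarrow>
    exec W (While b c) s (1 + bcost b) s"
| exec_WhileTrue: "bfits W b s \<Longrightarrow> bval b s \<Longrightarrow> exec W c s t s' \<Longrightarrow>
    exec W (While b c) s' t' s'' \<Longrightarrow> exec W (While b c) s (1 + bcost b + t + t') s''"

inductive_cases SkipE: "exec W Skip s t s'"
inductive_cases AssignE: "exec W (Assign x e) s t s'"
inductive_cases PutE: "exec W (Put a i e) s t s'"
inductive_cases SeqE: "exec W (Seq c d) s t s'"
inductive_cases CondE: "exec W (Cond b c d) s t s'"
inductive_cases WhileE: "exec W (While b c) s t s'"

text \<open>Execution is deterministic, so the halting run of a program is its only run.\<close>

lemma exec_deterministic:
  "exec W c s t s' \<Longrightarrow> exec W c s t2 s2 \<Longrightarrow> t2 = t \<and> s2 = s'"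
proof (induction arbitrary: t2 s2 rule: exec.induct)
  case (exec_Skip s) then show ?case by (rule SkipE) simp
next
  case (exec_Assign e s x) from exec_Assign(2) show ?case by (rule AssignE) simp
next
  case (exec_Put i s e a) from exec_Put(3) show ?case by (rule PutE) simp
next
  case (exec_Seq c s t s' d t' s'') from exec_Seq.prems show ?case
    by (rule SeqE) (auto dest!: exec_Seq.IH)
next
  case (exec_CondTrue b s c t s' d) from exec_CondTrue.prems show ?case
    by (rule CondE) (use exec_CondTrue.hyps(2) in \<open>auto dest!: exec_CondTrue.IH\<close>)
next
  case (exec_CondFalse b s d t s' c) from exec_CondFalse.prems show ?case
    by (rule CondE) (use exec_CondFalse.hyps(2) in \<open>auto dest!: exec_CondFalse.IH\<close>)
next
  case (exec_WhileFalse b s c) from exec_WhileFalse.prems show ?case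
    by (rule WhileE) (use exec_WhileFalse.hyps(2) in auto)
next
  case (exec_WhileTrue b s c t s' t' s'') from exec_WhileTrue.prems show ?case
    by (rule WhileE) (use exec_WhileTrue.hyps(2) in \<open>auto dest!: exec_WhileTrue.IH\<close>)
qed


section \<open>Input and output\<close>

text \<open>Adjacency lists, in arbitrary order, of a graph with vertex set \<open>{0, \<dots>, n - 1}\<close>.\<close>

definition adjacency_lists :: "(nat, 'b) pre_digraph \<Rightarrow> nat list list \<Rightarrow> bool" where
  "adjacency_lists G adj \<longleftrightarrow> verts G = {..<length adj} \<and>
     (\<forall>u < length adj. distinct (adj ! u) \<and> set (adj ! u) = {v. u \<rightarrow>\<^bsub>G\<^esub> v})"

text \<open>The lists are stored consecutively in array \<open>nbr\<close>; those of vertex \<open>u\<close> occupy the positions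
  from \<open>off[u]\<close> (inclusive) to \<open>off[u+1]\<close> (exclusive). All other memory is zero.\<close>

definition input_store :: "nat list list \<Rightarrow> store" where
  "input_store adj =
     \<lparr>reg = (\<lambda>_. 0)(''n'' := length adj),
      arr = (\<lambda>_ _. 0)
        (''off'' := (\<lambda>u. if u \<le> length adj then length (concat (take u adj)) else 0),
         ''nbr'' := (\<lambda>i. if i < length (concat adj) then concat adj ! i else 0))\<rparr>"

text \<open>The computed vertex set is read off as a 0/1 array.\<close>

definition output_set :: "(nat, 'b) pre_digraph \<Rightarrow> store \<Rightarrow> nat set" where
  "output_set G s = {v \<in> verts G. arr s ''out'' v = 1}"

end

theory Submission
  imports Defs
begin

text \<open>A vertex set \<open>D\<close> splits into pairs at distance at most two iff every vertex of \<open>D\<close> can move a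
  token to a vertex of its closed neighbourhood such that every place receives an even number of
  tokens: a pair meets at a common closed neighbour. In a rooted block graph the tokens crossing a
  block balance out, and this gives a greedy algorithm. Bottom-up, every vertex gets a kind that records
  whether its subtree has to be dominated from above (\<open>Undominated\<close>), waits for a token from the block
  above (\<open>Needy\<close>, \<open>Full_Needy\<close>) or has one to spare (\<open>Spare\<close>). In a block whose needy vertices
  outnumber the spare ones, every missing token costs one further vertex, the first of which is the
  parent. Optimality holds because the number of vertices that any solution has in a subtree, minus
  the greedy cost of this subtree, is bounded below in terms of the tokens which enter and leave the
  subtree; the bound propagates upwards by counting tokens and their parity.
  Top-down, the deficits are assigned to needy vertices, which yields a solution meeting the bound.\<close>

section \<open>Rooted block structures\<close>

text \<open>Partners at distance two may meet at a vertex outside the set and belong to different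
  blocks, so pairs are not local to a subtree. Tokens are: each moves along at most one edge, and an
  edge lies in one block. Thus a subtree interacts with the rest only through its root: whether it
  is in the set, whether it is dominated, and which tokens it exchanges with the block above. Only
  the parity of the tokens at a place matters, which leaves six kinds. A chosen parent dominates all
  blocks below it but supplies a token to only one of them, so each further missing token has to be
  paid for inside the subtree of a needy child. One extra vertex is always enough: a
  \<open>Needy\<close> vertex joins the set and keeps its token; a \<open>Full_Needy\<close> one
  keeps the token it would have sent down and passes the debt on to one needy child of its own. The
  cost does not depend on which children pay. Therefore counts suffice for the bottom-up pass, and
  the choice can be postponed to the top-down pass.\<close>

text \<open>\<open>Spare\<close>, \<open>Full\<close> and \<open>Full_Needy\<close> vertices belong to the constructed set, \<open>Dominated\<close> ones do not.\<close>

datatype kind = Undominated | Dominated | Needy | Spare | Full | Full_Needy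

definition chosen :: "kind \<Rightarrow> bool" where
  "chosen k \<longleftrightarrow> k = Spare \<or> k = Full \<or> k = Full_Needy"

definition needy :: "kind \<Rightarrow> bool" where
  "needy k \<longleftrightarrow> k = Needy \<or> k = Full_Needy"

definition kind_of :: "bool \<Rightarrow> bool \<Rightarrow> bool \<Rightarrow> bool \<Rightarrow> kind" where
  "kind_of d f s a =
     (if d then if s then Full_Needy else Full
      else if f then if s then Full else Spare
      else if s then Needy else if a then Dominated else Undominated)"

text \<open>Every block consists of a vertex and of one class of its children; \<open>ld\<close> maps every non-root vertex to the
  representative of its class. The value \<open>n\<close> of \<open>par\<close> at the root is a dummy which is not a vertex.\<close>

locale rooted_blocks =
  fixes n :: nat and A :: "nat \<Rightarrow> nat set" and par ld pos :: "nat \<Rightarrow> nat"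
  assumes two_le_n: "2 \<le> n"
    and A_range: "v \<in> A u \<Longrightarrow> u < n \<and> v < n"
    and A_sym: "v \<in> A u \<Longrightarrow> u \<in> A v"
    and A_irrefl: "v \<notin> A v"
    and par_A: "0 < v \<Longrightarrow> v < n \<Longrightarrow> par v \<in> A v"
    and pos_par: "0 < v \<Longrightarrow> v < n \<Longrightarrow> pos (par v) < pos v"
    and pos_less: "v < n \<Longrightarrow> pos v < n"
    and edge_cases: "v \<in> A u \<Longrightarrow> (0 < u \<and> par u = v) \<or> (0 < v \<and> par v = u) \<or>
       (0 < u \<and> 0 < v \<and> par u = par v \<and> ld u = ld v)"
    and block_clique: "0 < u \<Longrightarrow> u < n \<Longrightarrow> 0 < v \<Longrightarrow> v < n \<Longrightarrow> ld u = ld v \<Longrightarrow> u \<noteq> v \<Longrightarrow> v \<in> A u"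
    and ld_props: "0 < v \<Longrightarrow> v < n \<Longrightarrow> 0 < ld v \<and> ld v < n \<and> ld (ld v) = ld v \<and> par (ld v) = par v"
    and root_props: "par 0 = n" "ld 0 = 0"
begin

section \<open>Children, the blocks below a vertex, and their token counts\<close>

definition kids :: "nat \<Rightarrow> nat set" where
  "kids v = {c. 0 < c \<and> c < n \<and> par c = v}"

definition blk :: "nat \<Rightarrow> nat set" where
  "blk l = {c. 0 < c \<and> c < n \<and> ld c = l}"

definition leads :: "nat \<Rightarrow> nat set" where
  "leads v = {l \<in> kids v. ld l = l}"

definition ncount :: "(nat \<Rightarrow> kind) \<Rightarrow> nat \<Rightarrow> nat" where
  "ncount t l = card {c \<in> blk l. needy (t c)}"

definition ecount :: "(nat \<Rightarrow> kind) \<Rightarrow> nat \<Rightarrow> nat" where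
  "ecount t l = card {c \<in> blk l. t c = Spare}"

definition lacking :: "(nat \<Rightarrow> kind) \<Rightarrow> nat \<Rightarrow> bool" where
  "lacking t v \<longleftrightarrow> (\<exists>l \<in> leads v. ecount t l < ncount t l)"

text \<open>The subtraction is truncated block by block: a token moves only once, so a token that
  one block sends up to \<open>v\<close> cannot serve a needy vertex of another block.\<close>

definition surplus :: "(nat \<Rightarrow> kind) \<Rightarrow> nat \<Rightarrow> nat" where
  "surplus t v = (\<Sum>l \<in> leads v. ecount t l - ncount t l)"

definition deficit :: "(nat \<Rightarrow> kind) \<Rightarrow> nat \<Rightarrow> nat" where
  "deficit t v = (\<Sum>l \<in> leads v. ncount t l - ecount t l)"

text \<open>An undominated child has no chosen child of its own, and here no chosen vertex in its
  block either. Among the vertices that could still dominate it, the parent reaches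
  furthest.\<close>

definition forced :: "(nat \<Rightarrow> kind) \<Rightarrow> nat \<Rightarrow> bool" where
  "forced t v \<longleftrightarrow> (\<exists>l \<in> leads v. (\<exists>c \<in> blk l. t c = Undominated) \<and> (\<forall>c \<in> blk l. \<not> chosen (t c)))"

definition child_chosen :: "(nat \<Rightarrow> kind) \<Rightarrow> nat \<Rightarrow> bool" where
  "child_chosen t v \<longleftrightarrow> (\<exists>c \<in> kids v. chosen (t c))"

definition kind_rule :: "(nat \<Rightarrow> kind) \<Rightarrow> nat \<Rightarrow> kind" where
  "kind_rule t v = kind_of (lacking t v) (forced t v) (odd (surplus t v)) (child_chosen t v)"

lemma finite_parts [simp, intro]: "finite (kids v)" "finite (blk v)" "finite (leads v)"
proof -
  have "kids v \<subseteq> {..<n}" "blk v \<subseteq> {..<n}" "leads v \<subseteq> {..<n}"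
    by (auto simp: kids_def blk_def leads_def)
  then show "finite (kids v)" "finite (blk v)" "finite (leads v)"
    by (auto intro: finite_subset)
qed

lemma pos_kids: "c \<in> kids v \<Longrightarrow> n - pos c < n - pos v"
  using pos_par[of c] pos_less[of c] by (auto simp: kids_def)

text \<open>\<open>kind_rule\<close> reads its first argument only at children
  (\<open>kind_rule_cong\<close>); the guard exposes this to the termination proof, where
  \<open>n - pos\<close> decreases from a parent to its children.\<close>

function ty :: "nat \<Rightarrow> kind" where
  "ty v = kind_rule (\<lambda>c. if c \<in> kids v then ty c else Undominated) v"
  by auto
termination
  by (relation "measure (\<lambda>v. n - pos v)") (auto dest: pos_kids)

declare ty.simps [simp del]

function subtree_sum :: "(nat \<Rightarrow> int) \<Rightarrow> nat \<Rightarrow> int" where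
  "subtree_sum g v = g v + (\<Sum>c \<in> kids v. if c \<in> kids v then subtree_sum g c else 0)"
  by auto
termination
  by (relation "measure (\<lambda>(g, v). n - pos v)") (auto dest: pos_kids)

declare subtree_sum.simps [simp del]

lemma blk_par: "l \<in> leads v \<Longrightarrow> c \<in> blk l \<Longrightarrow> par c = v"
  using ld_props[of c] by (auto simp: leads_def kids_def blk_def)

lemma blk_kids: "l \<in> leads v \<Longrightarrow> blk l \<subseteq> kids v"
  using blk_par[of l v] by (auto simp: kids_def blk_def)

lemma kids_Union: "kids v = (\<Union>l \<in> leads v. blk l)"
proof (intro equalityI subsetI)
  fix c assume "c \<in> kids v"
  then show "c \<in> (\<Union>l \<in> leads v. blk l)"
    using ld_props[of c] by (auto simp: leads_def kids_def blk_def)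
next
  fix c assume "c \<in> (\<Union>l \<in> leads v. blk l)"
  then show "c \<in> kids v" using blk_kids by blast
qed

lemma blk_disjoint: "l \<noteq> l' \<Longrightarrow> blk l \<inter> blk l' = {}"
  by (auto simp: blk_def)

lemma sum_kids:
  fixes g :: "nat \<Rightarrow> 'b::comm_monoid_add"
  shows "sum g (kids v) = (\<Sum>l \<in> leads v. sum g (blk l))"
  unfolding kids_Union by (rule sum.UNION_disjoint) (auto simp: blk_disjoint)

lemma kids_notself: "c \<in> kids v \<Longrightarrow> c \<noteq> v"
  using pos_par[of c] by (auto simp: kids_def)

lemma kids_A: "c \<in> kids v \<Longrightarrow> c \<in> A v \<and> v \<in> A c"
  using par_A[of c] A_sym by (auto simp: kids_def)

lemma kids_less: "c \<in> kids v \<Longrightarrow> 0 < c \<and> c < n \<and> v < n \<and> par c = v"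
  using par_A[of c] A_range by (auto simp: kids_def)

lemma ld_leads: "c \<in> kids v \<Longrightarrow> ld c \<in> leads v \<and> c \<in> blk (ld c)"
  using ld_props[of c] by (auto simp: leads_def kids_def blk_def)

lemma par_notin_blk: "l \<in> leads v \<Longrightarrow> par l \<notin> blk l"
  using blk_par[of l v "par l"] ld_props[of l] pos_par[of "par l"]
  by (auto simp: leads_def kids_def blk_def)

lemma A_split:
  assumes "u \<in> A v"
  shows "u \<in> kids v \<or> (0 < v \<and> u = par v) \<or> (0 < v \<and> u \<in> blk (ld v))"
  using edge_cases[OF assms] A_range[OF assms] by (auto simp: kids_def blk_def)

lemma not_kids:
  assumes "0 < v" "v < n" "u = par v \<or> u \<in> blk (ld v)"
  shows "u \<notin> kids v"
  using assms ld_props[of v] ld_props[of u] pos_par[of v] pos_par[of u]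
  by (auto simp: kids_def blk_def)

lemma leads_par: "l \<in> leads v \<Longrightarrow> par l = v"
  by (auto simp: leads_def kids_def)

lemma sum_of_bool_blk: "(\<Sum>l \<in> leads v. of_bool (x \<in> blk l)) = (of_bool (x \<in> kids v) :: nat)"
proof (cases "x \<in> kids v")
  case True
  then have "leads v \<inter> {l. x \<in> blk l} = {ld x}" using ld_leads[of x v] by (auto simp: blk_def)
  then show ?thesis using True by simp
next
  case False
  then have "leads v \<inter> {l. x \<in> blk l} = {}" using blk_kids by blast
  then show ?thesis using False by simp
qed

lemma kind_rule_cong:
  assumes "\<And>c. c \<in> kids v \<Longrightarrow> t c = t' c"
  shows "kind_rule t v = kind_rule t' v"
proof -
  have b: "t c = t' c" if "l \<in> leads v" "c \<in> blk l" for l c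
    using that assms blk_kids by blast
  have "ecount t l = ecount t' l" "ncount t l = ncount t' l" if "l \<in> leads v" for l
    unfolding ecount_def ncount_def using b[OF that]
    by (auto intro!: arg_cong[of _ _ card])
  then have "lacking t v = lacking t' v" "surplus t v = surplus t' v"
    by (auto simp: lacking_def surplus_def)
  moreover have "forced t v = forced t' v"
    unfolding forced_def by (intro bex_cong refl arg_cong2[of _ _ _ _ "(\<and>)"] ball_cong) (simp_all add: b)
  moreover have "child_chosen t v = child_chosen t' v"
    using assms by (auto simp: child_chosen_def)
  ultimately show ?thesis by (simp add: kind_rule_def)
qed

lemma ty_eq: "ty v = kind_rule ty v"
  by (subst ty.simps) (rule kind_rule_cong, simp)

lemma subtree_sum_eq: "subtree_sum g v = g v + sum (subtree_sum g) (kids v)"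
  by (subst subtree_sum.simps) simp

lemma kids_induct [consumes 1, case_names step]:
  assumes "v < n" and step: "\<And>v. v < n \<Longrightarrow> (\<And>c. c \<in> kids v \<Longrightarrow> P c) \<Longrightarrow> P v"
  shows "P v"
  using assms(1)
proof (induction "n - pos v" arbitrary: v rule: less_induct)
  case less
  show ?case
  proof (rule step[OF less.prems])
    fix c assume "c \<in> kids v"
    then show "P c" using pos_kids by (intro less.hyps) (auto simp: kids_def)
  qed
qed

text \<open>When the recursion equation is summed over all vertices, every non-root vertex occurs
  exactly once as a child, and everything cancels except the value at the root.\<close>

lemma sum_eq_subtree_sum: "(\<Sum>v<n. g v) = subtree_sum g 0"
proof -
  have "(\<Sum>v<n. subtree_sum g v) = (\<Sum>v<n. g v) + (\<Sum>v<n. \<Sum>c \<in> kids v. subtree_sum g c)"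
    by (subst sum.distrib[symmetric], rule sum.cong[OF refl subtree_sum_eq])
  also have "(\<Sum>v<n. \<Sum>c \<in> kids v. subtree_sum g c) = (\<Sum>c \<in> (\<Union>v<n. kids v). subtree_sum g c)"
    by (rule sum.UNION_disjoint[symmetric]) (auto simp: kids_def)
  also have "(\<Union>v<n. kids v) = {0<..<n}"
    using kids_less by (auto simp: kids_def)
  finally have "(\<Sum>v<n. subtree_sum g v) = (\<Sum>v<n. g v) + sum (subtree_sum g) {0<..<n}" .
  moreover have "{..<n} = insert 0 {0<..<n}"
    using two_le_n by auto
  then have "(\<Sum>v<n. subtree_sum g v) = subtree_sum g 0 + sum (subtree_sum g) {0<..<n}"
    by (simp del: lessThan_iff)
  ultimately show ?thesis by simp
qed

text \<open>The vertex \<open>v\<close> itself is one of the \<open>deficit\<close> many vertices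
  paid for missing tokens; hence a lacking vertex that is also forced costs nothing more.\<close>

definition local_cost :: "nat \<Rightarrow> nat" where
  "local_cost v = (if lacking ty v then deficit ty v else if forced ty v then 1 else 0)"

lemma deficit_pos: "lacking t v \<longleftrightarrow> 0 < deficit t v"
  unfolding lacking_def deficit_def by (simp add: zero_less_iff_neq_zero not_le)

lemma kind_cases:
  "\<lbrakk>lacking ty v; odd (surplus ty v)\<rbrakk> \<Longrightarrow> ty v = Full_Needy"
  "\<lbrakk>lacking ty v; even (surplus ty v)\<rbrakk> \<Longrightarrow> ty v = Full"
  "\<lbrakk>\<not> lacking ty v; forced ty v; odd (surplus ty v)\<rbrakk> \<Longrightarrow> ty v = Full"
  "\<lbrakk>\<not> lacking ty v; forced ty v; even (surplus ty v)\<rbrakk> \<Longrightarrow> ty v = Spare"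
  "\<lbrakk>\<not> lacking ty v; \<not> forced ty v; odd (surplus ty v)\<rbrakk> \<Longrightarrow> ty v = Needy"
  "\<lbrakk>\<not> lacking ty v; \<not> forced ty v; even (surplus ty v); child_chosen ty v\<rbrakk> \<Longrightarrow> ty v = Dominated"
  "\<lbrakk>\<not> lacking ty v; \<not> forced ty v; even (surplus ty v); \<not> child_chosen ty v\<rbrakk> \<Longrightarrow> ty v = Undominated"
  by (subst ty_eq; simp add: kind_rule_def kind_of_def)+


lemma ty_chosen:
  "lacking ty v \<Longrightarrow> chosen (ty v)"
  "forced ty v \<Longrightarrow> chosen (ty v)"
  using kind_cases(1-4)[of v] by (cases "lacking ty v"; cases "odd (surplus ty v)"; simp add: chosen_def)+

end

section \<open>The lower bound\<close>

text \<open>The function \<open>f\<close> sends every vertex of \<open>D\<close> to the place where it meets its partner.\<close>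

locale meeting_places = rooted_blocks +
  fixes D :: "nat set" and f :: "nat \<Rightarrow> nat"
  assumes D_sub: "D \<subseteq> {..<n}"
    and f_near: "x \<in> D \<Longrightarrow> f x = x \<or> f x \<in> A x"
begin

text \<open>A moving token uses an edge, and every edge lies in exactly one block;
  \<open>toks l\<close> collects the tokens that move within the block of \<open>par l\<close> and
  \<open>blk l\<close>. \<open>emits\<close> and \<open>takes\<close> concern the block above a
  vertex, \<open>down\<close> and \<open>up\<close> the exchange of a parent with one block below
  it.\<close>

definition toks :: "nat \<Rightarrow> nat set" where
  "toks l = {y \<in> D. f y \<noteq> y \<and> y \<in> insert (par l) (blk l) \<and> f y \<in> insert (par l) (blk l)}"

definition emits :: "nat \<Rightarrow> nat" where "emits v = of_bool (v \<in> toks (ld v))"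
definition takes :: "nat \<Rightarrow> nat" where "takes v = card {y \<in> toks (ld v). f y = v}"
definition down :: "nat \<Rightarrow> nat" where "down l = of_bool (par l \<in> toks l)"
definition up :: "nat \<Rightarrow> nat" where "up l = card {y \<in> toks l. f y = par l}"
definition stays :: "nat \<Rightarrow> nat" where "stays v = of_bool (v \<in> D \<and> f v = v)"

lemma finD [simp, intro]: "finite D" using D_sub finite_subset by blast
lemma fintoks [simp, intro]: "finite (toks l)" by (simp add: toks_def)

text \<open>Double counting of the tokens moving inside the block: each has one start and one end
  there, at a child or at the parent.\<close>

lemma balance:
  assumes l: "l \<in> leads v"
  shows "(\<Sum>c \<in> blk l. emits c) + down l = (\<Sum>c \<in> blk l. takes c) + up l"
proof -
  have ld: "ld c = l" if "c \<in> blk l" for c using that by (simp add: blk_def)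
  have "(\<Sum>c \<in> insert (par l) (blk l). of_bool (c \<in> toks l)) = card (insert (par l) (blk l) \<inter> toks l)"
    by (subst sum_of_bool_eq) (auto simp: Int_def)
  also have "insert (par l) (blk l) \<inter> toks l = toks l"
    by (auto simp: toks_def)
  finally have "(\<Sum>c \<in> insert (par l) (blk l). of_bool (c \<in> toks l)) = card (toks l)" .
  moreover have "(\<Sum>c \<in> insert (par l) (blk l). card {y \<in> toks l. f y = c}) = card (toks l)"
    unfolding card_eq_sum by (rule sum.group) (auto simp: toks_def)
  ultimately show ?thesis
    using par_notin_blk[OF l]
    by (simp only: emits_def takes_def down_def up_def ld sum.insert finite_parts not_False_eq_True
        cong: sum.cong)
qed

text \<open>There is no block above the root: \<open>blk 0\<close> is empty, and the one remaining
  candidate \<open>par 0 = n\<close> is not a vertex.\<close>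

lemma toks_0 [simp]: "toks 0 = {}"
proof -
  have "c \<notin> blk 0" for c
    unfolding blk_def using ld_props[of c] by (metis (mono_tags, lifting) less_irrefl mem_Collect_eq)
  then have "blk 0 = {}" by blast
  then show ?thesis using D_sub by (auto simp: toks_def root_props)
qed

lemma toks_own:
  assumes "v < n"
  shows "v \<in> toks (ld v) \<longleftrightarrow> v \<in> D \<and> f v \<noteq> v \<and> f v \<notin> kids v"
proof (cases "v = 0")
  case True
  then show ?thesis using f_near[of 0] A_split[of "f 0" 0] root_props(2) toks_0 by auto
next
  case False
  have "v \<in> blk (ld v)" "par (ld v) = par v" using False assms ld_props[of v] by (auto simp: blk_def)
  moreover have "f v \<in> insert (par v) (blk (ld v)) \<longleftrightarrow> f v \<notin> kids v" if "v \<in> D" "f v \<noteq> v"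
    using f_near[OF that(1)] that(2) A_split[of "f v" v] not_kids[of v "f v"] False assms by auto
  ultimately show ?thesis by (auto simp: toks_def)
qed

lemma toks_fibre_own:
  assumes "v < n"
  shows "{y \<in> toks (ld v). f y = v} = {y \<in> D. f y = v \<and> y \<noteq> v \<and> y \<notin> kids v}"
proof -
  have near: "y \<in> A v" if "y \<in> D" "f y = v" "y \<noteq> v" for y
    using f_near[OF that(1)] A_sym[of v y] that by auto
  show ?thesis
  proof (cases "v = 0")
    case True
    have "y \<in> kids 0" if "y \<in> D" "f y = 0" "y \<noteq> 0" for y
      using A_split[of y 0] near[of y] True that by auto
    then show ?thesis using True root_props(2) toks_0 by auto
  next
    case False
    have "v \<in> blk (ld v)" "par (ld v) = par v"
      using False assms ld_props[of v] by (auto simp: blk_def)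
    moreover have "y \<in> insert (par v) (blk (ld v)) \<longleftrightarrow> y \<notin> kids v"
      if "y \<in> D" "f y = v" "y \<noteq> v" for y
      using A_split[OF near[OF that]] not_kids[of v y] False assms by auto
    ultimately have "y \<in> toks (ld v) \<longleftrightarrow> y \<notin> kids v" if "y \<in> D" "f y = v" "y \<noteq> v" for y
      using that by (simp add: toks_def)
    moreover have "y \<in> D \<and> f y \<noteq> y" if "y \<in> toks (ld v)" for y
      using that by (simp add: toks_def)
    ultimately show ?thesis by (intro Collect_cong) metis
  qed
qed

lemma toks_down:
  assumes "l \<in> leads v"
  shows "v \<in> toks l \<longleftrightarrow> v \<in> D \<and> f v \<in> blk l"
  using assms par_notin_blk[OF assms] by (auto simp: toks_def leads_def kids_def)

lemma toks_fibre_up: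
  assumes "l \<in> leads v"
  shows "{y \<in> toks l. f y = v} = {y \<in> D. f y = v \<and> y \<in> blk l}"
  using assms par_notin_blk[OF assms] by (auto simp: toks_def leads_def kids_def)

text \<open>The token of a vertex stays, or moves into the block above, or moves into exactly one of
  the blocks below. \<open>tokens_at\<close> is the same case split for the tokens that
  arrive.\<close>

lemma token_of:
  assumes "v < n"
  shows "of_bool (v \<in> D) = stays v + emits v + (\<Sum>l \<in> leads v. down l)"
proof -
  have "(\<Sum>l \<in> leads v. down l) = (\<Sum>l \<in> leads v. of_bool (v \<in> D) * of_bool (f v \<in> blk l))"
    by (rule sum.cong) (auto simp: down_def leads_par toks_down)
  also have "\<dots> = of_bool (v \<in> D \<and> f v \<in> kids v)"
    by (subst sum_distrib_left[symmetric], subst sum_of_bool_blk) auto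
  finally have "(\<Sum>l \<in> leads v. down l) = of_bool (v \<in> D \<and> f v \<in> kids v)" .
  moreover have "v \<notin> kids v" using kids_notself by blast
  ultimately show ?thesis
    by (auto simp: stays_def emits_def toks_own[OF assms])
qed

lemma tokens_at:
  assumes "v < n"
  shows "card {x \<in> D. f x = v} = stays v + takes v + (\<Sum>l \<in> leads v. up l)"
proof -
  have "(\<Sum>l \<in> leads v. up l) = (\<Sum>l \<in> leads v. card {y \<in> D. f y = v \<and> y \<in> blk l})"
    by (rule sum.cong) (auto simp: up_def leads_par toks_fibre_up)
  also have "\<dots> = card (\<Union>l \<in> leads v. {y \<in> D. f y = v \<and> y \<in> blk l})"
    by (subst card_UN_disjoint) (auto simp: blk_def)
  also have "(\<Union>l \<in> leads v. {y \<in> D. f y = v \<and> y \<in> blk l}) = {y \<in> D. f y = v \<and> y \<in> kids v}"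
    by (auto simp: kids_Union)
  finally have 1: "(\<Sum>l \<in> leads v. up l) = card {y \<in> D. f y = v \<and> y \<in> kids v}" .
  have 2: "takes v = card {y \<in> D. f y = v \<and> y \<noteq> v \<and> y \<notin> kids v}"
    by (simp add: takes_def toks_fibre_own[OF assms])
  have nk: "v \<notin> kids v" using kids_notself by blast
  have "{y \<in> D. f y = v \<and> y = v} = (if v \<in> D \<and> f v = v then {v} else {})"
    by auto
  then have 3: "stays v = card {y \<in> D. f y = v \<and> y = v}"
    by (simp add: stays_def)
  have 4: "{x \<in> D. f x = v} = {y \<in> D. f y = v \<and> y = v} \<union>
     ({y \<in> D. f y = v \<and> y \<noteq> v \<and> y \<notin> kids v} \<union> {y \<in> D. f y = v \<and> y \<in> kids v})"
    using nk by auto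
  have "card {x \<in> D. f x = v} = card {y \<in> D. f y = v \<and> y = v} + (card {y \<in> D. f y = v \<and> y \<noteq> v \<and> y \<notin> kids v}
     + card {y \<in> D. f y = v \<and> y \<in> kids v})"
  proof -
    have "card ({y \<in> D. f y = v \<and> y \<noteq> v \<and> y \<notin> kids v} \<union> {y \<in> D. f y = v \<and> y \<in> kids v}) =
      card {y \<in> D. f y = v \<and> y \<noteq> v \<and> y \<notin> kids v} + card {y \<in> D. f y = v \<and> y \<in> kids v}"
      by (rule card_Un_disjoint) auto
    then show ?thesis unfolding 4 using nk by (subst card_Un_disjoint) auto
  qed
  then show ?thesis by (simp only: 1 2 3 add.assoc)
qed

section \<open>Propagation of the lower bound from children to parents\<close>

lemma sum_of_bool_card: "finite B \<Longrightarrow> (\<Sum>c \<in> B. of_bool (P c)) = int (card {c \<in> B. P c})"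
  by (simp add: Int_def)

text \<open>If no token is taken (\<open>t = 0\<close>), parity excludes
  \<open>excess = int e\<close>, which yields the additional 1; a token that is taken compensates
  for it directly.\<close>

lemma needy_slack:
  assumes "int e \<le> excess" "odd (excess + int e + int t)"
  shows "int e - int t + 1 \<le> excess"
proof (cases "t = 0")
  case True
  then have "excess \<noteq> int e" using assms(2) by auto
  then show ?thesis using assms(1) True by simp
next
  case False
  then show ?thesis using assms(1) by linarith
qed

definition excess :: "nat \<Rightarrow> int" where
  "excess = subtree_sum (\<lambda>v. of_bool (v \<in> D) - int (local_cost v))"

text \<open>The lower bounds of the induction for the excess of a solution over the greedy cost, by kind. The first
  conjunct says that tokens in the subtree pair up.\<close>

definition bounded :: "nat \<Rightarrow> bool" where
  "bounded v \<longleftrightarrow> even (excess v + int (emits v) + int (takes v) + of_bool (needy (ty v)) + of_bool (ty v = Spare)) \<and>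
     0 \<le> excess v \<and>
     (needy (ty v) \<longrightarrow> int (emits v) - int (takes v) + 1 \<le> excess v) \<and>
     (ty v = Dominated \<or> ty v = Needy \<or> ty v = Undominated \<longrightarrow> of_bool (v \<in> D) \<le> excess v) \<and>
     (ty v = Undominated \<longrightarrow> of_bool (\<exists>c \<in> kids v. c \<in> D) \<le> excess v)"

lemma bounded_kid:
  assumes "bounded c" "ty c = Undominated" "u \<in> kids c" "u \<in> D"
  shows "1 \<le> excess c"
proof -
  have "of_bool (\<exists>c \<in> kids c. c \<in> D) \<le> excess c" using assms(1,2) unfolding bounded_def by blast
  moreover have "\<exists>c \<in> kids c. c \<in> D" using assms(3,4) by blast
  ultimately show ?thesis by simp
qed

text \<open>A common weakening of the bounds for all kinds, in a form that can be summed over a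
  block. For the kinds that are neither needy nor spare, parity excludes the only critical case: one
  token emitted, none taken, excess 0.\<close>

lemma bounded_general:
  assumes "bounded c"
  shows "int (emits c) - int (takes c) + of_bool (needy (ty c)) - of_bool (ty c = Spare) \<le> excess c"
proof -
  have e: "emits c \<le> 1" by (simp add: emits_def)
  consider "needy (ty c)" | "ty c = Spare" | "\<not> needy (ty c)" "ty c \<noteq> Spare" by blast
  then show ?thesis
  proof cases
    case 1
    then show ?thesis using assms by (auto simp: bounded_def needy_def)
  next
    case 2
    then show ?thesis using assms e by (auto simp: bounded_def needy_def)
  next
    case 3
    then have *: "even (excess c + int (emits c) + int (takes c))" "0 \<le> excess c"
      using assms by (auto simp: bounded_def)
    have "int (emits c) - int (takes c) \<le> excess c"
    proof (cases "takes c = 0 \<and> emits c = 1")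
      case True
      then have "excess c \<noteq> 0" using * by auto
      then show ?thesis using True * by auto
    next
      case False
      then show ?thesis using * e by linarith
    qed
    then show ?thesis using 3 by simp
  qed
qed

text \<open>After summation over the block, \<open>balance\<close> replaces the emitted minus the
  taken tokens of the children by \<open>up l - down l\<close>. Thus only the token of the parent
  can reduce what the children pay for a deficit.\<close>

lemma block_bounds:
  assumes l: "l \<in> leads v" and b: "\<And>c. c \<in> kids v \<Longrightarrow> bounded c"
  shows "int (ncount ty l - ecount ty l) \<le> (\<Sum>c \<in> blk l. excess c) + int (down l)"
    and "0 \<le> (\<Sum>c \<in> blk l. excess c)"
    and "even ((\<Sum>c \<in> blk l. excess c) + int (down l) + int (up l) + int (ncount ty l) + int (ecount ty l))"
proof -
  have b: "bounded c" if "c \<in> blk l" for c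
    using that blk_kids[OF l] b by blast
  have bal: "(\<Sum>c \<in> blk l. int (emits c)) + int (down l) = (\<Sum>c \<in> blk l. int (takes c)) + int (up l)"
    using balance[OF l] by (simp flip: of_nat_sum of_nat_add)
  have nc: "(\<Sum>c \<in> blk l. of_bool (needy (ty c))) = int (ncount ty l)"
    "(\<Sum>c \<in> blk l. of_bool (ty c = Spare)) = int (ecount ty l)"
    by (simp_all only: sum_of_bool_card finite_parts ncount_def ecount_def)
  show ge0: "0 \<le> (\<Sum>c \<in> blk l. excess c)"
    by (rule sum_nonneg) (use b in \<open>auto simp: bounded_def\<close>)
  have "(\<Sum>c \<in> blk l. int (emits c) - int (takes c) + of_bool (needy (ty c)) - of_bool (ty c = Spare))
     \<le> (\<Sum>c \<in> blk l. excess c)"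
    by (rule sum_mono) (use b bounded_general in blast)
  then have "int (ncount ty l) - int (ecount ty l) \<le> (\<Sum>c \<in> blk l. excess c) + int (down l)"
    using bal nc by (simp only: sum.distrib sum_subtractf)
  with ge0 show "int (ncount ty l - ecount ty l) \<le> (\<Sum>c \<in> blk l. excess c) + int (down l)"
    by linarith
  have "even (\<Sum>c \<in> blk l. excess c + int (emits c) + int (takes c) + of_bool (needy (ty c)) + of_bool (ty c = Spare))"
    by (rule dvd_sum) (use b in \<open>auto simp: bounded_def\<close>)
  then have "even ((\<Sum>c \<in> blk l. excess c) + (\<Sum>c \<in> blk l. int (emits c)) + (\<Sum>c \<in> blk l. int (takes c))
      + int (ncount ty l) + int (ecount ty l))"
    using nc by (simp only: sum.distrib)
  then show "even ((\<Sum>c \<in> blk l. excess c) + int (down l) + int (up l) + int (ncount ty l) + int (ecount ty l))"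
    using bal by presburger
qed

lemma excess_eq: "excess v = of_bool (v \<in> D) - int (local_cost v) + (\<Sum>l \<in> leads v. \<Sum>c \<in> blk l. excess c)"
  unfolding excess_def by (subst subtree_sum_eq) (simp only: sum_kids)

lemma all_bounded:
  assumes even: "\<And>z. z < n \<Longrightarrow> even (card {x \<in> D. f x = z})"
    and dom: "\<And>v. v < n \<Longrightarrow> v \<in> D \<or> (\<exists>u \<in> D. u \<in> A v)"
    and v: "v < n"
  shows "bounded v"
  using v
proof (induction v rule: kids_induct)
  case (step v)
  define S where "S = (\<Sum>l \<in> leads v. \<Sum>c \<in> blk l. excess c)"
  define x :: int where "x = of_bool (v \<in> D)"
  define dn where "dn = (\<Sum>l \<in> leads v. int (down l))"
  define upp where "upp = (\<Sum>l \<in> leads v. int (up l))"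
  have excess: "excess v = x - int (local_cost v) + S" unfolding x_def S_def by (rule excess_eq)
  note B = block_bounds[OF _ step.IH]
  have S0: "0 \<le> S" unfolding S_def by (rule sum_nonneg) (rule B)
  have "(\<Sum>l \<in> leads v. int (ncount ty l - ecount ty l)) \<le> (\<Sum>l \<in> leads v. (\<Sum>c \<in> blk l. excess c) + int (down l))"
    by (rule sum_mono) (rule B)
  then have Sd: "int (deficit ty v) \<le> S + dn"
    unfolding S_def dn_def deficit_def by (simp add: sum.distrib)
  have "even (\<Sum>l \<in> leads v. (\<Sum>c \<in> blk l. excess c) + int (down l) + int (up l) +
      (int (ncount ty l - ecount ty l) + int (ecount ty l - ncount ty l)))"
  proof (rule dvd_sum)
    fix l assume "l \<in> leads v"
    from B(3)[OF this] show "even ((\<Sum>c \<in> blk l. excess c) + int (down l) + int (up l) +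
      (int (ncount ty l - ecount ty l) + int (ecount ty l - ncount ty l)))" by presburger
  qed
  then have Sp: "even (S + dn + upp + int (deficit ty v) + int (surplus ty v))"
    unfolding S_def dn_def upp_def deficit_def surplus_def by (simp add: sum.distrib add_ac)
  have x: "x = int (stays v) + int (emits v) + dn"
    using arg_cong[OF token_of[OF step.hyps], of int] by (simp add: x_def dn_def)
  have dn0: "0 \<le> dn" unfolding dn_def by (rule sum_nonneg) simp
  have "even (int (card {x \<in> D. f x = v}))"
    using even[OF step.hyps] by simp
  then have tk: "even (int (stays v) + int (takes v) + upp)"
    by (simp add: tokens_at[OF step.hyps] upp_def)
  \<comment> \<open>The parity of the blocks below is added to the parity of the tokens meeting at
    \<open>v\<close>; \<open>emits v\<close> and \<open>upp\<close> then occur twice and drop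
    out.\<close>
  have par: "even (excess v + int (emits v) + int (takes v) + int (local_cost v) + int (deficit ty v) + int (surplus ty v))"
  proof -
    have e: "excess v + int (emits v) + int (takes v) + int (local_cost v) + int (deficit ty v) + int (surplus ty v) =
      (S + dn + upp + int (deficit ty v) + int (surplus ty v)) + (int (stays v) + int (takes v) + upp)
      + 2 * (int (emits v) - upp)" unfolding excess unfolding x by (simp add: algebra_simps)
    show ?thesis unfolding e by (intro dvd_add Sp tk) simp
  qed
  have x01: "0 \<le> x" "x \<le> 1" by (auto simp: x_def)
  have big: "1 \<le> S" if "c \<in> kids v" "1 \<le> excess c" for c
  proof -
    have "excess c \<le> sum excess (kids v)"
      by (rule member_le_sum) (use that step.IH in \<open>auto simp: bounded_def\<close>)
    also have "sum excess (kids v) = S" unfolding S_def by (rule sum_kids)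
    finally show ?thesis using that by simp
  qed
  \<comment> \<open>For each of the three unchosen kinds, \<open>bounded\<close> charges membership
    in \<open>D\<close> to the excess.\<close>
  have unch: "1 \<le> S" if "c \<in> kids v" "c \<in> D" "\<not> chosen (ty c)" for c
    using big[OF that(1)] step.IH[OF that(1)] that(2,3)
    by (cases "ty c") (auto simp: chosen_def bounded_def)
  show ?case
  proof (cases "lacking ty v")
    case True
    then have local_cost: "local_cost v = deficit ty v" by (simp add: local_cost_def)
    \<comment> \<open>A token sent down to relieve the deficit is not emitted upwards:
      \<open>x\<close> splits into \<open>stays v\<close>, \<open>emits v\<close> and
      \<open>dn\<close>, and \<open>S + dn\<close> covers the deficit.\<close>
    have *: "int (emits v) \<le> excess v" using excess Sd x local_cost by simp
    have **: "even (excess v + int (emits v) + int (takes v) + int (surplus ty v))"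
      using par unfolding local_cost by auto
    note * = * **
    show ?thesis
    proof (cases "odd (surplus ty v)")
      case odd: True
      have ty: "ty v = Full_Needy" using kind_cases(1)[OF True odd] .
      have "int (emits v) - int (takes v) + 1 \<le> excess v"
        using * odd by (intro needy_slack) simp_all
      then show ?thesis using * odd ty by (auto simp: bounded_def needy_def)
    next
      case even: False
      then have "ty v = Full" using kind_cases(2)[OF True] by simp
      then show ?thesis using * even by (auto simp: bounded_def needy_def)
    qed
  next
    case nl: False
    then have d0: "deficit ty v = 0" by (simp add: deficit_pos)
    show ?thesis
    proof (cases "forced ty v")
      case True
      then have local_cost: "local_cost v = 1" using nl by (simp add: local_cost_def)
      \<comment> \<open>If \<open>v\<close> is not in \<open>D\<close>, the undominated child
        \<open>c\<close> is dominated by itself, by one of its children or by a vertex of its block.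
        The greedy choice contains none of these, so each of them raises the excess below
        \<open>v\<close>.\<close>
      have "1 \<le> x + S"
      proof (cases "v \<in> D")
        case True then show ?thesis using S0 by (simp add: x_def)
      next
        case False
        obtain l c where l: "l \<in> leads v" and c: "c \<in> blk l" "ty c = Undominated"
          and ch: "\<And>c. c \<in> blk l \<Longrightarrow> \<not> chosen (ty c)"
          using True by (auto simp: forced_def)
        have kids: "c \<in> kids v" if "c \<in> blk l" for c using that blk_kids[OF l] by blast
        have cn: "c < n" "par c = v" "ld c = l" using c kids[of c] by (auto simp: kids_def blk_def)
        consider "c \<in> D" | u where "u \<in> D" "u \<in> A c" using dom[OF cn(1)] by blast
        then have "1 \<le> S"
        proof cases
          case 1 then show ?thesis using unch[OF kids[OF c(1)]] ch[OF c(1)] by blast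
        next
          case 2
          then consider "u \<in> kids c" | "u \<in> blk l" using A_split[OF 2(2)] cn False by auto
          then show ?thesis
          proof cases
            case 1
            then have "1 \<le> excess c" using bounded_kid step.IH[OF kids[OF c(1)]] c 2 by blast
            then show ?thesis using big kids c by blast
          next
            case b: 2
            then show ?thesis using unch[OF kids[OF b]] ch[OF b] 2 by blast
          qed
        qed
        then show ?thesis using x01 by simp
      qed
      then have "0 \<le> excess v" using excess local_cost by simp
      moreover have "ty v = (if odd (surplus ty v) then Full else Spare)"
        using kind_cases(3,4)[OF nl True] by auto
      ultimately show ?thesis using par local_cost d0 by (auto simp: bounded_def needy_def)
    next
      case nf: False
      then have local_cost: "local_cost v = 0" using nl by (simp add: local_cost_def)
      then have hx: "excess v = x + S" using excess by simp
      have emx: "int (emits v) \<le> x" using x dn0 by linarith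
      show ?thesis
      proof (cases "odd (surplus ty v)")
        case odd: True
        have ty: "ty v = Needy" using kind_cases(5)[OF nl nf odd] .
        have "int (emits v) - int (takes v) + 1 \<le> excess v"
          using par local_cost d0 odd hx emx S0 by (intro needy_slack) simp_all
        then show ?thesis using ty hx x01 S0 par local_cost d0 odd
          by (auto simp: bounded_def needy_def x_def)
      next
        case ev: False
        show ?thesis
        proof (cases "child_chosen ty v")
          case True
          then have "ty v = Dominated" using kind_cases(6)[OF nl nf] ev by simp
          then show ?thesis using hx x01 S0 par local_cost d0 ev by (auto simp: bounded_def needy_def x_def)
        next
          case na: False
          then have ty: "ty v = Undominated" using kind_cases(7)[OF nl nf] ev by simp
          have "1 \<le> excess v" if "c \<in> kids v" "c \<in> D" for c
            using unch[OF that] na that hx x01 by (auto simp: child_chosen_def)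
          then have "of_bool (\<exists>c \<in> kids v. c \<in> D) \<le> excess v" using hx x01 S0 by auto
          moreover have "of_bool (v \<in> D) \<le> excess v" using hx S0 by (simp add: x_def)
          ultimately show ?thesis using ty hx x01 S0 par local_cost d0 ev
            unfolding bounded_def needy_def by simp
        qed
      qed
    qed
  qed
qed

end

text \<open>No token can reach the root from above or leave it upwards. A needy or spare root
  therefore needs one more vertex, and an undominated root needs two, as they have to be
  paired.\<close>

definition (in rooted_blocks) root_cost :: nat where
  "root_cost = (case ty 0 of Undominated \<Rightarrow> 2 | Dominated \<Rightarrow> 0 | Full \<Rightarrow> 0 | _ \<Rightarrow> 1)"

definition (in rooted_blocks) optimum :: nat where
  "optimum = (\<Sum>v<n. local_cost v) + root_cost"

text \<open>With nothing emitted or taken at the root, the parity in \<open>bounded\<close> makes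
  the excess odd for a needy or spare root and even otherwise. Domination of an undominated root
  makes its excess positive, and parity then raises it to 2.\<close>

lemma (in meeting_places) optimum_le:
  assumes even: "\<And>z. z < n \<Longrightarrow> even (card {x \<in> D. f x = z})"
    and dom: "\<And>v. v < n \<Longrightarrow> v \<in> D \<or> (\<exists>u \<in> D. u \<in> A v)"
  shows "optimum \<le> card D"
proof -
  have n0: "0 < n" using two_le_n by simp
  have b: "bounded 0" using all_bounded[OF even dom n0] .
  have e: "emits 0 = 0" "takes 0 = 0"
    using root_props(2) by (simp_all add: emits_def takes_def)
  have "v \<in> D \<Longrightarrow> v < n" for v using D_sub by auto
  then have "(\<Sum>v<n. of_bool (v \<in> D)) = int (card D)"
    by (subst sum_of_bool_eq) (auto intro!: arg_cong[of _ _ card])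
  then have h0: "excess 0 = int (card D) - int (\<Sum>v<n. local_cost v)"
    unfolding excess_def by (subst sum_eq_subtree_sum[symmetric]) (simp add: sum_subtractf)
  have U: "1 \<le> excess 0" if U: "ty 0 = Undominated"
  proof (cases "0 \<in> D")
    case True
    moreover have "of_bool (0 \<in> D) \<le> excess 0" using b U unfolding bounded_def by blast
    ultimately show ?thesis by simp
  next
    case False
    then obtain u where "u \<in> D" "u \<in> A 0" using dom[OF n0] by blast
    then show ?thesis using bounded_kid[OF b U] A_split[of u 0] by blast
  qed
  have "even (excess 0 + of_bool (needy (ty 0)) + of_bool (ty 0 = Spare))" "0 \<le> excess 0"
    using b e unfolding bounded_def by simp_all
  moreover have "2 \<le> x \<longleftrightarrow> 1 \<le> x" "0 \<le> x" if "0 \<le> x" "even x" for x :: int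
    using that by presburger+
  moreover have "1 \<le> x" if "0 \<le> x" "odd x" for x :: int
    using that by presburger
  ultimately have "int root_cost \<le> excess 0"
    using U unfolding root_cost_def needy_def by (cases "ty 0") simp_all
  then show ?thesis using h0 unfolding optimum_def by linarith
qed

section \<open>The greedy solution\<close>

lemma exists_assignment:
  assumes "finite S" "finite T" "card T \<le> card S" "v \<notin> T"
  shows "\<exists>g. (\<forall>s \<in> S. g s \<in> insert v T) \<and> (\<forall>t \<in> T. card {s \<in> S. g s = t} = 1) \<and>
    card {s \<in> S. g s = v} = card S - card T"
proof -
  obtain S' where S': "S' \<subseteq> S" "card S' = card T" "finite S'"
    using obtain_subset_with_card_n[OF assms(3)] by blast
  obtain b where b: "bij_betw b S' T"
    using finite_same_card_bij[OF S'(3) assms(2) S'(2)] by blast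
  define g where "g s = (if s \<in> S' then b s else v)" for s
  have bT: "b s \<in> T" if "s \<in> S'" for s using b that by (auto simp: bij_betw_def)
  have "card {s \<in> S. g s = t} = 1" if "t \<in> T" for t
  proof -
    have "t \<in> b ` S'" using b that by (simp add: bij_betw_def)
    then obtain s where s: "s \<in> S'" "b s = t" by blast
    have "{s \<in> S. g s = t} = {s}"
      using s S' b assms(4) that unfolding g_def by (auto simp: bij_betw_def inj_on_def)
    then show ?thesis by simp
  qed
  moreover have "{s \<in> S. g s = v} = S - S'"
    using bT assms(4) S' unfolding g_def by auto
  then have "card {s \<in> S. g s = v} = card S - card T"
    using S' by (simp add: card_Diff_subset)
  ultimately show ?thesis using bT by (intro exI[of _ g]) (auto simp: g_def)
qed

context rooted_blocks begin

lemma kind_inv: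
  "ty v = Undominated \<Longrightarrow> \<not> lacking ty v \<and> even (surplus ty v) \<and> \<not> child_chosen ty v"
  "ty v = Dominated \<Longrightarrow> \<not> lacking ty v \<and> even (surplus ty v) \<and> child_chosen ty v"
  "ty v = Needy \<Longrightarrow> \<not> lacking ty v \<and> \<not> forced ty v \<and> odd (surplus ty v)"
  "ty v = Spare \<Longrightarrow> \<not> lacking ty v \<and> forced ty v \<and> even (surplus ty v)"
  "ty v = Full \<Longrightarrow> lacking ty v \<and> even (surplus ty v) \<or> \<not> lacking ty v \<and> forced ty v \<and> odd (surplus ty v)"
  "ty v = Full_Needy \<Longrightarrow> lacking ty v \<and> odd (surplus ty v)"
  by (subst (asm) ty_eq; simp add: kind_rule_def kind_of_def split: if_splits)+

lemma block_adj:
  assumes "l \<in> leads v" "y \<in> insert v (blk l)" "z \<in> insert v (blk l)" "y \<noteq> z"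
  shows "z \<in> A y"
proof -
  have "c \<in> A v" "v \<in> A c" if "c \<in> blk l" for c
    using that blk_kids[OF assms(1)] kids_A[of c v] by auto
  moreover have "z \<in> A y" if "y \<in> blk l" "z \<in> blk l"
    using that assms(4) block_clique[of y z] by (auto simp: blk_def)
  ultimately show ?thesis using assms by auto
qed

text \<open>The parent of the non-root vertex with the smallest position has a smaller position
  still, so it is the root.\<close>

lemma kids_root_nonempty: "kids 0 \<noteq> {}"
proof -
  have "1 \<in> {0<..<n}" using two_le_n by simp
  then have "finite {0<..<n}" "{0<..<n} \<noteq> {}" by blast+
  then obtain v where v: "v \<in> {0<..<n}" "\<And>w. w \<in> {0<..<n} \<Longrightarrow> pos v \<le> pos w"
    using ex_is_arg_min_if_finite[of "{0<..<n}" pos] by (auto simp: is_arg_min_linorder)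
  have "par v < n" using v par_A[of v] A_range[of "par v" v] by auto
  then have "par v = 0" using v(2)[of "par v"] pos_par[of v] v(1) by force
  then show ?thesis using v(1) by (auto simp: kids_def)
qed

end

text \<open>The flag \<open>fx\<close> marks the needy vertices whose partner is found within their own subtree,
  at the price of one further chosen vertex.\<close>

locale fixing = rooted_blocks +
  fixes fx :: "nat \<Rightarrow> bool"
  assumes fx_needy: "v < n \<Longrightarrow> fx v \<Longrightarrow> needy (ty v)"
    and fx_root: "needy (ty 0) \<Longrightarrow> fx 0"
    and fx_le: "l \<in> leads v \<Longrightarrow> card {c \<in> blk l. fx c} \<le> ncount ty l - ecount ty l"
    and fx_kids: "v < n \<Longrightarrow> card {c \<in> kids v. fx c} + of_bool (lacking ty v \<and> \<not> fx v) = deficit ty v"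
begin

text \<open>A fixed \<open>Needy\<close> vertex joins the set and its token stays at home. A fixed
  \<open>Full_Needy\<close> vertex belongs to the set anyway; it keeps its token at home, and by
  \<open>fx_kids\<close> one more of its children is fixed instead.\<close>

definition core :: "nat set" where
  "core = {v. v < n \<and> (chosen (ty v) \<or> ty v = Needy \<and> fx v)}"

lemma fin_core [simp]: "finite core" by (simp add: core_def)

text \<open>The greedy cost already pays for each missing token once: for the parent that lends its
  token, or for a fixed child. A fix of \<open>v\<close> itself adds exactly one vertex:
  \<open>v\<close> if it is \<open>Needy\<close>, and otherwise the additional vertex of one more
  fixed child.\<close>

lemma subtree_core:
  assumes "v < n"
  shows "subtree_sum (\<lambda>v. of_bool (v \<in> core) - int (local_cost v)) v = of_bool (fx v)"
  using assms
proof (induction v rule: kids_induct)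
  case (step v)
  have "(\<Sum>c \<in> kids v. subtree_sum (\<lambda>v. of_bool (v \<in> core) - int (local_cost v)) c) = (\<Sum>c \<in> kids v. of_bool (fx c))"
    by (rule sum.cong) (use step.IH in auto)
  also have "\<dots> = int (card {c \<in> kids v. fx c})" by (simp add: Int_def)
  finally have eq: "subtree_sum (\<lambda>v. of_bool (v \<in> core) - int (local_cost v)) v =
     of_bool (v \<in> core) - int (local_cost v) + int (card {c \<in> kids v. fx c})"
    by (subst subtree_sum_eq) simp
  have fk: "int (card {c \<in> kids v. fx c}) + of_bool (lacking ty v \<and> \<not> fx v) = int (deficit ty v)"
    using arg_cong[OF fx_kids[OF step.hyps], of int] by simp
  have d: "lacking ty v \<longleftrightarrow> 0 < deficit ty v" by (rule deficit_pos)
  have nf: "fx v \<Longrightarrow> needy (ty v)" using fx_needy[OF step.hyps] .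
  have "of_bool (v \<in> core) - int (local_cost v) + int (card {c \<in> kids v. fx c}) = of_bool (fx v)"
    unfolding local_cost_def using fk d nf kind_inv[of v] ty_chosen[of v] step.hyps
    by (cases "ty v"; cases "lacking ty v"; cases "fx v")
      (auto simp: core_def chosen_def needy_def)
  then show ?case by (simp only: eq)
qed

lemma card_core: "card core = (\<Sum>v<n. local_cost v) + of_bool (fx 0)"
proof -
  have "v \<in> core \<Longrightarrow> v < n" for v by (simp add: core_def)
  then have "(\<Sum>v<n. of_bool (v \<in> core)) = int (card core)"
    by (subst sum_of_bool_eq) (auto intro!: arg_cong[of _ _ card])
  then have "int (card core) - int (\<Sum>v<n. local_cost v) = of_bool (fx 0)"
    using subtree_core[of 0] two_le_n
    by (simp add: sum_eq_subtree_sum[symmetric] sum_subtractf)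
  then have "int (card core) = int ((\<Sum>v<n. local_cost v) + of_bool (fx 0))" by simp
  then show ?thesis by (simp only: of_nat_eq_iff)
qed

lemma core_dominates:
  assumes "v < n" "v \<notin> core" "v \<noteq> 0 \<or> ty v \<noteq> Undominated"
  shows "\<exists>u \<in> core. u \<in> A v"
proof -
  have nc: "\<not> chosen (ty v)" using assms by (simp add: core_def)
  have kid: "\<exists>u \<in> core. u \<in> A v" if "c \<in> kids v" "chosen (ty c)" for c
    using that kids_A[of c v] by (auto simp: core_def kids_def)
  show ?thesis
  proof (cases "ty v")
    case Undominated
    then have v: "v \<in> kids (par v)" "v \<noteq> 0" using assms by (auto simp: kids_def)
    have p: "par v < n" "par v \<in> A v" using kids_less[OF v(1)] kids_A[OF v(1)] by auto
    have l: "ld v \<in> leads (par v)" "v \<in> blk (ld v)" using ld_leads[OF v(1)] by auto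
    show ?thesis
    proof (cases "\<exists>c \<in> blk (ld v). chosen (ty c)")
      case True
      then obtain c where c: "c \<in> blk (ld v)" "chosen (ty c)" by blast
      then have "c \<in> core" "c \<noteq> v" using nc by (auto simp: core_def blk_def)
      then show ?thesis using block_adj[OF l(1), of v c] c l by auto
    next
      case False
      then have "forced ty (par v)" using l Undominated by (auto simp: forced_def)
      then have "par v \<in> core" using ty_chosen p by (auto simp: core_def)
      then show ?thesis using p by blast
    qed
  next
    case Dominated
    then show ?thesis using kind_inv(2)[of v] kid by (auto simp: child_chosen_def)
  next
    case Needy
    \<comment> \<open>An odd surplus is positive, so some block below contains a
      \<open>Spare\<close> child; it is chosen and dominates \<open>v\<close>.\<close>
    then have "surplus ty v \<noteq> 0" using kind_inv(3)[of v] by (metis even_zero)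
    from sum.not_neutral_contains_not_neutral[OF this[unfolded surplus_def]]
    obtain l where l: "l \<in> leads v" "ecount ty l - ncount ty l \<noteq> 0" .
    then have "ecount ty l \<noteq> 0" by simp
    then have "{c \<in> blk l. ty c = Spare} \<noteq> {}" unfolding ecount_def by (intro notI) simp
    then obtain c where "c \<in> blk l" "ty c = Spare" by auto
    then show ?thesis using kid[of c] blk_kids[OF l(1)] by (auto simp: chosen_def)
  qed (use nc in \<open>auto simp: chosen_def\<close>)
qed

text \<open>The missing tokens of the block that no fix accounts for, which the token of the parent
  has to supply. By \<open>used_sum\<close> there is at most one of them in all blocks below a
  vertex together.\<close>

definition used :: "nat \<Rightarrow> nat" where
  "used l = ncount ty l - ecount ty l - card {c \<in> blk l. fx c}"

lemma used_sum:
  assumes "v < n"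
  shows "(\<Sum>l \<in> leads v. used l) = of_bool (lacking ty v \<and> \<not> fx v)"
proof -
  have "(\<Sum>l \<in> leads v. card {c \<in> blk l. fx c}) = card {c \<in> kids v. fx c}"
    using sum_kids[of "\<lambda>c. of_bool (fx c) :: nat" v] by (simp add: Int_def)
  moreover have "(\<Sum>l \<in> leads v. used l) + (\<Sum>l \<in> leads v. card {c \<in> blk l. fx c}) = deficit ty v"
    unfolding deficit_def sum.distrib[symmetric]
  proof (rule sum.cong)
    fix l assume "l \<in> leads v"
    from fx_le[OF this] show "used l + card {c \<in> blk l. fx c} = ncount ty l - ecount ty l"
      by (simp add: used_def)
  qed simp
  ultimately show ?thesis using fx_kids[OF assms] by simp
qed

lemma leads_n: "l \<in> leads v \<Longrightarrow> v < n"
  using kids_less[of l v] by (auto simp: leads_def)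

lemma used_pos:
  assumes "l \<in> leads v" "0 < used l"
  shows "lacking ty v" "\<not> fx v" "used l = 1" "\<And>l'. l' \<in> leads v \<Longrightarrow> 0 < used l' \<Longrightarrow> l' = l"
proof -
  note s = used_sum[OF leads_n[OF assms(1)]]
  have u: "used l \<le> (\<Sum>l \<in> leads v. used l)" by (rule member_le_sum) (use assms in auto)
  then show "lacking ty v" "\<not> fx v" "used l = 1"
    using s assms(2) by (cases "lacking ty v \<and> \<not> fx v"; simp)+
  show "l' = l" if "l' \<in> leads v" "0 < used l'" for l'
  proof (rule ccontr)
    assume "l' \<noteq> l"
    then have "used l' + used l = (\<Sum>l \<in> {l', l}. used l)" by simp
    also have "\<dots> \<le> (\<Sum>l \<in> leads v. used l)" by (rule sum_mono2) (use assms that in auto)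
    finally show False using s assms(2) that(2) by (cases "lacking ty v \<and> \<not> fx v") simp_all
  qed
qed

section \<open>Routing the tokens within each block\<close>

definition src :: "nat \<Rightarrow> nat set" where
  "src l = {c \<in> blk l. ty c = Spare} \<union> (if 0 < used l then {par l} else {})"

definition tgt :: "nat \<Rightarrow> nat set" where
  "tgt l = {c \<in> blk l. needy (ty c) \<and> \<not> fx c}"

text \<open>Sources exceed targets by the surplus of the block. If the parent supplies a token there
  is no excess, so nothing returns to the parent.\<close>

lemma card_src_tgt:
  assumes l: "l \<in> leads v"
  shows "card (tgt l) \<le> card (src l)" "card (src l) - card (tgt l) = ecount ty l - ncount ty l"
    "0 < used l \<Longrightarrow> card (src l) = card (tgt l)"
proof -
  have v: "par l = v" "v \<notin> blk l" using l blk_kids[OF l] kids_notself[of v v] by (auto simp: leads_def kids_def)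
  have "card (src l) = ecount ty l + used l"
    using v used_pos[OF l] by (auto simp: src_def ecount_def)
  moreover have "card (tgt l) + card {c \<in> blk l. fx c} = ncount ty l"
    unfolding tgt_def ncount_def using fx_needy
    by (subst card_Un_disjoint[symmetric]) (auto intro!: arg_cong[of _ _ card] simp: blk_def)
  ultimately show "card (tgt l) \<le> card (src l)" "card (src l) - card (tgt l) = ecount ty l - ncount ty l"
    "0 < used l \<Longrightarrow> card (src l) = card (tgt l)"
    using fx_le[OF l] unfolding used_def by auto
qed

definition assignment :: "nat \<Rightarrow> nat \<Rightarrow> nat" where
  "assignment l = (SOME g. (\<forall>s \<in> src l. g s \<in> insert (par l) (tgt l)) \<and>
     (\<forall>t \<in> tgt l. card {s \<in> src l. g s = t} = 1) \<and>
     card {s \<in> src l. g s = par l} = card (src l) - card (tgt l))"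

lemma assignment:
  assumes l: "l \<in> leads v"
  shows "s \<in> src l \<Longrightarrow> assignment l s \<in> insert v (tgt l)"
    "t \<in> tgt l \<Longrightarrow> card {s \<in> src l. assignment l s = t} = 1"
    "card {s \<in> src l. assignment l s = v} = ecount ty l - ncount ty l"
    "s \<in> src l \<Longrightarrow> assignment l s \<noteq> s"
proof -
  have v: "par l = v" "v \<notin> blk l" using l blk_kids[OF l] kids_notself[of v v] by (auto simp: leads_def kids_def)
  have f: "finite (src l)" "finite (tgt l)" by (auto simp: src_def tgt_def)
  have "par l \<notin> tgt l" using v by (auto simp: tgt_def)
  from someI_ex[OF exists_assignment[OF f card_src_tgt(1)[OF l] this], folded assignment_def] v(1)
  have *: "\<forall>s \<in> src l. assignment l s \<in> insert v (tgt l)" "\<forall>t \<in> tgt l. card {s \<in> src l. assignment l s = t} = 1"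
    "card {s \<in> src l. assignment l s = v} = card (src l) - card (tgt l)" by auto
  then show "s \<in> src l \<Longrightarrow> assignment l s \<in> insert v (tgt l)"
    "t \<in> tgt l \<Longrightarrow> card {s \<in> src l. assignment l s = t} = 1"
    "card {s \<in> src l. assignment l s = v} = ecount ty l - ncount ty l"
    using card_src_tgt(2)[OF l] by auto
  show "assignment l s \<noteq> s" if s: "s \<in> src l"
  proof
    assume a: "assignment l s = s"
    then have "s \<in> insert v (tgt l)" using * s by force
    moreover have "s \<notin> tgt l" using s v by (auto simp: src_def tgt_def needy_def split: if_splits)
    ultimately have "s = v" by blast
    \<comment> \<open>A source equal to the parent is present only if its token is used; then
      sources and targets are equally many, and no token can end at the parent.\<close>
    then have "0 < used l" "{s \<in> src l. assignment l s = v} \<noteq> {}"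
      using s v a by (auto simp: src_def split: if_splits)
    then show False using *(3) card_src_tgt(3)[OF l] f by auto
  qed
qed

definition place :: "nat \<Rightarrow> nat" where
  "place y = (if ty y = Spare \<and> y \<noteq> 0 then assignment (ld y) y
     else if \<exists>l \<in> leads y. 0 < used l then assignment (SOME l. l \<in> leads y \<and> 0 < used l) y else y)"

lemma src_core:
  assumes "l \<in> leads v" "y \<in> src l"
  shows "y \<in> core" "place y = assignment l y"
proof -
  have v: "par l = v" using assms by (auto simp: leads_def kids_def)
  consider "y \<in> blk l" "ty y = Spare" | "y = v" "0 < used l"
    using assms v by (auto simp: src_def split: if_splits)
  then have "y \<in> core \<and> place y = assignment l y"
  proof cases
    case 1
    then show ?thesis by (auto simp: place_def core_def blk_def chosen_def)
  next
    case 2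
    note u = used_pos[OF assms(1) 2(2)]
    have "(SOME l. l \<in> leads y \<and> 0 < used l) = l"
    proof (rule some_equality)
      show "l \<in> leads y \<and> 0 < used l" using assms(1) 2 by simp
    qed (use u(4) 2 in blast)
    moreover have "ty y \<noteq> Spare" using u(1) 2(1) kind_inv(4)[of v] by blast
    moreover have "\<exists>l \<in> leads y. 0 < used l" using assms(1) 2 by blast
    ultimately have "place y = assignment l y" by (simp add: place_def)
    moreover have "y \<in> core" using 2(1) ty_chosen(1)[OF u(1)] leads_n[OF assms(1)] by (simp add: core_def)
    ultimately show ?thesis by blast
  qed
  then show "y \<in> core" "place y = assignment l y" by auto
qed

lemma place_cases:
  assumes "y < n"
  obtains "place y = y" "\<not> (ty y = Spare \<and> y \<noteq> 0)" "\<not> (lacking ty y \<and> \<not> fx y)"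
  | l v where "l \<in> leads v" "y \<in> src l" "place y = assignment l y"
      "ty y = Spare \<and> y \<noteq> 0 \<or> lacking ty y \<and> \<not> fx y"
proof (cases "ty y = Spare \<and> y \<noteq> 0")
  case True
  then have "y \<in> kids (par y)" using assms by (auto simp: kids_def)
  from ld_leads[OF this] have "ld y \<in> leads (par y)" "y \<in> src (ld y)" using True by (auto simp: src_def)
  then show ?thesis using that(2) src_core True by blast
next
  case False
  note u = used_sum[OF assms]
  show ?thesis
  proof (cases "\<exists>l \<in> leads y. 0 < used l")
    case True
    then obtain l where l: "l \<in> leads y" "0 < used l" by blast
    then have "y \<in> src l" by (auto simp: src_def leads_def kids_def)
    then show ?thesis using that(2) src_core[OF l(1)] used_pos[OF l] l by blast
  next
    case nu: False
    then have "(\<Sum>l \<in> leads y. used l) = 0" by simp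
    then have "\<not> (lacking ty y \<and> \<not> fx y)" using u by (auto split: if_splits)
    moreover have "place y = y" using False nu by (auto simp: place_def)
    ultimately show ?thesis using that(1) False by blast
  qed
qed

text \<open>The greedy set with its routing is itself an instance of the token locale, so that
  \<open>tokens_at\<close>, proved for arbitrary solutions, also counts its fibres.\<close>

sublocale meeting_places n A par ld pos core place
proof unfold_locales
  show "core \<subseteq> {..<n}" by (auto simp: core_def)
  fix y assume "y \<in> core"
  then have "y < n" by (simp add: core_def)
  then show "place y = y \<or> place y \<in> A y"
  proof (cases rule: place_cases)
    case (2 l v)
    then have p: "place y \<in> insert v (blk l)" using assignment(1)[OF 2(1,2)] by (auto simp: tgt_def)
    have y: "y \<in> insert v (blk l)"
      using 2(1,2) by (auto simp: src_def leads_def kids_def split: if_splits)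
    have "y \<noteq> place y" using assignment(4)[OF 2(1,2)] 2(3) by simp
    from block_adj[OF 2(1) y p this] show ?thesis ..
  qed simp
qed

text \<open>Two distinct blocks share at most one vertex, so the two ends of a move determine its
  block. In terms of positions: if both ends lay in two blocks, each of the two parents would be a
  child in the other block and so come after the other parent.\<close>

lemma toks_src:
  assumes l: "l \<in> leads v"
  shows "toks l = src l"
proof (intro equalityI subsetI)
  have v: "par l = v" using l by (auto simp: leads_def kids_def)
  fix y
  {
    assume y: "y \<in> src l"
    then show "y \<in> toks l"
      using src_core[OF l y] assignment(1,4)[OF l y] v
      by (auto simp: toks_def src_def tgt_def split: if_splits)
  next
    assume y: "y \<in> toks l"
    then have "y \<in> core" and y': "place y \<noteq> y" "y \<in> insert v (blk l)" "place y \<in> insert v (blk l)"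
      using v by (simp_all add: toks_def)
    then have "y < n" by (simp add: core_def)
    from \<open>y < n\<close> show "y \<in> src l"
    proof (cases rule: place_cases)
      case 1 then show ?thesis using y' by blast
    next
      case (2 l' v')
      have m: "place y \<in> insert v' (blk l')" using assignment(1)[OF 2(1,2)] 2(3) by (auto simp: tgt_def)
      have m': "y \<in> insert v' (blk l')"
        using 2(1,2) by (auto simp: src_def leads_def kids_def split: if_splits)
      have "l' = l"
      proof (rule ccontr)
        assume "l' \<noteq> l"
        have *: "c \<in> blk l \<Longrightarrow> pos v < pos c" "c \<in> blk l' \<Longrightarrow> pos v' < pos c"
          "c \<in> blk l \<Longrightarrow> c \<notin> blk l'" for c
          using blk_kids[OF l] blk_kids[OF 2(1)] pos_par[of c] \<open>l' \<noteq> l\<close>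
          by (auto simp: kids_def blk_def)
        show False
          using m m' y' *[of y] *[of "place y"]
          by (cases "y \<in> blk l"; cases "y \<in> blk l'"; cases "place y \<in> blk l"; cases "place y \<in> blk l'")
            simp_all
      qed
      then show ?thesis using 2 by simp
    qed
  }
qed

lemma card_fibre:
  assumes v: "v < n"
  shows "card {x \<in> core. place x = v} =
    of_bool (v \<in> core \<and> \<not> (ty v = Spare \<and> v \<noteq> 0) \<and> \<not> (lacking ty v \<and> \<not> fx v)) +
    of_bool (needy (ty v) \<and> \<not> fx v) + surplus ty v"
proof -
  have "place v = v \<longleftrightarrow> \<not> (ty v = Spare \<and> v \<noteq> 0) \<and> \<not> (lacking ty v \<and> \<not> fx v)"
    using v
  proof (cases rule: place_cases)
    case (2 l v')
    then show ?thesis using assignment(4)[OF 2(1,2)] by auto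
  qed simp
  then have 1: "stays v = of_bool (v \<in> core \<and> \<not> (ty v = Spare \<and> v \<noteq> 0) \<and> \<not> (lacking ty v \<and> \<not> fx v))"
    by (simp add: stays_def)
  have "up l = ecount ty l - ncount ty l" if l: "l \<in> leads v" for l
  proof -
    have "{y \<in> src l. place y = v} = {y \<in> src l. assignment l y = v}"
      using src_core(2)[OF l] by auto
    then show ?thesis using assignment(3)[OF l] leads_par[OF l] by (simp add: up_def toks_src[OF l])
  qed
  then have 2: "(\<Sum>l \<in> leads v. up l) = surplus ty v" by (simp add: surplus_def)
  have 3: "takes v = of_bool (needy (ty v) \<and> \<not> fx v)"
  proof (cases "v = 0")
    case True
    then show ?thesis using fx_root root_props(2) by (auto simp: takes_def)
  next
    case False
    then have k: "v \<in> kids (par v)" using v by (simp add: kids_def)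
    define L where "L = ld v"
    have L: "L \<in> leads (par v)" "v \<in> blk L" using ld_leads[OF k] by (auto simp: L_def)
    have ne: "v \<noteq> par v" using k kids_notself by blast
    have "{y \<in> src L. place y = v} = {y \<in> src L. assignment L y = v}"
      using src_core(2)[OF L(1)] by (intro Collect_cong conj_cong refl) simp
    then have t: "takes v = card {y \<in> src L. assignment L y = v}"
      by (simp add: takes_def toks_src[OF L(1), unfolded L_def] L_def)
    have m: "v \<in> tgt L \<longleftrightarrow> needy (ty v) \<and> \<not> fx v" using L by (simp add: tgt_def)
    show ?thesis
    proof (cases "v \<in> tgt L")
      case True
      then show ?thesis using assignment(2)[OF L(1) True] t m by simp
    next
      case False
      then have "{y \<in> src L. assignment L y = v} = {}"
        using assignment(1)[OF L(1)] ne by blast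
      then have "takes v = 0" unfolding t by (simp only: card.empty)
      then show ?thesis using m False by simp
    qed
  qed
  show ?thesis by (simp only: tokens_at[OF v] 1 2 3)
qed

text \<open>A spare root is the only exception, because there is no block above it in which its
  token could find a partner.\<close>

lemma even_fibre:
  assumes v: "v < n" 
  shows "even (card {x \<in> core. place x = v}) \<longleftrightarrow> \<not> (v = 0 \<and> ty v = Spare)"
  unfolding card_fibre[OF v]
  using kind_inv[of v] v fx_needy[OF v]
  by (cases "ty v") (auto simp: core_def needy_def chosen_def)

text \<open>For an undominated or spare root, a child \<open>w\<close> outside \<open>core\<close>
  sends its token to the root and meets the token of the root there. A spare root is already in
  \<open>core\<close>, so the set grows by one vertex; an undominated one is not, and it grows by
  two.\<close>

theorem fixing_optimal:
  assumes w: "ty 0 = Undominated \<or> ty 0 = Spare \<Longrightarrow> w \<in> kids 0 \<and> w \<notin> core"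
    and D: "D = (if ty 0 = Undominated \<or> ty 0 = Spare then insert 0 (insert w core) else core)"
  shows "card D = optimum" "\<And>v. v < n \<Longrightarrow> v \<in> D \<or> (\<exists>u \<in> D. u \<in> A v)"
    "D \<subseteq> {..<n}" "\<exists>f. (\<forall>x \<in> D. f x = x \<or> f x \<in> A x) \<and> (\<forall>z<n. even (card {x \<in> D. f x = z}))"
proof -
  have n0: "0 < n" using two_le_n by simp
  have c0: "0 \<in> core \<longleftrightarrow> ty 0 \<noteq> Undominated" if "ty 0 = Undominated \<or> ty 0 = Spare"
    using that n0 by (auto simp: core_def chosen_def)
  have nfx: "\<not> fx 0" if "\<not> needy (ty 0)" using that fx_needy n0 by blast
  have w0: "w \<noteq> 0" if "ty 0 = Undominated \<or> ty 0 = Spare" using w[OF that] by (auto simp: kids_def)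
  show "card D = optimum"
    using c0 w w0 fx_root nfx
    by (cases "ty 0") (simp_all add: D optimum_def root_cost_def card_core needy_def insert_absorb)
  show "v \<in> D \<or> (\<exists>u \<in> D. u \<in> A v)" if "v < n" for v
  proof (cases "v \<in> D")
    case False
    then have "v \<notin> core" "v \<noteq> 0 \<or> ty v \<noteq> Undominated" by (auto simp: D split: if_splits)
    with core_dominates[OF that] obtain u where "u \<in> core" "u \<in> A v" by blast
    then show ?thesis by (auto simp: D)
  qed simp
  show "D \<subseteq> {..<n}" using D_sub w n0 by (auto simp: D kids_def)
  show "\<exists>f. (\<forall>x \<in> D. f x = x \<or> f x \<in> A x) \<and> (\<forall>z<n. even (card {x \<in> D. f x = z}))"
  proof (cases "ty 0 = Undominated \<or> ty 0 = Spare")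
    case False
    then show ?thesis using f_near even_fibre by (intro exI[of _ place]) (auto simp: D)
  next
    case True
    have w: "w \<in> kids 0" "w \<notin> core" "w \<noteq> 0" "0 \<in> A w" using w[OF True] w0[OF True] kids_A by auto
    have p0: "place 0 = 0"
      using n0
    proof (cases rule: place_cases)
      case (2 l v)
      then show ?thesis using True kind_inv(1,4)[of 0] by auto
    qed
    define f where "f = place(w := 0)"
    have f: "f 0 = 0" "f w = 0" "\<And>x. x \<in> core \<Longrightarrow> f x = place x" using w p0 by (auto simp: f_def)
    have "even (card {x \<in> D. f x = z})" if "z < n" for z
    proof (cases "z = 0")
      case False
      then have "{x \<in> D. f x = z} = {x \<in> core. place x = z}" using f True by (auto simp: D)
      then show ?thesis using even_fibre[OF that] False by simp
    next
      case z: True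
      have eq: "{x \<in> D. f x = z} = insert 0 (insert w {x \<in> core. place x = 0})" using f True z by (auto simp: D)
      show ?thesis unfolding eq
        using True c0 even_fibre[OF n0] w p0 by (auto simp: insert_absorb)
    qed
    moreover have "f x = x \<or> f x \<in> A x" if "x \<in> D" for x
      using that f(1,2) f(3)[of x] f_near[of x] w True by (auto simp: D)
    ultimately show ?thesis by blast
  qed
qed

text \<open>No child of an undominated root is chosen, and without a deficit none is fixed. A spare
  root is forced, so it has an undominated child, which is outside \<open>core\<close>.\<close>

lemma exists_extra:
  assumes "ty 0 = Undominated \<or> ty 0 = Spare"
  shows "\<exists>w \<in> kids 0. w \<notin> core"
  using assms
proof
  assume U: "ty 0 = Undominated"
  then have "card {c \<in> kids 0. fx c} = 0"
    using fx_kids[of 0] two_le_n kind_inv(1)[of 0] deficit_pos[of ty 0] by simp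
  then have "\<forall>c \<in> kids 0. \<not> fx c" by simp
  moreover obtain w where "w \<in> kids 0" using kids_root_nonempty by blast
  ultimately show ?thesis using kind_inv(1)[OF U] by (auto simp: core_def child_chosen_def)
next
  assume "ty 0 = Spare"
  then obtain l c where "l \<in> leads 0" "c \<in> blk l" "ty c = Undominated"
    using kind_inv(4)[of 0] by (auto simp: forced_def)
  then show ?thesis using blk_kids by (intro bexI[of _ c]) (auto simp: core_def chosen_def)
qed

end

section \<open>Block graphs\<close>

text \<open>The parent of a vertex is its earliest neighbour in the order of discovery. In any such search tree
  the two ends of an edge which is not a tree edge are siblings, because the tree path between
  them closes a cycle and its vertices form a clique.\<close>

locale search_tree =
  fixes n :: nat and A :: "nat \<Rightarrow> nat set" and ord par :: "nat \<Rightarrow> nat"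
  assumes two_le_n: "2 \<le> n"
    and A_range: "v \<in> A u \<Longrightarrow> u < n \<and> v < n"
    and A_sym: "v \<in> A u \<Longrightarrow> u \<in> A v"
    and A_irrefl: "v \<notin> A v"
    and cycle_clique: "\<lbrakk>distinct cs; 3 \<le> length cs; successively (\<lambda>u v. v \<in> A u) cs; hd cs \<in> A (last cs);
       u \<in> set cs; v \<in> set cs; u \<noteq> v\<rbrakk> \<Longrightarrow> v \<in> A u"
    and ord_bij: "bij_betw ord {..<n} {..<n}"
    and ord_0: "ord 0 = 0"
    and par_root: "par 0 = n"
    and par_ord: "0 < k \<Longrightarrow> k < n \<Longrightarrow>
       \<exists>j<k. par (ord k) = ord j \<and> ord k \<in> A (ord j) \<and> (\<forall>i<j. ord k \<notin> A (ord i))"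
begin

section \<open>Positions and paths in the search tree\<close>

definition pos :: "nat \<Rightarrow> nat" where
  "pos = inv_into {..<n} ord"

lemma pos_ord [simp]: "k < n \<Longrightarrow> pos (ord k) = k"
  using ord_bij by (simp add: pos_def bij_betw_inv_into_left)

lemma ord_pos [simp]: "v < n \<Longrightarrow> ord (pos v) = v"
  using ord_bij by (simp add: pos_def bij_betw_inv_into_right)

lemma pos_less: "v < n \<Longrightarrow> pos v < n"
  using bij_betw_inv_into[OF ord_bij] by (auto simp: pos_def bij_betw_def)

lemma pos_inj: "u < n \<Longrightarrow> v < n \<Longrightarrow> pos u = pos v \<Longrightarrow> u = v"
  using ord_pos by metis

lemma pos_0: "pos 0 = 0"
  using pos_ord[of 0] ord_0 two_le_n by simp

lemma par_props:
  assumes "0 < v" "v < n"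
  shows "par v \<in> A v" "par v < n" "pos (par v) < pos v" "u \<in> A v \<Longrightarrow> pos (par v) \<le> pos u"
proof -
  have "pos v \<noteq> 0" using assms pos_inj[of v 0] pos_0 by auto
  then obtain j where j: "j < pos v" "par v = ord j" "v \<in> A (ord j)" "\<And>i. i < j \<Longrightarrow> v \<notin> A (ord i)"
    using par_ord[of "pos v"] assms pos_less by auto
  then show "par v \<in> A v" "par v < n" using A_sym A_range by auto
  have jn: "j < n" using j(1) pos_less[OF assms(2)] by simp
  show "pos (par v) < pos v" using j jn by simp
  show "pos (par v) \<le> pos u" if "u \<in> A v"
  proof (rule ccontr)
    assume "\<not> pos (par v) \<le> pos u"
    then have "pos u < j" using j jn by simp
    then show False using j(4)[of "pos u"] A_sym[OF that] A_range[OF that] by simp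
  qed
qed

text \<open>The end with the larger position is replaced by its parent until both ends coincide;
  \<open>a\<close> is the vertex where they meet. The bound by \<open>max\<close> shows that the
  replaced end is not yet on the path.\<close>

lemma tree_path:
  assumes "v < n" "w < n"
  shows "\<exists>L a. distinct L \<and> successively (\<lambda>u v. v \<in> A u) L \<and> L \<noteq> [] \<and> hd L = v \<and> last L = w \<and>
    a \<in> set L \<and> set L \<subseteq> {..<n} \<and> (\<forall>x \<in> set L. pos a \<le> pos x \<and> pos x \<le> max (pos v) (pos w)) \<and>
    (v \<noteq> a \<longrightarrow> par v \<in> set L) \<and> (w \<noteq> a \<longrightarrow> par w \<in> set L)"
  using assms
proof (induction "pos v + pos w" arbitrary: v w rule: less_induct)
  case less
  consider "v = w" | "pos v < pos w" | "pos w < pos v"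
    using pos_inj less.prems by fastforce
  then show ?case
  proof cases
    case 1
    then show ?thesis using less.prems by (intro exI[of _ "[v]"] exI[of _ v]) auto
  next
    case 2
    then have w: "0 < w" using pos_0 by (cases w) auto
    note p = par_props[OF w less.prems(2)]
    obtain L a where L: "distinct L" "successively (\<lambda>u v. v \<in> A u) L" "L \<noteq> []" "hd L = v" "last L = par w"
      "a \<in> set L" "set L \<subseteq> {..<n}" "\<forall>x \<in> set L. pos a \<le> pos x \<and> pos x \<le> max (pos v) (pos (par w))"
      "v \<noteq> a \<longrightarrow> par v \<in> set L"
      using less.hyps[of v "par w"] less.prems p by auto
    have "w \<notin> set L" using L(8) 2 p(3) by (auto simp: not_le)
    moreover have "par w \<in> set L" using L(3,5) last_in_set by metis
    moreover have "pos a \<le> pos w" using L(6,8) 2 p(3) by fastforce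
    moreover have "pos x \<le> max (pos v) (pos w)" if "x \<in> set L" for x using that L(8) p(3) by fastforce
    ultimately show ?thesis using L less.prems A_sym[OF p(1)]
      by (intro exI[of _ "L @ [w]"] exI[of _ a]) (auto simp: successively_append_iff)
  next
    case 3
    then have v: "0 < v" using pos_0 by (cases v) auto
    note p = par_props[OF v less.prems(1)]
    obtain L a where L: "distinct L" "successively (\<lambda>u v. v \<in> A u) L" "L \<noteq> []" "hd L = par v" "last L = w"
      "a \<in> set L" "set L \<subseteq> {..<n}" "\<forall>x \<in> set L. pos a \<le> pos x \<and> pos x \<le> max (pos (par v)) (pos w)"
      "w \<noteq> a \<longrightarrow> par w \<in> set L"
      using less.hyps[of "par v" w] less.prems p by auto
    have "v \<notin> set L" using L(8) 3 p(3) by (auto simp: not_le)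
    moreover have "par v \<in> set L" using L(3,4) hd_in_set by metis
    moreover have "pos a \<le> pos v" using L(6,8) 3 p(3) by fastforce
    moreover have "pos x \<le> max (pos v) (pos w)" if "x \<in> set L" for x using that L(8) p(3) by fastforce
    ultimately show ?thesis using L less.prems p(1)
      by (intro exI[of _ "v # L"] exI[of _ a]) (auto simp: successively_Cons)
  qed
qed

lemma edge_cases:
  assumes e: "v \<in> A w"
  shows "(0 < w \<and> par w = v) \<or> (0 < v \<and> par v = w) \<or> (0 < w \<and> 0 < v \<and> par w = par v)"
proof -
  have n: "v < n" "w < n" and ne: "v \<noteq> w" using A_range[OF e] A_irrefl e by auto
  obtain L a where L: "distinct L" "successively (\<lambda>u v. v \<in> A u) L" "L \<noteq> []" "hd L = v" "last L = w"
      "a \<in> set L" "set L \<subseteq> {..<n}" "\<forall>x \<in> set L. pos a \<le> pos x"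
      "v \<noteq> a \<longrightarrow> par v \<in> set L" "w \<noteq> a \<longrightarrow> par w \<in> set L"
    using tree_path[OF n] by blast
  have mem: "v \<in> set L" "w \<in> set L" using L(3-5) by auto
  have clique: "y \<in> A x" if "x \<in> set L" "y \<in> set L" "x \<noteq> y" for x y
  proof (cases "3 \<le> length L")
    case True
    then show ?thesis using cycle_clique[OF L(1) True L(2)] L(4,5) e that by auto
  next
    case False
    then have "L = [v, w]" using L(3-5) ne
      by (cases L; cases "tl L") (auto simp: numeral_3_eq_3 not_le less_Suc_eq split: if_splits)
    then show ?thesis using that e A_sym[OF e] by auto
  qed
  have an: "a < n" using L by auto
  \<comment> \<open>Being in a common clique, \<open>a\<close> is a neighbour of \<open>x\<close>.
    The parent of \<open>x\<close> is its earliest neighbour, and \<open>a\<close> is the earliest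
    vertex on the path, which also contains \<open>par x\<close>; so they coincide.\<close>
  have top: "0 < x \<and> par x = a" if "x \<in> set L" "x \<noteq> a" "par x \<in> set L" "x < n" for x
  proof
    show x: "0 < x"
    proof (rule ccontr)
      assume "\<not> 0 < x"
      then show False using that L(8) pos_0 pos_inj[OF an that(4)] by force
    qed
    have "pos (par x) \<le> pos a" using par_props(4)[OF x that(4)] clique[OF that(1) L(6) that(2)] .
    then show "par x = a" using L(8) that(3) pos_inj par_props(2)[OF x that(4)] an by (meson le_antisym)
  qed
  show ?thesis
    using top[OF mem(1)] top[OF mem(2)] L(9,10) n ne by metis
qed

section \<open>Sibling classes and their representatives\<close>

definition sibs :: "nat \<Rightarrow> nat set" where
  "sibs v = insert v {w. 0 < w \<and> 0 < v \<and> w \<in> A v \<and> par w = par v}"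

definition ld :: "nat \<Rightarrow> nat" where
  "ld v = Min (sibs v)"

text \<open>Adjacency of children with a common parent is transitive: for \<open>w\<close> adjacent
  to \<open>u\<close> and \<open>u\<close> adjacent to \<open>v\<close>, the vertices
  \<open>par w\<close>, \<open>w\<close>, \<open>u\<close>, \<open>v\<close> form a 4-cycle and
  hence a clique.\<close>

lemma sibs_eq:
  assumes "0 < u" "0 < v" "v \<in> A u" "par u = par v"
  shows "sibs u = sibs v"
proof -
  have *: "sibs u \<subseteq> sibs v" if uv: "0 < u" "0 < v" "v \<in> A u" "par u = par v" for u v
  proof
    fix w assume w: "w \<in> sibs u"
    show "w \<in> sibs v"
    proof (cases "w = u \<or> w = v")
      case True
      then show ?thesis using uv A_sym[OF uv(3)] by (auto simp: sibs_def)
    next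
      case False
      then have w: "0 < w" "w \<in> A u" "par w = par u" using w by (auto simp: sibs_def)
      have n: "w < n" "u < n" "v < n" using A_range w uv by auto
      have p: "par w \<in> A w" "par w \<in> A u" "par w \<in> A v"
        using par_props(1) w uv n by metis+
      have "v \<noteq> u" using uv A_irrefl by auto
      have dis: "distinct [par w, w, u, v]"
        using p A_irrefl[of "par w"] A_irrefl[of w] A_irrefl[of u] A_irrefl[of v] w uv False by auto
      have suc: "successively (\<lambda>u v. v \<in> A u) [par w, w, u, v]"
        using p(1) w(2) uv(3) A_sym[of "par w" w] A_sym[of w u] by simp
      have hdl: "hd [par w, w, u, v] \<in> A (last [par w, w, u, v])" using p(3) by simp
      have "v \<in> A w"
        by (rule cycle_clique[OF dis _ suc hdl]) (use False in simp_all)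
      then show ?thesis using w uv A_sym[of v w] by (auto simp: sibs_def)
    qed
  qed
  show ?thesis using *[of u v] *[of v u] assms A_sym[OF assms(3)] by auto
qed

lemma sibs_fin: "finite (sibs v)"
proof -
  have "sibs v \<subseteq> insert v {..<n}" using A_range by (auto simp: sibs_def)
  then show ?thesis using finite_subset by blast
qed

lemma ld_sibs: "ld v \<in> sibs v"
  unfolding ld_def by (rule Min_in[OF sibs_fin]) (auto simp: sibs_def)

lemma sibs_ld: "0 < v \<Longrightarrow> sibs (ld v) = sibs v"
  using ld_sibs[of v] sibs_eq[of v "ld v"] by (auto simp: sibs_def)

sublocale rooted_blocks n A par ld pos
proof unfold_locales
  show "2 \<le> n" by (rule two_le_n)
  show "v \<in> A u \<Longrightarrow> u < n \<and> v < n" for u v by (rule A_range)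
  show "v \<in> A u \<Longrightarrow> u \<in> A v" for u v by (rule A_sym)
  show "v \<notin> A v" for v by (rule A_irrefl)
  show "par 0 = n" by (rule par_root)
  show "ld 0 = 0" using ld_sibs[of 0] by (simp add: sibs_def)
  show "pos v < n" if "v < n" for v by (rule pos_less[OF that])
  show "par v \<in> A v" "pos (par v) < pos v" if "0 < v" "v < n" for v using par_props[OF that] by auto
  show "0 < ld v \<and> ld v < n \<and> ld (ld v) = ld v \<and> par (ld v) = par v" if "0 < v" "v < n" for v
    using ld_sibs[of v] that A_range[of "ld v" v] sibs_ld[OF that(1)] ld_def[of "ld v"] ld_def[of v]
    by (auto simp: sibs_def)
  show "v \<in> A u" if "0 < u" "u < n" "0 < v" "v < n" "ld u = ld v" "u \<noteq> v" for u v
  proof -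
    have "sibs u = sibs v" using sibs_ld[OF that(1)] sibs_ld[OF that(3)] that(5) by simp
    then have "v \<in> sibs u" by (simp add: sibs_def)
    then show ?thesis using that by (auto simp: sibs_def)
  qed
  show "0 < u \<and> par u = v \<or> 0 < v \<and> par v = u \<or> 0 < u \<and> 0 < v \<and> par u = par v \<and> ld u = ld v"
    if "v \<in> A u" for u v
    using edge_cases[OF that] sibs_eq[of u v] that ld_def by auto
qed

end

section \<open>Cycles of a block graph span cliques\<close>

lemma reachable_successively:
  assumes "wf_digraph H" "successively (\<lambda>u v. u \<rightarrow>\<^bsub>H\<^esub> v \<and> v \<rightarrow>\<^bsub>H\<^esub> u) xs" "set xs \<subseteq> verts H"
    and "x \<in> set xs" "y \<in> set xs"
  shows "x \<rightarrow>\<^sup>*\<^bsub>H\<^esub> y"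
proof -
  interpret wf_digraph H by fact
  have "\<forall>x \<in> set xs. hd xs \<rightarrow>\<^sup>*\<^bsub>H\<^esub> x \<and> x \<rightarrow>\<^sup>*\<^bsub>H\<^esub> hd xs"
    using assms(2,3)
  proof (induction xs)
    case (Cons a xs)
    show ?case
    proof (cases "xs = []")
      case False
      then have "a \<rightarrow>\<^bsub>H\<^esub> hd xs" "hd xs \<rightarrow>\<^bsub>H\<^esub> a"
        and IH: "\<forall>x \<in> set xs. hd xs \<rightarrow>\<^sup>*\<^bsub>H\<^esub> x \<and> x \<rightarrow>\<^sup>*\<^bsub>H\<^esub> hd xs"
        using Cons by (auto simp: successively_Cons)
      then have "a \<rightarrow>\<^sup>*\<^bsub>H\<^esub> x \<and> x \<rightarrow>\<^sup>*\<^bsub>H\<^esub> a" if "x \<in> set xs" for x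
        using that adj_reachable_trans reachable_adj_trans by blast
      then show ?thesis using Cons.prems by auto
    qed (use Cons.prems in auto)
  qed simp
  then show ?thesis using assms(4,5) reachable_trans by blast
qed

text \<open>Removing a vertex from a cycle leaves a path through all the others: if
  \<open>cs = xs @ v # bs\<close>, this path is \<open>bs @ xs\<close>, joined by the edge that
  closes the cycle.\<close>

lemma cycle_connected_no_cut:
  assumes "graph H" and cs: "distinct cs" "3 \<le> length cs" "set cs \<subseteq> verts H"
    and adj: "successively (\<lambda>u v. u \<rightarrow>\<^bsub>H\<^esub> v) cs" "last cs \<rightarrow>\<^bsub>H\<^esub> hd cs"
  shows "connected_no_cut (H \<restriction> set cs)"
proof -
  interpret graph H by fact
  define K where "K = H \<restriction> set cs"
  have sym: "u \<rightarrow>\<^bsub>H\<^esub> v \<Longrightarrow> v \<rightarrow>\<^bsub>H\<^esub> u" for u v using sym_arcs by (simp add: symmetric_def symD)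
  have K: "wf_digraph K" unfolding K_def by (rule wellformed_induce_subgraph)
  interpret K: wf_digraph K by fact
  have KA: "u \<rightarrow>\<^bsub>K\<^esub> v" if "u \<in> set cs" "v \<in> set cs" "u \<rightarrow>\<^bsub>H\<^esub> v" for u v
    using that unfolding K_def arcs_ends_conv by auto
  have adjK: "successively (\<lambda>u v. u \<rightarrow>\<^bsub>K\<^esub> v \<and> v \<rightarrow>\<^bsub>K\<^esub> u) cs"
    by (rule successively_mono[OF adj(1)]) (use KA sym in blast)
  have "cs \<noteq> []" using cs by auto
  then have lastK: "last cs \<rightarrow>\<^bsub>K\<^esub> hd cs \<and> hd cs \<rightarrow>\<^bsub>K\<^esub> last cs"
    using KA adj(2) sym by simp
  have vK: "verts K = set cs" by (simp add: K_def)
  have symK: "symmetric K"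
    unfolding K_def using cs(3) by (intro induced_graph_imp_symmetric[OF sym_arcs] induced_induce)
  have "Digraph_Component.connected K"
    using \<open>cs \<noteq> []\<close> reachable_successively[OF K adjK] vK
    by (intro K.connectedI) (auto simp: K.reachable_mk_symmetric_eq[OF symK])
  moreover have "\<not> cut_vertex K v" for v
  proof
    assume cut: "cut_vertex K v"
    then have "v \<in> set cs" by (simp add: cut_vertex_def vK)
    from split_list[OF this] obtain xs bs where ab: "cs = xs @ v # bs" by blast
    define ps where "ps = bs @ xs"
    have ps: "successively (\<lambda>u v. u \<rightarrow>\<^bsub>K\<^esub> v \<and> v \<rightarrow>\<^bsub>K\<^esub> u) ps"
      using adjK lastK unfolding ps_def ab
      by (auto simp: successively_append_iff successively_Cons split: if_splits)
    have set: "set ps = set cs - {v}" using cs(1) by (auto simp: ps_def ab)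
    define L where "L = pre_digraph.del_vert K v"
    have L: "wf_digraph L" unfolding L_def by (rule K.wf_digraph_del_vert)
    have LA: "u \<rightarrow>\<^bsub>L\<^esub> w" if "u \<rightarrow>\<^bsub>K\<^esub> w" "u \<noteq> v" "w \<noteq> v" for u w
      using that unfolding L_def arcs_ends_conv by (auto simp: pre_digraph.del_vert_def)
    have "successively (\<lambda>u v. u \<rightarrow>\<^bsub>L\<^esub> v \<and> v \<rightarrow>\<^bsub>L\<^esub> u) ps"
      by (rule successively_mono[OF ps]) (use LA set in auto)
    moreover have "verts L = set ps" by (simp add: L_def pre_digraph.del_vert_def vK set)
    ultimately have "x \<rightarrow>\<^sup>*\<^bsub>L\<^esub> y" if "x \<in> set ps" "y \<in> set ps" for x y
      using reachable_successively[OF L] that by auto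
    then show False using cut unfolding cut_vertex_def vK L_def[symmetric] set[symmetric] by blast
  qed
  ultimately show ?thesis unfolding connected_no_cut_def K_def by blast
qed

text \<open>Among the connected induced subgraphs without cut vertex that contain \<open>S\<close>,
  one with the most vertices is a block, and blocks are complete.\<close>

lemma block_graph_clique:
  assumes "block_graph H" and S: "S \<subseteq> verts H" "connected_no_cut (H \<restriction> S)"
    and "u \<in> S" "v \<in> S" "u \<noteq> v"
  shows "u \<rightarrow>\<^bsub>H\<^esub> v"
proof -
  interpret graph H using assms(1) by (simp add: block_graph_def)
  define C where "C = {B. induced_subgraph B H \<and> connected_no_cut B \<and> S \<subseteq> verts B}"
  have "H \<restriction> S \<in> C" using S by (auto simp: C_def)
  moreover have bound: "\<forall>B. B \<in> C \<longrightarrow> card (verts B) < Suc (card (verts H))"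
    by (auto simp: C_def less_Suc_eq_le intro!: card_mono)
  ultimately obtain B where B: "B \<in> C" and max: "\<And>B'. B' \<in> C \<Longrightarrow> card (verts B') \<le> card (verts B)"
    using ex_has_greatest_nat[of "\<lambda>B. B \<in> C" "H \<restriction> S" "\<lambda>B. card (verts B)" "Suc (card (verts H))"] by auto
  have "is_block H B"
    unfolding is_block_def
  proof (intro conjI notI)
    show "induced_subgraph B H" "connected_no_cut B" using B by (auto simp: C_def)
    assume "\<exists>B'. induced_subgraph B' H \<and> connected_no_cut B' \<and> verts B \<subset> verts B'"
    then obtain B' where B': "induced_subgraph B' H" "connected_no_cut B'" "verts B \<subset> verts B'" by blast
    then have "finite (verts B')" by (meson finite_subset finite_verts induced_imp_subgraph subgraph_imp_subverts)
    then have "card (verts B) < card (verts B')" using B'(3) by (rule psubset_card_mono)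
    moreover have "B' \<in> C" using B' B by (auto simp: C_def)
    ultimately show False using max by fastforce
  qed
  then obtain k where "complete_digraph k B" using assms(1) by (auto simp: block_graph_def)
  then have "(u, v) \<in> arcs_ends B" using assms B by (auto simp: complete_digraph_def C_def)
  moreover have "subgraph B H" using B by (auto simp: C_def)
  ultimately show ?thesis using adj_mono by blast
qed

lemma block_graph_cycle_clique:
  assumes "block_graph H" "distinct cs" "3 \<le> length cs"
    and "successively (\<lambda>u v. u \<rightarrow>\<^bsub>H\<^esub> v) cs" "last cs \<rightarrow>\<^bsub>H\<^esub> hd cs"
    and "u \<in> set cs" "v \<in> set cs" "u \<noteq> v"
  shows "u \<rightarrow>\<^bsub>H\<^esub> v"
proof -
  interpret graph H using assms(1) by (simp add: block_graph_def)
  have "x \<in> verts H" if x: "x \<in> set cs" for x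
  proof -
    from split_list[OF x] obtain xs bs where ab: "cs = xs @ x # bs" by blast
    show ?thesis
    proof (cases bs)
      case Nil
      then show ?thesis using assms(5) ab adj_in_verts(1) by auto
    next
      case (Cons b bs')
      then have "x \<rightarrow>\<^bsub>H\<^esub> b" using assms(4) ab by (auto simp: successively_append_iff)
      then show ?thesis using adj_in_verts(1) by blast
    qed
  qed
  then have s: "set cs \<subseteq> verts H" by blast
  show ?thesis
    by (rule block_graph_clique[OF assms(1) s cycle_connected_no_cut[OF _ assms(2,3) s assms(4,5)] assms(6-8)])
      unfold_locales
qed

lemma connected_closed_eq_verts:
  assumes "graph H" "Digraph_Component.connected H" "x \<in> S" "S \<subseteq> verts H"
    and closed: "\<And>u v. u \<in> S \<Longrightarrow> u \<rightarrow>\<^bsub>H\<^esub> v \<Longrightarrow> v \<in> S"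
  shows "S = verts H"
proof -
  interpret graph H by fact
  have "strongly_connected H" using symmetric_connected_imp_strongly_connected[OF sym_arcs assms(2)] .
  then have r: "x \<rightarrow>\<^sup>*\<^bsub>H\<^esub> y" if "y \<in> verts H" for y
    using that assms(3,4) by (auto simp: strongly_connected_def)
  have "y \<in> S" if "x \<rightarrow>\<^sup>*\<^bsub>H\<^esub> y" for y
    using that by (induction rule: reachable_induct) (use assms(3) closed in auto)
  then show ?thesis using r assms(4) by blast
qed

section \<open>Semipaired domination in terms of meeting places\<close>

lemma gdist_le_2_iff:
  assumes "wf_digraph H" "u \<in> verts H" "u \<noteq> v"
  shows "gdist H u v \<le> 2 \<longleftrightarrow> u \<rightarrow>\<^bsub>H\<^esub> v \<or> (\<exists>z. u \<rightarrow>\<^bsub>H\<^esub> z \<and> z \<rightarrow>\<^bsub>H\<^esub> v)"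
proof -
  interpret wf_digraph H by fact
  have cost: "awalk_cost (\<lambda>_. 1) p = real (length p)" for p :: "'b list"
    by (induction p) auto
  show ?thesis
  proof
    assume le: "gdist H u v \<le> 2"
    have "\<exists>p. awalk u p v \<and> length p \<le> 2"
    proof (rule ccontr)
      assume "\<nexists>p. awalk u p v \<and> length p \<le> 2"
      \<comment> \<open>Walk lengths are integers, so without a walk of length at most 2 the infimum
        is at least 3.\<close>
      then have "3 \<le> length p" if "awalk u p v" for p using that by (metis One_nat_def Suc_1 not_less_eq_eq numeral_3_eq_3)
      then have "ereal 3 \<le> gdist H u v" unfolding \<mu>_def cost by (intro INF_greatest) auto
      then have "ereal 3 \<le> 2" using le by (rule order_trans)
      then show False by simp
    qed
    then obtain p where p: "awalk u p v" "length p \<le> 2" by blast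
    consider "p = []" | a where "p = [a]" | a b where "p = [a, b]"
      using p(2) by (cases p; cases "tl p") (auto simp: numeral_2_eq_2 length_Suc_conv le_Suc_eq)
    then show "u \<rightarrow>\<^bsub>H\<^esub> v \<or> (\<exists>z. u \<rightarrow>\<^bsub>H\<^esub> z \<and> z \<rightarrow>\<^bsub>H\<^esub> v)"
    proof cases
      case 1 then show ?thesis using p(1) assms(3) by (simp add: awalk_Nil_iff)
    next
      case 2 then show ?thesis using p(1) by (auto simp: awalk_Cons_iff awalk_Nil_iff arcs_ends_conv)
    next
      case 3
      then have "a \<in> arcs H" "b \<in> arcs H" "tail H a = u" "head H a = tail H b" "head H b = v"
        using p(1) by (auto simp: awalk_Cons_iff awalk_Nil_iff)
      moreover have "tail H e \<rightarrow>\<^bsub>H\<^esub> head H e" if "e \<in> arcs H" for e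
        using that by (auto simp: arcs_ends_conv)
      ultimately have "u \<rightarrow>\<^bsub>H\<^esub> head H a" "head H a \<rightarrow>\<^bsub>H\<^esub> v" by metis+
      then show ?thesis by blast
    qed
  next
    assume "u \<rightarrow>\<^bsub>H\<^esub> v \<or> (\<exists>z. u \<rightarrow>\<^bsub>H\<^esub> z \<and> z \<rightarrow>\<^bsub>H\<^esub> v)"
    then have "\<exists>p. awalk u p v \<and> length p \<le> 2"
    proof (elim disjE exE conjE)
      assume "u \<rightarrow>\<^bsub>H\<^esub> v"
      then obtain a where "a \<in> arcs H" "tail H a = u" "head H a = v" by (auto simp: arcs_ends_conv)
      then show ?thesis by (intro exI[of _ "[a]"]) (auto simp: awalk_Cons_iff awalk_Nil_iff)
    next
      fix z assume "u \<rightarrow>\<^bsub>H\<^esub> z" "z \<rightarrow>\<^bsub>H\<^esub> v"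
      then obtain a b where "a \<in> arcs H" "tail H a = u" "head H a = z" "b \<in> arcs H" "tail H b = z" "head H b = v"
        by (auto simp: arcs_ends_conv)
      then show ?thesis by (intro exI[of _ "[a, b]"]) (auto simp: awalk_Cons_iff awalk_Nil_iff)
    qed
    then obtain p where p: "awalk u p v" "length p \<le> 2" by blast
    then have "gdist H u v \<le> ereal (real (length p))" using min_cost_le_walk_cost[OF p(1)] cost by metis
    also have "\<dots> \<le> 2" using p(2) by simp
    finally show "gdist H u v \<le> 2" .
  qed
qed

lemma even_card_pairing:
  assumes "finite S" "even (card S)"
  shows "\<exists>P. partition_on S P \<and> (\<forall>p \<in> P. card p = 2)"
  using assms
proof (induction "card S" arbitrary: S rule: less_induct)
  case less
  show ?case
  proof (cases "S = {}")
    case True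
    then show ?thesis by (intro exI[of _ "{}"]) (auto simp: partition_on_def)
  next
    case False
    then have "card S \<noteq> 0" using less.prems by simp
    then have "2 \<le> card S" using less.prems(2) by presburger
    then obtain p where p: "p \<subseteq> S" "card p = 2" "finite p" using obtain_subset_with_card_n by blast
    then have "card (S - p) = card S - 2" by (simp add: card_Diff_subset)
    then obtain P where P: "partition_on (S - p) P" "\<forall>q \<in> P. card q = 2"
      using less.hyps[of "S - p"] less.prems \<open>2 \<le> card S\<close> by auto
    have "partition_on S (insert p P)"
      using P p unfolding partition_on_def by (auto simp: disjoint_def)
    then show ?thesis using P p by blast
  qed
qed

text \<open>From pairs to \<open>f\<close>, both members are sent to one common closed neighbour.
  Conversely, any two vertices with the same image under \<open>f\<close> are at distance at most 2,
  so each even fibre may be split into pairs arbitrarily.\<close>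

lemma semipaired_dominating_iff:
  assumes "graph H"
  shows "semipaired_dominating H D \<longleftrightarrow> D \<subseteq> verts H \<and> (\<forall>v \<in> verts H. v \<in> D \<or> (\<exists>u \<in> D. v \<rightarrow>\<^bsub>H\<^esub> u)) \<and>
    (\<exists>f. (\<forall>x \<in> D. f x = x \<or> x \<rightarrow>\<^bsub>H\<^esub> f x) \<and> (\<forall>z \<in> verts H. even (card {x \<in> D. f x = z})))"
    (is "_ \<longleftrightarrow> ?D \<and> ?dom \<and> ?F")
proof -
  interpret graph H by fact
  have sym: "u \<rightarrow>\<^bsub>H\<^esub> v \<Longrightarrow> v \<rightarrow>\<^bsub>H\<^esub> u" for u v using sym_arcs by (simp add: symmetric_def symD)
  have "(\<exists>P. partition_on D P \<and> (\<forall>p \<in> P. \<exists>u v. p = {u, v} \<and> u \<noteq> v \<and> gdist H u v \<le> 2)) \<longleftrightarrow> ?F" if D: ?D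
  proof
    have finD: "finite D" by (rule finite_subset[OF D]) simp
    assume "\<exists>P. partition_on D P \<and> (\<forall>p \<in> P. \<exists>u v. p = {u, v} \<and> u \<noteq> v \<and> gdist H u v \<le> 2)"
    then obtain P where P: "partition_on D P"
      and pair: "\<forall>p \<in> P. \<exists>u v. p = {u, v} \<and> u \<noteq> v \<and> gdist H u v \<le> 2" by (elim exE conjE)
    have "\<exists>z. \<forall>x \<in> p. z = x \<or> x \<rightarrow>\<^bsub>H\<^esub> z" if pP: "p \<in> P" for p
    proof -
      obtain u v where p: "p = {u, v}" "u \<noteq> v" "gdist H u v \<le> 2" using bspec[OF pair pP] by (elim exE conjE)
      have "u \<in> verts H" using p pP P D partition_onD1[OF P] by blast
      then consider "u \<rightarrow>\<^bsub>H\<^esub> v" | z where "u \<rightarrow>\<^bsub>H\<^esub> z" "z \<rightarrow>\<^bsub>H\<^esub> v"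
        using gdist_le_2_iff[OF wf_digraph_axioms _ p(2)] p(3) by blast
      then show ?thesis using p sym by cases blast+
    qed
    then obtain z where z: "\<And>p x. p \<in> P \<Longrightarrow> x \<in> p \<Longrightarrow> z p = x \<or> x \<rightarrow>\<^bsub>H\<^esub> z p" by metis
    define blk where "blk x = (THE p. p \<in> P \<and> x \<in> p)" for x
    have blk: "blk x = p" if "p \<in> P" "x \<in> p" for p x
      unfolding blk_def using that partition_onD2[OF P] by (intro the_equality) (auto simp: disjoint_def)
    have blkD: "blk x \<in> P \<and> x \<in> blk x" if "x \<in> D" for x
      using that partition_onD1[OF P] blk by auto
    have "even (card {x \<in> D. z (blk x) = w})" for w
    proof -
      have eq: "{x \<in> D. z (blk x) = w} = \<Union>{p \<in> P. z p = w}"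
        using blkD blk partition_onD1[OF P] by auto
      have "card (\<Union>{p \<in> P. z p = w}) = sum card {p \<in> P. z p = w}"
        by (rule card_Union_disjoint)
          (use partition_onD2[OF P] partition_onD1[OF P] finD in
            \<open>auto simp: pairwise_def disjnt_def disjoint_def intro: finite_subset\<close>)
      also have "even \<dots>"
      proof (rule dvd_sum)
        fix p assume "p \<in> {p \<in> P. z p = w}"
        then obtain u v where "p = {u, v}" "u \<noteq> v" using pair by blast
        then show "even (card p)" by simp
      qed
      finally show ?thesis unfolding eq .
    qed
    moreover have "z (blk x) = x \<or> x \<rightarrow>\<^bsub>H\<^esub> z (blk x)" if "x \<in> D" for x using z blkD[OF that] by blast
    ultimately show ?F by (intro exI[of _ "\<lambda>x. z (blk x)"]) blast
  next
    assume ?F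
    then obtain f where f: "\<And>x. x \<in> D \<Longrightarrow> f x = x \<or> x \<rightarrow>\<^bsub>H\<^esub> f x"
      and even: "\<And>z. z \<in> verts H \<Longrightarrow> even (card {x \<in> D. f x = z})" by blast
    have finD: "finite D" by (rule finite_subset[OF D]) simp
    have "\<exists>P. partition_on {x \<in> D. f x = z} P \<and> (\<forall>p \<in> P. card p = 2)" if "z \<in> verts H" for z
      using even_card_pairing[OF _ even[OF that]] finD by simp
    then obtain P where P: "\<And>z. z \<in> verts H \<Longrightarrow> partition_on {x \<in> D. f x = z} (P z)"
      "\<And>z p. z \<in> verts H \<Longrightarrow> p \<in> P z \<Longrightarrow> card p = 2" by metis
    have fv: "f x \<in> verts H" if "x \<in> D" for x using f[OF that] D that adj_in_verts(2) by auto
    have part: "partition_on D (\<Union>z \<in> verts H. P z)"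
    proof (rule partition_onI)
      show "\<Union>(\<Union>z \<in> verts H. P z) = D"
      proof -
        have "\<Union>(\<Union>z \<in> verts H. P z) = (\<Union>z \<in> verts H. \<Union>(P z))" by blast
        also have "\<dots> = (\<Union>z \<in> verts H. {x \<in> D. f x = z})"
          by (intro SUP_cong refl) (rule partition_onD1[OF P(1), symmetric])
        also have "\<dots> = D" using fv by blast
        finally show ?thesis .
      qed
      show "disjnt p q" if pq: "p \<in> (\<Union>z \<in> verts H. P z)" "q \<in> (\<Union>z \<in> verts H. P z)" "p \<noteq> q" for p q
      proof -
        obtain y z where yz: "y \<in> verts H" "z \<in> verts H" "p \<in> P y" "q \<in> P z" using pq by blast
        then have s: "p \<subseteq> {x \<in> D. f x = y}" "q \<subseteq> {x \<in> D. f x = z}"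
          using partition_onD1[OF P(1)] by blast+
        show ?thesis
        proof (cases "y = z")
          case True
          then show ?thesis using partition_onD2[OF P(1)[OF yz(1)]] yz pq(3) by (auto simp: disjoint_def disjnt_def)
        next
          case False
          then show ?thesis using s by (auto simp: disjnt_def)
        qed
      qed
      show "{} \<notin> (\<Union>z \<in> verts H. P z)" using P(2)[of _ "{}"] by auto
    qed
    have pairs: "\<exists>u v. p = {u, v} \<and> u \<noteq> v \<and> gdist H u v \<le> 2" if p: "p \<in> (\<Union>z \<in> verts H. P z)" for p
    proof -
      obtain z where z: "z \<in> verts H" "p \<in> P z" using p by blast
      obtain u v where uv: "p = {u, v}" "u \<noteq> v" using P(2)[OF z] by (auto simp: card_2_iff)
      have "p \<subseteq> {x \<in> D. f x = z}" using partition_onD1[OF P(1)[OF z(1)]] z(2) by blast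
      then have "u \<in> D" "v \<in> D" "f u = z" "f v = z" using uv by auto
      then have "u \<rightarrow>\<^bsub>H\<^esub> v \<or> (\<exists>z. u \<rightarrow>\<^bsub>H\<^esub> z \<and> z \<rightarrow>\<^bsub>H\<^esub> v)"
        using f[of u] f[of v] sym uv(2) by auto
      then have "gdist H u v \<le> 2"
        using gdist_le_2_iff[OF wf_digraph_axioms _ uv(2)] \<open>u \<in> D\<close> D by blast
      then show ?thesis using uv by blast
    qed
    show "\<exists>P. partition_on D P \<and> (\<forall>p \<in> P. \<exists>u v. p = {u, v} \<and> u \<noteq> v \<and> gdist H u v \<le> 2)"
      by (intro exI[of _ "\<Union>z \<in> verts H. P z"] conjI[OF part] ballI pairs)
  qed
  then have "?D \<Longrightarrow> (\<exists>P. partition_on D P \<and> (\<forall>p \<in> P. \<exists>u v. p = {u, v} \<and> u \<noteq> v \<and> gdist H u v \<le> 2)) = ?F" .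
  moreover have "(\<forall>v \<in> verts H - D. \<exists>u \<in> D. v \<rightarrow>\<^bsub>H\<^esub> u) = ?dom" by auto
  ultimately show ?thesis unfolding semipaired_dominating_def by (simp cong: conj_cong)
qed

lemma min_semipaired_dominatingI:
  assumes "semipaired_dominating H D" "\<And>D'. semipaired_dominating H D' \<Longrightarrow> card D \<le> card D'"
  shows "min_semipaired_dominating H D"
  using assms unfolding min_semipaired_dominating_def semipaired_domination_number_def
  by (auto intro!: Least_equality[symmetric])

section \<open>Running programs\<close>

fun straight :: "com \<Rightarrow> bool" where
  "straight (Seq c d) \<longleftrightarrow> straight c \<and> straight d"
| "straight (Cond b c d) \<longleftrightarrow> straight c \<and> straight d"
| "straight (While b c) \<longleftrightarrow> False"
| "straight _ \<longleftrightarrow> True"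

text \<open>A functional reading of loop-free code, which lets the invariants of loop bodies be
  checked by simplification; \<open>time\<close> takes the more expensive branch of a conditional,
  so it depends on the code alone.\<close>

fun step :: "com \<Rightarrow> store \<Rightarrow> store" where
  "step (Assign x e) s = s\<lparr>reg := (reg s)(x := aval e s)\<rparr>"
| "step (Put a i e) s = s\<lparr>arr := (arr s)(a := (arr s a)(aval i s := aval e s))\<rparr>"
| "step (Seq c d) s = step d (step c s)"
| "step (Cond b c d) s = (if bval b s then step c s else step d s)"
| "step _ s = s"

fun time :: "com \<Rightarrow> nat" where
  "time (Assign x e) = 1 + acost e"
| "time (Put a i e) = 1 + acost i + acost e"
| "time (Seq c d) = time c + time d"
| "time (Cond b c d) = 1 + bcost b + max (time c) (time d)"
| "time _ = 1"

fun wregs :: "com \<Rightarrow> string set" where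
  "wregs (Assign x e) = {x}"
| "wregs (Seq c d) = wregs c \<union> wregs d"
| "wregs (Cond b c d) = wregs c \<union> wregs d"
| "wregs (While b c) = wregs c"
| "wregs _ = {}"

fun warrs :: "com \<Rightarrow> string set" where
  "warrs (Put a i e) = {a}"
| "warrs (Seq c d) = warrs c \<union> warrs d"
| "warrs (Cond b c d) = warrs c \<union> warrs d"
| "warrs (While b c) = warrs c"
| "warrs _ = {}"

lemma exec_frame:
  assumes "exec W c s t s'"
  shows "x \<notin> wregs c \<Longrightarrow> reg s' x = reg s x" "a \<notin> warrs c \<Longrightarrow> arr s' a = arr s a"
  using assms by (induction rule: exec.induct) auto

lemma step_frame:
  "x \<notin> wregs c \<Longrightarrow> reg (step c s) x = reg s x" "a \<notin> warrs c \<Longrightarrow> arr (step c s) a = arr s a"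
  by (induction c arbitrary: s) auto

lemma afits_mono: "afits W e s \<Longrightarrow> W \<le> W' \<Longrightarrow> afits W' e s"
  by (induction e) auto

lemma bfits_mono: "bfits W b s \<Longrightarrow> W \<le> W' \<Longrightarrow> bfits W' b s"
  by (induction b) (auto intro: afits_mono)

lemma exec_mono: "exec W c s t s' \<Longrightarrow> W \<le> W' \<Longrightarrow> exec W' c s t s'"
  by (induction rule: exec.induct) (blast intro: exec.intros afits_mono bfits_mono)+

lemma eventually_afits: "eventually (\<lambda>W. afits W e s) sequentially"
  by (induction e) (simp_all add: eventually_conj_iff eventually_gt_at_top)

lemma afits_exists: "\<exists>W. afits W e s"
  using eventually_happens'[OF sequentially_bot eventually_afits] .

lemma bfits_exists: "\<exists>W. bfits W b s"
proof -
  have "eventually (\<lambda>W. bfits W b s) sequentially"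
    by (induction b) (simp_all add: eventually_conj_iff eventually_afits)
  then show ?thesis by (rule eventually_happens'[OF sequentially_bot])
qed

text \<open>The word limit is left open here and supplied at the end by \<open>runs_within\<close>.\<close>

definition runs :: "com \<Rightarrow> store \<Rightarrow> nat \<Rightarrow> (store \<Rightarrow> bool) \<Rightarrow> bool" where
  "runs c s T Q \<longleftrightarrow> (\<exists>W t s'. exec W c s t s' \<and> t \<le> T \<and> Q s')"

lemma runs_weaken: "runs c s T Q \<Longrightarrow> T \<le> T' \<Longrightarrow> (\<And>s'. Q s' \<Longrightarrow> Q' s') \<Longrightarrow> runs c s T' Q'"
  unfolding runs_def by (meson order_trans)

lemma runs_frame:
  assumes "runs c s T Q"
  shows "runs c s T (\<lambda>s'. Q s' \<and> (\<forall>x. x \<notin> wregs c \<longrightarrow> reg s' x = reg s x) \<and> (\<forall>a. a \<notin> warrs c \<longrightarrow> arr s' a = arr s a))"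
  using assms unfolding runs_def by (meson exec_frame)

lemma runs_Seq:
  assumes "runs c s T1 Q" "\<And>s'. Q s' \<Longrightarrow> runs d s' T2 R" "T1 + T2 \<le> T"
  shows "runs (Seq c d) s T R"
proof -
  obtain W1 t1 s1 where 1: "exec W1 c s t1 s1" "t1 \<le> T1" "Q s1" using assms(1) by (auto simp: runs_def)
  obtain W2 t2 s2 where 2: "exec W2 d s1 t2 s2" "t2 \<le> T2" "R s2" using assms(2)[OF 1(3)] by (auto simp: runs_def)
  have "exec (W1 + W2) (Seq c d) s (t1 + t2) s2"
    by (rule exec_Seq) (use 1 2 in \<open>auto intro: exec_mono\<close>)
  then show ?thesis using 1 2 assms(3) unfolding runs_def by (meson add_mono order_trans)
qed

lemma runs_Cond:
  assumes "runs (if bval b s then c else d) s T Q" "1 + bcost b + T \<le> T'"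
  shows "runs (Cond b c d) s T' Q"
proof -
  obtain W1 t s1 where 1: "exec W1 (if bval b s then c else d) s t s1" "t \<le> T" "Q s1"
    using assms(1) by (auto simp: runs_def)
  obtain W2 where 2: "bfits W2 b s" using bfits_exists by blast
  have "exec (W1 + W2) (Cond b c d) s (1 + bcost b + t) s1"
  proof -
    have b: "bfits (W1 + W2) b s" by (rule bfits_mono[OF 2]) simp
    have e: "exec (W1 + W2) (if bval b s then c else d) s t s1" by (rule exec_mono[OF 1(1)]) simp
    show ?thesis
    proof (cases "bval b s")
      case True
      then show ?thesis using exec_CondTrue[OF b True] e by simp
    next
      case False
      then show ?thesis using exec_CondFalse[OF b False] e by simp
    qed
  qed
  then show ?thesis using 1 assms(2) unfolding runs_def by (meson add_left_mono order_trans)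
qed

lemma runs_WhileFalse:
  assumes "\<not> bval b s" "1 + bcost b \<le> T" "Q s"
  shows "runs (While b c) s T Q"
  using assms bfits_exists[of b s] unfolding runs_def by (meson exec_WhileFalse)

lemma runs_WhileTrue:
  assumes "bval b s" "runs c s T1 Q" "\<And>s'. Q s' \<Longrightarrow> runs (While b c) s' T2 R" "1 + bcost b + T1 + T2 \<le> T"
  shows "runs (While b c) s T R"
proof -
  obtain W1 t1 s1 where 1: "exec W1 c s t1 s1" "t1 \<le> T1" "Q s1" using assms(2) by (auto simp: runs_def)
  obtain W2 t2 s2 where 2: "exec W2 (While b c) s1 t2 s2" "t2 \<le> T2" "R s2"
    using assms(3)[OF 1(3)] by (auto simp: runs_def)
  obtain W3 where 3: "bfits W3 b s" using bfits_exists by blast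
  have "exec (W1 + W2 + W3) (While b c) s (1 + bcost b + t1 + t2) s2"
    by (rule exec_WhileTrue[OF _ assms(1)]) (use 1 2 3 in \<open>auto intro: exec_mono bfits_mono\<close>)
  moreover have "1 + bcost b + t1 + t2 \<le> T" using 1 2 assms(4) by linarith
  ultimately show ?thesis using 2 unfolding runs_def by blast
qed

lemma runs_step:
  assumes "straight c" "Q (step c s)" "time c \<le> T"
  shows "runs c s T Q"
proof -
  have "runs c s (time c) (\<lambda>s'. s' = step c s)"
    using assms(1)
  proof (induction c arbitrary: s)
    case Skip
    then show ?case unfolding runs_def by (auto intro!: exI exec_Skip)
  next
    case (Assign x e)
    obtain W where "afits W e s" using afits_exists by blast
    from exec_Assign[OF this, of x] show ?case unfolding runs_def by auto
  next
    case (Put a i e)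
    obtain W1 W2 where "afits W1 i s" "afits W2 e s" using afits_exists by meson
    then have "afits (W1 + W2) i s" "afits (W1 + W2) e s" by (auto intro: afits_mono)
    from exec_Put[OF this, of a] show ?case unfolding runs_def by auto
  next
    case (Seq c d)
    show ?case by (rule runs_Seq[OF Seq.IH(1)]) (use Seq in auto)
  next
    case (Cond b c d)
    show ?case by (rule runs_Cond[where T = "max (time c) (time d)"])
      (use Cond.prems in \<open>auto intro: runs_weaken[OF Cond.IH(1)] runs_weaken[OF Cond.IH(2)]\<close>)
  qed simp
  then show ?thesis using assms by (auto intro: runs_weaken)
qed

text \<open>If the only additions are increments, then no number exceeds the initial maximum by more than the
  elapsed time; a linear time bound therefore yields the word limit for free.\<close>

fun ainc :: "nat \<Rightarrow> aexp \<Rightarrow> bool" where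
  "ainc M (Const k) \<longleftrightarrow> k \<le> M"
| "ainc M (Reg x) \<longleftrightarrow> True"
| "ainc M (Get a i) \<longleftrightarrow> ainc M i"
| "ainc M (Add e f) \<longleftrightarrow> ainc M e \<and> f = Const 1"
| "ainc M (Sub e f) \<longleftrightarrow> ainc M e \<and> ainc M f"

fun binc :: "nat \<Rightarrow> bexp \<Rightarrow> bool" where
  "binc M (Less e f) \<longleftrightarrow> ainc M e \<and> ainc M f"
| "binc M (Equal e f) \<longleftrightarrow> ainc M e \<and> ainc M f"
| "binc M (Neg b) \<longleftrightarrow> binc M b"
| "binc M (Conj b c) \<longleftrightarrow> binc M b \<and> binc M c"

fun cinc :: "nat \<Rightarrow> com \<Rightarrow> bool" where
  "cinc M Skip \<longleftrightarrow> True"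
| "cinc M (Assign x e) \<longleftrightarrow> ainc M e"
| "cinc M (Put a i e) \<longleftrightarrow> ainc M i \<and> ainc M e"
| "cinc M (Seq c d) \<longleftrightarrow> cinc M c \<and> cinc M d"
| "cinc M (Cond b c d) \<longleftrightarrow> binc M b \<and> cinc M c \<and> cinc M d"
| "cinc M (While b c) \<longleftrightarrow> binc M b \<and> cinc M c"

definition below :: "nat \<Rightarrow> store \<Rightarrow> bool" where
  "below M s \<longleftrightarrow> (\<forall>x. reg s x \<le> M) \<and> (\<forall>a i. arr s a i \<le> M)"

lemma ainc_mono: "ainc M e \<Longrightarrow> M \<le> M' \<Longrightarrow> ainc M' e" by (induction e) auto
lemma binc_mono: "binc M b \<Longrightarrow> M \<le> M' \<Longrightarrow> binc M' b" by (induction b) (auto intro: ainc_mono)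
lemma cinc_mono: "cinc M c \<Longrightarrow> M \<le> M' \<Longrightarrow> cinc M' c" by (induction c) (auto intro: ainc_mono binc_mono)

lemma below_mono: "below M s \<Longrightarrow> M \<le> M' \<Longrightarrow> below M' s"
  unfolding below_def by (meson order_trans)

lemma ainc_fits:
  assumes "ainc M e" "below M s" "1 \<le> M" "M + acost e < W"
  shows "afits W e s \<and> aval e s \<le> M + acost e"
  using assms
proof (induction e)
  case (Get a i)
  have "arr s a (aval i s) \<le> M" using Get.prems by (simp add: below_def)
  then show ?case using Get by auto
next
  case (Reg x)
  have "reg s x \<le> M" using Reg.prems by (simp add: below_def)
  then show ?case using Reg.prems by simp
next
  case (Add e f)
  then have "afits W e s \<and> aval e s \<le> M + acost e" by simp
  then show ?case using Add.prems by simp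
next
  case (Sub e f)
  then have "afits W e s \<and> aval e s \<le> M + acost e" "afits W f s" by simp_all
  moreover from this have "aval e s - aval f s \<le> M + acost (Sub e f)" by (simp, linarith)
  ultimately show ?case by simp
qed simp

lemma binc_fits:
  assumes "binc M b" "below M s" "1 \<le> M" "M + bcost b < W"
  shows "bfits W b s"
  using assms by (induction b) (auto simp: ainc_fits)

lemma exec_within:
  assumes "exec W0 c s t s'" "cinc M c" "below M s" "1 \<le> M" "M + t < W"
  shows "exec W c s t s' \<and> below (M + t) s'"
  using assms
proof (induction arbitrary: M rule: exec.induct)
  case (exec_Skip s)
  then show ?case using exec.exec_Skip below_mono[of M s "M + 1"] by simp
next
  case (exec_Assign e s x)
  have "afits W e s \<and> aval e s \<le> M + acost e" by (rule ainc_fits) (use exec_Assign in auto)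
  moreover have "below (M + (1 + acost e)) s" using exec_Assign by (auto intro: below_mono)
  ultimately show ?case by (auto intro!: exec.exec_Assign simp: below_def simp del: One_nat_def)
next
  case (exec_Put i s e a)
  have "afits W e s \<and> aval e s \<le> M + acost e" "afits W i s \<and> aval i s \<le> M + acost i"
    by (rule ainc_fits; use exec_Put in auto)+
  moreover have "below (M + (1 + acost i + acost e)) s" using exec_Put by (auto intro: below_mono)
  ultimately show ?case by (auto intro!: exec.exec_Put simp: below_def simp del: One_nat_def)
next
  case (exec_Seq c s t s' d t' s'')
  have 1: "exec W c s t s' \<and> below (M + t) s'" by (rule exec_Seq.IH) (use exec_Seq.prems in auto)
  have "exec W d s' t' s'' \<and> below (M + t + t') s''"
    by (rule exec_Seq.IH) (use 1 exec_Seq.prems in \<open>auto intro: cinc_mono\<close>)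
  then show ?case using 1 by (auto intro: exec.exec_Seq simp: add.assoc)
next
  case (exec_CondTrue b s c t s' d)
  have "bfits W b s" by (rule binc_fits) (use exec_CondTrue.prems in auto)
  moreover have "exec W c s t s' \<and> below (M + t) s'" by (rule exec_CondTrue.IH) (use exec_CondTrue.prems in auto)
  ultimately show ?case using exec_CondTrue.hyps
    by (auto intro!: exec.exec_CondTrue intro: below_mono simp del: One_nat_def)
next
  case (exec_CondFalse b s d t s' c)
  have "bfits W b s" by (rule binc_fits) (use exec_CondFalse.prems in auto)
  moreover have "exec W d s t s' \<and> below (M + t) s'" by (rule exec_CondFalse.IH) (use exec_CondFalse.prems in auto)
  ultimately show ?case using exec_CondFalse.hyps
    by (auto intro!: exec.exec_CondFalse intro: below_mono simp del: One_nat_def)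
next
  case (exec_WhileFalse b s c)
  have "bfits W b s" by (rule binc_fits) (use exec_WhileFalse.prems in auto)
  then show ?case using exec_WhileFalse by (auto intro!: exec.exec_WhileFalse intro: below_mono simp del: One_nat_def)
next
  case (exec_WhileTrue b s c t s' t' s'')
  have 0: "bfits W b s" by (rule binc_fits) (use exec_WhileTrue.prems in auto)
  have 1: "exec W c s t s' \<and> below (M + t) s'" by (rule exec_WhileTrue.IH) (use exec_WhileTrue.prems in auto)
  have 2: "exec W (While b c) s' t' s'' \<and> below (M + t + t') s''"
    by (rule exec_WhileTrue.IH) (use 1 exec_WhileTrue.prems in \<open>auto intro: cinc_mono binc_mono\<close>)
  then show ?case using 0 1 exec_WhileTrue.hyps
    by (auto intro!: exec.exec_WhileTrue intro: below_mono simp del: One_nat_def)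
qed

lemma runs_within:
  assumes "runs c s T Q" "cinc M c" "below M s" "1 \<le> M" "M + T < W"
  shows "\<exists>t s'. exec W c s t s' \<and> t \<le> T \<and> Q s'"
proof -
  obtain W0 t s' where e: "exec W0 c s t s'" "t \<le> T" "Q s'" using assms(1) by (auto simp: runs_def)
  then have "exec W c s t s'" using exec_within[OF e(1) assms(2-4), of W] assms(5) by simp
  then show ?thesis using e by blast
qed

section \<open>Scanning adjacency lists and sweeping over all vertices\<close>

definition scan :: "com \<Rightarrow> com" where
  "scan body = Seq (Assign ''k'' (Get ''off'' (Reg ''v'')))
     (While (Less (Reg ''k'') (Get ''off'' (Add (Reg ''v'') (Const 1))))
       (Seq (Assign ''w'' (Get ''nbr'' (Reg ''k'')))
         (Seq body (Assign ''k'' (Add (Reg ''k'') (Const 1))))))"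

definition sweep :: "com \<Rightarrow> com \<Rightarrow> com \<Rightarrow> com" where
  "sweep pre body post = Seq (Assign ''i'' (Const 0))
     (While (Less (Reg ''i'') (Reg ''n''))
       (Seq pre (Seq (scan body) (Seq post (Assign ''i'' (Add (Reg ''i'') (Const 1)))))))"

definition layout :: "nat list list \<Rightarrow> store \<Rightarrow> bool" where
  "layout adj s \<longleftrightarrow> reg s ''n'' = length adj \<and> arr s ''off'' = arr (input_store adj) ''off'' \<and>
     arr s ''nbr'' = arr (input_store adj) ''nbr''"

lemma layout_off: "layout adj s \<Longrightarrow> u \<le> length adj \<Longrightarrow> arr s ''off'' u = length (concat (take u adj))"
  by (simp add: layout_def input_store_def)

lemma concat_take_Suc: "v < length adj \<Longrightarrow> concat (take (Suc v) adj) = concat (take v adj) @ adj ! v"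
  by (simp add: take_Suc_conv_app_nth)

lemma layout_nbr:
  assumes "layout adj s" "v < length adj" "j < length (adj ! v)"
  shows "arr s ''nbr'' (length (concat (take v adj)) + j) = adj ! v ! j"
proof -
  have "concat adj = concat (take v adj) @ adj ! v @ concat (drop (Suc v) adj)"
    using assms(2) by (metis append.assoc append_take_drop_id concat_append concat_take_Suc)
  then have "concat adj ! (length (concat (take v adj)) + j) = adj ! v ! j"
    "length (concat (take v adj)) + j < length (concat adj)"
    using assms(3) by (simp_all add: nth_append)
  then show ?thesis using assms(1) by (simp add: layout_def input_store_def)
qed

text \<open>\<open>J X\<close> is the loop invariant once the neighbours in \<open>X\<close> have
  been handled. A set suffices as parameter because the adjacency lists are in arbitrary order;
  distinctness ensures that the next neighbour is new.\<close>

lemma runs_scan: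
  assumes lay: "layout adj s" and v: "reg s ''v'' = v" "v < length adj"
    and body: "straight body" "{''n'', ''v'', ''k''} \<inter> wregs body = {}" "{''off'', ''nbr''} \<inter> warrs body = {}"
    and dist: "distinct (adj ! v)"
    and init: "J {} s"
    and loc: "\<And>X s k w. J X s \<Longrightarrow> J X (s\<lparr>reg := (reg s)(''k'' := k)\<rparr>) \<and> J X (s\<lparr>reg := (reg s)(''w'' := w)\<rparr>)"
    and step: "\<And>X s w. \<lbrakk>layout adj s; reg s ''v'' = v; reg s ''w'' = w; J X s; X \<subseteq> set (adj ! v);
       w \<in> set (adj ! v); w \<notin> X\<rbrakk> \<Longrightarrow> J (insert w X) (step body s)"
  shows "runs (scan body) s ((length (adj ! v) + 1) * (time body + 16)) (\<lambda>s'. J (set (adj ! v)) s')"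
proof -
  let ?o = "length (concat (take v adj))" and ?d = "length (adj ! v)"
  let ?b = "Less (Reg ''k'') (Get ''off'' (Add (Reg ''v'') (Const 1)))"
  let ?c = "Seq (Assign ''w'' (Get ''nbr'' (Reg ''k''))) (Seq body (Assign ''k'' (Add (Reg ''k'') (Const 1))))"
  define R where "R j s \<longleftrightarrow> layout adj s \<and> reg s ''v'' = v \<and> reg s ''k'' = ?o + j \<and> J (set (take j (adj ! v))) s" for j s
  have off: "arr s ''off'' v = ?o" "arr s ''off'' (Suc v) = ?o + ?d" if "layout adj s" for s
    using layout_off[OF that, of v] layout_off[OF that, of "Suc v"] v(2) concat_take_Suc[OF v(2)] by auto
  have iter: "R (Suc j) (step ?c s)" if R: "R j s" and j: "j < ?d" for j s
  proof -
    let ?s = "s\<lparr>reg := (reg s)(''w'' := adj ! v ! j)\<rparr>"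
    have s: "layout adj s" "reg s ''v'' = v" "reg s ''k'' = ?o + j" "J (set (take j (adj ! v))) s"
      using R by (auto simp: R_def)
    have w: "arr s ''nbr'' (?o + j) = adj ! v ! j" using layout_nbr[OF s(1) v(2) j] .
    have "adj ! v ! j \<notin> set (take j (adj ! v))"
      using dist j by (auto simp: in_set_conv_nth nth_eq_iff_index_eq)
    moreover have "set (take j (adj ! v)) \<subseteq> set (adj ! v)" by (rule set_take_subset)
    moreover have "layout adj ?s" using s(1) by (simp add: layout_def)
    ultimately have "J (insert (adj ! v ! j) (set (take j (adj ! v)))) (step body ?s)"
      using s j loc by (intro step) auto
    moreover have "insert (adj ! v ! j) (set (take j (adj ! v))) = set (take (Suc j) (adj ! v))"
      using j by (simp add: take_Suc_conv_app_nth)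
    moreover have fr: "reg (step body ?s) ''v'' = v" "reg (step body ?s) ''k'' = ?o + j"
      "layout adj (step body ?s)"
      using step_frame[of _ body ?s] s body(2,3) by (auto simp: layout_def)
    ultimately show ?thesis
      using loc by (simp add: R_def s w layout_def)
  qed
  \<comment> \<open>One round costs \<open>time body + 14\<close> including its test. The subtracted
    8 still leaves enough for the last test, which costs 7, and makes room for the assignment to
    \<open>k\<close> before the loop.\<close>
  have loop: "runs (While ?b ?c) s ((?d - j + 1) * (time body + 16) - 8) (\<lambda>s'. J (set (adj ! v)) s')"
    if "R j s" "j \<le> ?d" for j s
    using that
  proof (induction "?d - j" arbitrary: j s)
    case 0
    then have "\<not> bval ?b s" "J (set (adj ! v)) s" using off[of s] by (auto simp: R_def)
    then show ?case by (intro runs_WhileFalse) auto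
  next
    case (Suc m)
    then have j: "j < ?d" by simp
    show ?case
    proof (rule runs_WhileTrue)
      show "bval ?b s" using Suc.prems j off[of s] by (auto simp: R_def)
      show "runs ?c s (time body + 7) (R (Suc j))"
        using body(1) iter[OF Suc.prems(1) j] by (intro runs_step) auto
      show "runs (While ?b ?c) s' ((?d - Suc j + 1) * (time body + 16) - 8) (\<lambda>s'. J (set (adj ! v)) s')"
        if "R (Suc j) s'" for s'
        using Suc.hyps(1)[of "Suc j" s'] Suc.hyps(2) that j by simp
      have "?d - j + 1 = Suc (?d - Suc j + 1)" using j by simp
      then show "1 + bcost ?b + (time body + 7) + ((?d - Suc j + 1) * (time body + 16) - 8)
         \<le> (?d - j + 1) * (time body + 16) - 8" by simp
    qed
  qed
  show ?thesis
    unfolding scan_def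
  proof (rule runs_Seq)
    show "runs (Assign ''k'' (Get ''off'' (Reg ''v''))) s 3 (R 0)"
      using lay v init loc off[OF lay] by (intro runs_step) (auto simp: R_def layout_def)
    show "runs (While ?b ?c) s' ((?d - 0 + 1) * (time body + 16) - 8) (\<lambda>s'. J (set (adj ! v)) s')" if "R 0 s'" for s'
      by (rule loop[OF that]) simp
  qed simp
qed

lemma wregs_scan [simp]: "wregs (scan body) = {''k'', ''w''} \<union> wregs body"
  and warrs_scan [simp]: "warrs (scan body) = warrs body"
  by (auto simp: scan_def)

lemma sum_deg: "(\<Sum>v<length adj. length (adj ! v)) = length (concat adj)"
proof -
  have "length (concat adj) = sum_list (map length adj)" by (simp add: length_concat)
  also have "\<dots> = (\<Sum>v<length adj. length (adj ! v))"
    by (simp add: sum_list_sum_nth atLeast0LessThan)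
  finally show ?thesis by simp
qed

text \<open>The invariants depend on the set \<open>U\<close> of handled vertices, so that one rule
  serves all passes, whatever order \<open>pre\<close> selects. Since the selected vertex is never
  in \<open>U\<close>, each vertex is charged once, by its degree, and the total is linear.\<close>

lemma runs_sweep:
  assumes lay: "layout adj s"
    and straight: "straight pre" "straight body" "straight post"
    and regs: "{''n'', ''i'', ''k'', ''w''} \<inter> wregs pre = {}" "{''n'', ''i'', ''v'', ''k''} \<inter> wregs body = {}"
      "{''n'', ''i'', ''k'', ''w''} \<inter> wregs post = {}"
    and arrs: "{''off'', ''nbr''} \<inter> (warrs pre \<union> warrs body \<union> warrs post) = {}"
    and dist: "\<And>v. v < length adj \<Longrightarrow> distinct (adj ! v)"
    and init: "I {} s"
    and locI: "\<And>U s i. I U s \<Longrightarrow> I U (s\<lparr>reg := (reg s)(''i'' := i)\<rparr>)"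
    and locJ: "\<And>U v X s k w. J U v X s \<Longrightarrow>
       J U v X (s\<lparr>reg := (reg s)(''k'' := k)\<rparr>) \<and> J U v X (s\<lparr>reg := (reg s)(''w'' := w)\<rparr>)"
    and pre: "\<And>U s. \<lbrakk>U \<subseteq> {..<length adj}; card U < length adj; layout adj s; reg s ''i'' = card U; I U s\<rbrakk> \<Longrightarrow>
       reg (step pre s) ''v'' < length adj \<and> reg (step pre s) ''v'' \<notin> U \<and> J U (reg (step pre s) ''v'') {} (step pre s)"
    and body: "\<And>U v X w s. \<lbrakk>U \<subseteq> {..<length adj}; v < length adj; v \<notin> U; X \<subseteq> set (adj ! v); w \<in> set (adj ! v); w \<notin> X;
       layout adj s; reg s ''v'' = v; reg s ''w'' = w; J U v X s\<rbrakk> \<Longrightarrow> J U v (insert w X) (step body s)"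
    and post: "\<And>U v s. \<lbrakk>U \<subseteq> {..<length adj}; v < length adj; v \<notin> U; layout adj s; reg s ''v'' = v;
       J U v (set (adj ! v)) s\<rbrakk> \<Longrightarrow> I (insert v U) (step post s)"
    and T: "(time pre + time body + time post + 30) * (2 * length adj + length (concat adj) + 1) \<le> T"
  shows "runs (sweep pre body post) s T (\<lambda>s'. layout adj s' \<and> I {..<length adj} s')"
proof -
  let ?n = "length adj" and ?C = "time pre + time body + time post + 30"
  let ?b = "Less (Reg ''i'') (Reg ''n'')"
  let ?c = "Seq pre (Seq (scan body) (Seq post (Assign ''i'' (Add (Reg ''i'') (Const 1)))))"
  \<comment> \<open>The remaining time: every unhandled vertex is charged its degree plus 2, and the
    final 4 pays for the last test of the loop.\<close>
  define K where "K U = ?C * (\<Sum>v \<in> {..<?n} - U. length (adj ! v) + 2) + 4" for U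
  define R where "R U s \<longleftrightarrow> U \<subseteq> {..<?n} \<and> layout adj s \<and> reg s ''i'' = card U \<and> I U s" for U s
  have iter: "runs ?c s (?C * (length (adj ! v) + 2) - 4) (R (insert v U))"
    if R: "R U s" and lt: "card U < ?n" and v: "v = reg (step pre s) ''v''" for U v s
  proof -
    have s: "U \<subseteq> {..<?n}" "layout adj s" "reg s ''i'' = card U" "I U s" using R by (auto simp: R_def)
    have finite_parts: "finite U" using s(1) finite_subset by blast
    have vp: "v < ?n" "v \<notin> U" "J U v {} (step pre s)" using pre[OF s(1) lt s(2-4)] v by auto
    define Q where "Q s' \<longleftrightarrow> layout adj s' \<and> reg s' ''i'' = card U \<and> reg s' ''v'' = v" for s'
    have Q1: "Q (step pre s)"
      using step_frame[of _ pre s] regs(1) arrs s v by (auto simp: Q_def layout_def)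
    show ?thesis
    proof (rule runs_Seq)
      show "runs pre s (time pre) (\<lambda>s'. s' = step pre s)" by (rule runs_step) (use straight in auto)
    next
      fix s1 assume "s1 = step pre s"
      then have s1: "Q s1" "J U v {} s1" using Q1 vp by auto
      show "runs (Seq (scan body) (Seq post (Assign ''i'' (Add (Reg ''i'') (Const 1))))) s1
         ((length (adj ! v) + 1) * (time body + 16) + (time post + 4)) (R (insert v U))"
      proof (rule runs_Seq[OF _ _ order_refl])
        have "runs (scan body) s1 ((length (adj ! v) + 1) * (time body + 16)) (\<lambda>s'. J U v (set (adj ! v)) s')"
          using s1 regs(2) arrs straight(2) vp(1) dist locJ body[OF s(1) vp(1,2)]
          by (intro runs_scan) (auto simp: Q_def)
        from runs_frame[OF this]
        show "runs (scan body) s1 ((length (adj ! v) + 1) * (time body + 16)) (\<lambda>s'. J U v (set (adj ! v)) s' \<and> Q s')"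
          by (rule runs_weaken) (use s1(1) regs(2) arrs in \<open>auto simp: Q_def layout_def\<close>)
      next
        fix s2 assume s2: "J U v (set (adj ! v)) s2 \<and> Q s2"
        then have "I (insert v U) (step post s2)" using post[OF s(1) vp(1,2)] by (auto simp: Q_def)
        moreover have "reg (step post s2) ''i'' = card U" "layout adj (step post s2)"
          using step_frame[of _ post s2] regs(3) arrs s2 by (auto simp: Q_def layout_def)
        ultimately have "R (insert v U) (step (Seq post (Assign ''i'' (Add (Reg ''i'') (Const 1)))) s2)"
          using s(1) vp finite_parts locI by (auto simp: R_def layout_def)
        then show "runs (Seq post (Assign ''i'' (Add (Reg ''i'') (Const 1)))) s2 (time post + 4) (R (insert v U))"
          using straight(3) by (intro runs_step) auto
      qed
      next
      have "(length (adj ! v) + 1) * (time body + 16) \<le> (length (adj ! v) + 1) * ?C" by (intro mult_left_mono) auto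
      then show "time pre + ((length (adj ! v) + 1) * (time body + 16) + (time post + 4)) \<le> ?C * (length (adj ! v) + 2) - 4"
        by (simp add: algebra_simps)
    qed
  qed
  have loop: "runs (While ?b ?c) s (K U) (\<lambda>s'. layout adj s' \<and> I {..<?n} s')" if "R U s" for U s
    using that
  proof (induction "?n - card U" arbitrary: U s)
    case 0
    have finite_parts: "finite U" "U \<subseteq> {..<?n}" using 0 finite_subset by (auto simp: R_def)
    then have "card U \<le> ?n" using card_mono[of "{..<?n}" U] by simp
    then have "card U = ?n" using 0 by simp
    then have "U = {..<?n}" using finite_parts by (intro card_subset_eq) auto
    then show ?case using 0 by (intro runs_WhileFalse) (auto simp: R_def layout_def K_def)
  next
    case (Suc m)
    then have lt: "card U < ?n" by simp
    define v where "v = reg (step pre s) ''v''"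
    have U: "U \<subseteq> {..<?n}" "finite U" using Suc.prems finite_subset by (auto simp: R_def)
    have v: "v < ?n" "v \<notin> U" using pre[OF U(1) lt] Suc.prems by (auto simp: R_def v_def)
    show ?case
    proof (rule runs_WhileTrue)
      show "bval ?b s" using Suc.prems lt by (auto simp: R_def layout_def)
      show "runs ?c s (?C * (length (adj ! v) + 2) - 4) (R (insert v U))"
        by (rule iter[OF Suc.prems lt v_def])
      show "runs (While ?b ?c) s' (K (insert v U)) (\<lambda>s'. layout adj s' \<and> I {..<?n} s')" if "R (insert v U) s'" for s'
        using Suc.hyps(1)[OF _ that] Suc.hyps(2) U v by simp
      have "{..<?n} - U = insert v ({..<?n} - insert v U)" using v by auto
      then have "(\<Sum>v \<in> {..<?n} - U. length (adj ! v) + 2) =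
         (length (adj ! v) + 2) + (\<Sum>v \<in> {..<?n} - insert v U. length (adj ! v) + 2)"
        by (metis (no_types, lifting) DiffD2 finite_Diff finite_lessThan insertI1 sum.insert)
      then have "K U = ?C * (length (adj ! v) + 2) + K (insert v U)"
        by (simp add: K_def algebra_simps)
      moreover have "4 \<le> ?C * (length (adj ! v) + 2)" by simp
      ultimately show "1 + bcost ?b + (?C * (length (adj ! v) + 2) - 4) + K (insert v U) \<le> K U" by simp
    qed
  qed
  have "K {} = ?C * (length (concat adj) + 2 * ?n) + 4"
    unfolding K_def Diff_empty sum.distrib sum_deg by simp
  then have K: "2 + K {} \<le> T" using T by (simp add: algebra_simps)
  show ?thesis
    unfolding sweep_def
  proof (rule runs_Seq)
    show "runs (Assign ''i'' (Const 0)) s 2 (R {})"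
      using lay init locI by (intro runs_step) (auto simp: R_def layout_def)
  qed (use loop K in auto)
qed

lemma wregs_sweep [simp]: "wregs (sweep pre body post) = {''i'', ''k'', ''w''} \<union> wregs pre \<union> wregs body \<union> wregs post"
  and warrs_sweep [simp]: "warrs (sweep pre body post) = warrs pre \<union> warrs body \<union> warrs post"
  by (auto simp: sweep_def)

section \<open>The program\<close>

text \<open>Arrays: \<open>ord\<close> is the search queue; \<open>ce\<close>, \<open>cn\<close>, \<open>cu\<close>, \<open>cc\<close> and \<open>pr\<close> hold, at the representative of
  a block, the number of its spare and of its needy vertices found so far, whether it has an
  undominated and a chosen vertex, and the parity of \<open>ce + cn\<close>; \<open>fx\<close> marks the needy vertices
  that are repaired at the price of one vertex. In the top-down pass \<open>cn\<close> is reused for the number of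
  needy vertices not yet served, and \<open>av\<close> says whether the token of the current vertex is available.\<close>

definition bfs_init :: com where
  "bfs_init = Seq (Put ''par'' (Const 0) (Reg ''n'')) (Seq (Put ''vis'' (Const 0) (Const 1)) (Assign ''t'' (Const 1)))"

definition bfs_pre :: com where
  "bfs_pre = Assign ''v'' (Get ''ord'' (Reg ''i''))"

definition bfs_body :: com where
  "bfs_body = Cond (Equal (Get ''vis'' (Reg ''w'')) (Const 0))
     (Seq (Put ''vis'' (Reg ''w'') (Const 1)) (Seq (Put ''par'' (Reg ''w'') (Reg ''v''))
       (Seq (Put ''ord'' (Reg ''t'') (Reg ''w'')) (Assign ''t'' (Add (Reg ''t'') (Const 1)))))) Skip"

definition bfs :: com where
  "bfs = Seq bfs_init (sweep bfs_pre bfs_body Skip)"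

definition lead_pre :: com where
  "lead_pre = Seq (Assign ''v'' (Reg ''i'')) (Assign ''l'' (Reg ''i''))"

definition lead_body :: com where
  "lead_body = Cond (Conj (Equal (Get ''par'' (Reg ''w'')) (Get ''par'' (Reg ''v''))) (Less (Reg ''w'') (Reg ''l'')))
     (Assign ''l'' (Reg ''w'')) Skip"

definition lead_post :: com where
  "lead_post = Put ''ld'' (Reg ''v'') (Reg ''l'')"

definition leads_of :: com where
  "leads_of = sweep lead_pre lead_body lead_post"

locale adjacency =
  fixes adj :: "nat list list"
  assumes two_le: "2 \<le> length adj"
    and dist: "u < length adj \<Longrightarrow> distinct (adj ! u)"
    and range: "u < length adj \<Longrightarrow> set (adj ! u) \<subseteq> {..<length adj}"
    and reach: "\<lbrakk>0 \<in> S; S \<subseteq> {..<length adj}; \<And>u. u \<in> S \<Longrightarrow> set (adj ! u) \<subseteq> S\<rbrakk> \<Longrightarrow> S = {..<length adj}"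
begin

abbreviation n :: nat where "n \<equiv> length adj"
abbreviation N :: "nat \<Rightarrow> nat set" where "N u \<equiv> set (adj ! u)"

definition first_parent :: "(nat \<Rightarrow> nat) \<Rightarrow> (nat \<Rightarrow> nat) \<Rightarrow> nat \<Rightarrow> bool" where
  "first_parent ord par k \<longleftrightarrow> (\<exists>j<k. par (ord k) = ord j \<and> ord k \<in> N (ord j) \<and> (\<forall>i<j. ord k \<notin> N (ord i)))"

text \<open>The first \<open>t\<close> entries of \<open>ord\<close> are the discovered vertices,
  and the first \<open>card U\<close> of these are the handled ones; the entries in between form the
  waiting queue.\<close>

definition bfs_inv :: "nat set \<Rightarrow> nat \<Rightarrow> (nat \<Rightarrow> nat) \<Rightarrow> (nat \<Rightarrow> nat) \<Rightarrow> (nat \<Rightarrow> nat) \<Rightarrow> bool" where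
  "bfs_inv U t ord vis par \<longleftrightarrow> inj_on ord {..<t} \<and> ord 0 = 0 \<and> 0 < t \<and> ord ` {..<t} \<subseteq> {..<n} \<and>
     card U \<le> t \<and> U = ord ` {..<card U} \<and> (\<forall>v. vis v = of_bool (v \<in> ord ` {..<t})) \<and>
     (\<forall>u \<in> U. N u \<subseteq> ord ` {..<t}) \<and> par 0 = n \<and> (\<forall>k<t. 0 < k \<longrightarrow> first_parent ord par k)"

abbreviation bfs_store :: "nat set \<Rightarrow> store \<Rightarrow> bool" where
  "bfs_store U s \<equiv> bfs_inv U (reg s ''t'') (arr s ''ord'') (arr s ''vis'') (arr s ''par'')"

lemma bfs_inv_extend:
  assumes inv: "bfs_inv U t ord vis par" and v: "card U < t" "v = ord (card U)"
    and w: "w \<in> N v" "w < n" "w \<notin> ord ` {..<t}"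
  shows "bfs_inv U (Suc t) (ord(t := w)) (vis(w := 1)) (par(w := v))"
proof -
  have i: "inj_on ord {..<t}" "ord 0 = 0" "0 < t" "ord ` {..<t} \<subseteq> {..<n}" "card U \<le> t" "U = ord ` {..<card U}"
    "\<And>v. vis v = of_bool (v \<in> ord ` {..<t})" "\<And>u. u \<in> U \<Longrightarrow> N u \<subseteq> ord ` {..<t}" "par 0 = n"
    "\<And>k. k < t \<Longrightarrow> 0 < k \<Longrightarrow> first_parent ord par k"
    using inv unfolding bfs_inv_def by auto
  let ?o = "ord(t := w)"
  have im: "?o ` {..<Suc t} = insert w (ord ` {..<t})" by (auto simp: lessThan_Suc)
  have old: "?o k = ord k" if "k < t" for k using that by simp
  have "first_parent ?o (par(w := v)) k" if k: "k < Suc t" "0 < k" for k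
  proof (cases "k = t")
    case True
    \<comment> \<open>Vertices that precede \<open>v\<close> in the queue are handled, so all their
      neighbours are discovered. As \<open>w\<close> is not, \<open>v\<close> is its earliest
      neighbour.\<close>
    have "w \<notin> N (ord i)" if "i < card U" for i
    proof -
      have "ord i \<in> U" using that by (subst i(6)) blast
      then show ?thesis using i(8) w(3) by blast
    qed
    then show ?thesis unfolding first_parent_def using True v w(1) by (intro exI[of _ "card U"]) auto
  next
    case False
    then have kt: "k < t" using k by simp
    then obtain j where j: "j < k" "par (ord k) = ord j" "ord k \<in> N (ord j)" "\<forall>i<j. ord k \<notin> N (ord i)"
      using i(10)[OF kt k(2)] unfolding first_parent_def by blast
    have "ord k \<noteq> w" using w(3) kt by blast
    then show ?thesis unfolding first_parent_def using j kt by (intro exI[of _ j]) auto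
  qed
  moreover have "inj_on ?o {..<Suc t}" using i(1) w(3) by (auto simp: inj_on_def less_Suc_eq)
  moreover have "?o 0 = 0" using i by simp
  moreover have "U = ?o ` {..<card U}" using i(6) v(1) by auto
  moreover have "w \<noteq> 0" using w(3) i(2,3) by force
  moreover have "\<forall>u \<in> U. N u \<subseteq> insert w (ord ` {..<t})" using i(8) by blast
  ultimately show ?thesis
    unfolding bfs_inv_def im using i(2-5,7,9) w by auto
qed

lemma bfs_inv_next:
  assumes inv: "bfs_inv U t ord vis par" and v: "card U < t" "v = ord (card U)" "v \<notin> U" "finite U"
    and N: "N v \<subseteq> ord ` {..<t}"
  shows "bfs_inv (insert v U) t ord vis par"
proof -
  have c: "card (insert v U) = Suc (card U)" using v by simp
  have i: "inj_on ord {..<t}" "ord 0 = 0" "0 < t" "ord ` {..<t} \<subseteq> {..<n}" "U = ord ` {..<card U}"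
    "\<forall>v. vis v = of_bool (v \<in> ord ` {..<t})" "\<forall>u \<in> U. N u \<subseteq> ord ` {..<t}" "par 0 = n"
    "\<forall>k<t. 0 < k \<longrightarrow> first_parent ord par k"
    using inv unfolding bfs_inv_def by blast+
  have "insert v U = ord ` {..<Suc (card U)}"
    unfolding lessThan_Suc image_insert i(5)[symmetric] v(2) ..
  moreover have "\<forall>u \<in> insert v U. N u \<subseteq> ord ` {..<t}" using i(7) N by blast
  moreover have "Suc (card U) \<le> t" using v(1) by simp
  ultimately show ?thesis unfolding bfs_inv_def c using i by (intro conjI)
qed

lemma bfs_correct:
  assumes lay: "layout adj s" and z: "arr s ''vis'' = (\<lambda>_. 0)" "arr s ''ord'' = (\<lambda>_. 0)"
  shows "runs bfs s (100 * (2 * n + length (concat adj) + 1)) (\<lambda>s'. layout adj s' \<and>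
     bij_betw (arr s' ''ord'') {..<n} {..<n} \<and> arr s' ''ord'' 0 = 0 \<and> arr s' ''par'' 0 = n \<and>
     (\<forall>k<n. 0 < k \<longrightarrow> first_parent (arr s' ''ord'') (arr s' ''par'') k))"
proof -
  have n0: "0 < n" using two_le by linarith
  show ?thesis
    unfolding bfs_def
  proof (rule runs_Seq)
    show "runs bfs_init s 10 (\<lambda>s'. layout adj s' \<and> bfs_store {} s')"
    proof (rule runs_step)
      have "bfs_inv {} 1 (\<lambda>_. 0) ((\<lambda>_. 0)(0 := 1)) ((arr s ''par'')(0 := n))"
        unfolding bfs_inv_def using n0 by (auto simp: fun_eq_iff inj_on_def Suc_le_eq)
      then show "layout adj (step bfs_init s) \<and> bfs_store {} (step bfs_init s)"
        using lay z by (simp add: bfs_init_def layout_def)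
    qed (simp_all add: bfs_init_def)
  next
    fix s assume s: "layout adj s \<and> bfs_store {} s"
    let ?J = "\<lambda>U v X s. bfs_store U s \<and> card U < reg s ''t'' \<and> v = arr s ''ord'' (card U) \<and> X \<subseteq> arr s ''ord'' ` {..<reg s ''t''}"
    have "runs (sweep bfs_pre bfs_body Skip) s (90 * (2 * n + length (concat adj) + 1))
       (\<lambda>s'. layout adj s' \<and> bfs_store {..<n} s')"
    proof (rule runs_sweep[where J = ?J])
      show "layout adj s" "bfs_store {} s" using s by auto
      show "straight bfs_pre" "straight bfs_body" "straight Skip"
        "{''n'', ''i'', ''k'', ''w''} \<inter> wregs bfs_pre = {}" "{''n'', ''i'', ''v'', ''k''} \<inter> wregs bfs_body = {}"
        "{''n'', ''i'', ''k'', ''w''} \<inter> wregs Skip = {}"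
        "{''off'', ''nbr''} \<inter> (warrs bfs_pre \<union> warrs bfs_body \<union> warrs Skip) = {}"
        by (simp_all add: bfs_pre_def bfs_body_def)
      show "distinct (adj ! v)" if "v < n" for v by (rule dist[OF that])
      show "(time bfs_pre + time bfs_body + time Skip + 30) * (2 * n + length (concat adj) + 1)
        \<le> 90 * (2 * n + length (concat adj) + 1)"
        by (rule mult_le_mono1) (simp add: bfs_pre_def bfs_body_def)
      show "bfs_store U (s\<lparr>reg := (reg s)(''i'' := i)\<rparr>)" if "bfs_store U s" for U s i using that by simp
      show "?J U v X (s\<lparr>reg := (reg s)(''k'' := k)\<rparr>) \<and> ?J U v X (s\<lparr>reg := (reg s)(''w'' := w)\<rparr>)"
        if "?J U v X s" for U v X s k w using that by simp
    next
      fix U s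
      assume U: "U \<subseteq> {..<n}" "card U < n" and lay: "layout adj s" and i: "reg s ''i'' = card U" and inv: "bfs_store U s"
      define t ord where "t = reg s ''t''" and "ord = arr s ''ord''"
      have I: "inj_on ord {..<t}" "ord 0 = 0" "0 < t" "ord ` {..<t} \<subseteq> {..<n}" "card U \<le> t" "U = ord ` {..<card U}"
        "\<And>u. u \<in> U \<Longrightarrow> N u \<subseteq> ord ` {..<t}"
        using inv unfolding bfs_inv_def t_def ord_def by auto
      \<comment> \<open>If the queue were exhausted, the handled vertices would be closed under
        neighbours, and by connectivity no vertex would be left.\<close>
      have lt: "card U < t"
      proof (rule ccontr)
        assume "\<not> card U < t"
        then have Ut: "U = ord ` {..<t}" using I(5,6) by simp
        moreover have "0 \<in> ord ` {..<t}" using I(2,3) by force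
        ultimately have "U = {..<n}" using reach[of U] I(7) U(1) by auto
        then show False using U(2) by simp
      qed
      then have "ord (card U) < n" using I(4) by auto
      moreover have "ord (card U) \<notin> U"
      proof
        assume "ord (card U) \<in> U"
        then have "ord (card U) \<in> ord ` {..<card U}" by (subst (asm) (2) I(6))
        then obtain j where "j < card U" "ord j = ord (card U)" by auto
        then show False using I(1) lt by (auto simp: inj_on_def)
      qed
      ultimately show "reg (step bfs_pre s) ''v'' < n \<and> reg (step bfs_pre s) ''v'' \<notin> U \<and>
        ?J U (reg (step bfs_pre s) ''v'') {} (step bfs_pre s)"
        using inv lt i by (simp add: bfs_pre_def t_def ord_def)
    next
      fix U v X w s
      assume v: "v < n" and w: "w \<in> N v" and regs: "reg s ''v'' = v" "reg s ''w'' = w" and J: "?J U v X s"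
      have wn: "w < n" using w v range by auto
      have vis: "arr s ''vis'' w = of_bool (w \<in> arr s ''ord'' ` {..<reg s ''t''})"
        using J unfolding bfs_inv_def by blast
      show "?J U v (insert w X) (step bfs_body s)"
      proof (cases "w \<in> arr s ''ord'' ` {..<reg s ''t''}")
        case True
        then show ?thesis using J regs vis by (simp add: bfs_body_def)
      next
        case False
        have "bfs_inv U (Suc (reg s ''t'')) ((arr s ''ord'')(reg s ''t'' := w)) ((arr s ''vis'')(w := 1)) ((arr s ''par'')(w := v))"
          by (rule bfs_inv_extend) (use J w wn False in auto)
        moreover have "((arr s ''ord'')(reg s ''t'' := w)) ` {..<Suc (reg s ''t'')} = insert w (arr s ''ord'' ` {..<reg s ''t''})"
          by (auto simp: lessThan_Suc)
        ultimately show ?thesis using J regs vis False by (auto simp: bfs_body_def)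
      qed
    next
      fix U v s
      assume "U \<subseteq> {..<n}" "v < n" "v \<notin> U" and J: "?J U v (N v) s"
      then show "bfs_store (insert v U) (step Skip s)"
        using J bfs_inv_next finite_subset[OF _ finite_lessThan] by simp
    qed
    then show "runs (sweep bfs_pre bfs_body Skip) s (90 * (2 * n + length (concat adj) + 1)) (\<lambda>s'. layout adj s' \<and>
     bij_betw (arr s' ''ord'') {..<n} {..<n} \<and> arr s' ''ord'' 0 = 0 \<and> arr s' ''par'' 0 = n \<and>
     (\<forall>k<n. 0 < k \<longrightarrow> first_parent (arr s' ''ord'') (arr s' ''par'') k))"
    proof (rule runs_weaken)
      fix s' assume s': "layout adj s' \<and> bfs_store {..<n} s'"
      then have *: "inj_on (arr s' ''ord'') {..<reg s' ''t''}" "arr s' ''ord'' ` {..<reg s' ''t''} \<subseteq> {..<n}" "n \<le> reg s' ''t''"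
        unfolding bfs_inv_def by auto
      then have "reg s' ''t'' \<le> n" using card_inj_on_le[OF *(1,2)] by simp
      then have t: "reg s' ''t'' = n" using *(3) by simp
      have "arr s' ''ord'' ` {..<n} = {..<n}"
        using * unfolding t by (intro card_subset_eq) (auto simp: card_image)
      then have "bij_betw (arr s' ''ord'') {..<n} {..<n}" using * t by (simp add: bij_betw_def)
      moreover have **: "arr s' ''ord'' 0 = 0" "arr s' ''par'' 0 = n"
        "\<forall>k<reg s' ''t''. 0 < k \<longrightarrow> first_parent (arr s' ''ord'') (arr s' ''par'') k"
        using s' unfolding bfs_inv_def by blast+
      ultimately show "layout adj s' \<and> bij_betw (arr s' ''ord'') {..<n} {..<n} \<and> arr s' ''ord'' 0 = 0 \<and> arr s' ''par'' 0 = n \<and>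
        (\<forall>k<n. 0 < k \<longrightarrow> first_parent (arr s' ''ord'') (arr s' ''par'') k)"
        using ** s' unfolding t by blast
    qed simp
  qed simp
qed

lemma leads_of_correct:
  assumes lay: "layout adj s"
  shows "runs leads_of s (70 * (2 * n + length (concat adj) + 1)) (\<lambda>s'. layout adj s' \<and>
     (\<forall>u<n. arr s' ''ld'' u = Min (insert u {w \<in> N u. arr s ''par'' w = arr s ''par'' u})))"
proof -
  define par where "par = arr s ''par''"
  define M where "M u X = Min (insert u {w \<in> X. par w = par u})" for u X
  let ?I = "\<lambda>U (s::store). arr s ''par'' = par \<and> U = {..<card U} \<and> (\<forall>u \<in> U. arr s ''ld'' u = M u (N u))"
  let ?J = "\<lambda>U v X s. ?I U s \<and> v = card U \<and> reg s ''l'' = M v X"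
  have "runs (sweep lead_pre lead_body lead_post) s (70 * (2 * n + length (concat adj) + 1))
       (\<lambda>s'. layout adj s' \<and> ?I {..<n} s')"
  proof (rule runs_sweep[where J = ?J])
    show "layout adj s" by (rule lay)
    show "?I {} s" by (simp add: par_def)
    show "straight lead_pre" "straight lead_body" "straight lead_post"
      "{''n'', ''i'', ''k'', ''w''} \<inter> wregs lead_pre = {}" "{''n'', ''i'', ''v'', ''k''} \<inter> wregs lead_body = {}"
      "{''n'', ''i'', ''k'', ''w''} \<inter> wregs lead_post = {}"
      "{''off'', ''nbr''} \<inter> (warrs lead_pre \<union> warrs lead_body \<union> warrs lead_post) = {}"
      by (simp_all add: lead_pre_def lead_body_def lead_post_def)
    show "distinct (adj ! v)" if "v < n" for v by (rule dist[OF that])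
    show "(time lead_pre + time lead_body + time lead_post + 30) * (2 * n + length (concat adj) + 1)
        \<le> 70 * (2 * n + length (concat adj) + 1)"
      by (rule mult_le_mono1) (simp add: lead_pre_def lead_body_def lead_post_def)
  next
    fix U s
    assume "card U < n" "reg s ''i'' = card U" "?I U s"
    then show "reg (step lead_pre s) ''v'' < n \<and> reg (step lead_pre s) ''v'' \<notin> U \<and>
        ?J U (reg (step lead_pre s) ''v'') {} (step lead_pre s)"
      by (auto simp: lead_pre_def M_def)
  next
    fix U v X w s
    assume X: "X \<subseteq> N v" and regs: "reg s ''v'' = v" "reg s ''w'' = w" and J: "?J U v X s"
    have finite_parts: "finite (insert v {w \<in> X. par w = par v})" using X finite_subset by fastforce
    have "insert v {x \<in> insert w X. par x = par v} =
       (if par w = par v then insert w (insert v {w \<in> X. par w = par v}) else insert v {w \<in> X. par w = par v})" by auto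
    moreover have "Min (insert w (insert v {w \<in> X. par w = par v})) = min w (M v X)"
      unfolding M_def by (rule Min_insert[OF finite_parts]) simp
    ultimately have "M v (insert w X) = (if par w = par v then min w (M v X) else M v X)"
      by (simp add: M_def)
    then have "M v (insert w X) = (if par w = par v \<and> w < M v X then w else M v X)"
      by (simp add: min_def)
    then show "?J U v (insert w X) (step lead_body s)"
      using J regs by (simp add: lead_body_def)
  next
    fix U v s
    assume "U \<subseteq> {..<n}" "v \<notin> U" and regs: "reg s ''v'' = v" and J: "?J U v (N v) s"
    then have "card (insert v U) = Suc (card U)" by (metis card_insert_disjoint finite_lessThan finite_subset)
    moreover have "U = {..<card U}" "v = card U" using J by auto
    ultimately show "?I (insert v U) (step lead_post s)" using J regs by (auto simp: lead_post_def lessThan_Suc)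
  qed auto
  then show ?thesis unfolding leads_of_def M_def par_def by (rule runs_weaken) auto
qed

end

text \<open>The chosen kinds receive the codes above 2, so that a single comparison decides
  \<open>chosen\<close>.\<close>

fun kind_code :: "kind \<Rightarrow> nat" where
  "kind_code Undominated = 0"
| "kind_code Dominated = 1"
| "kind_code Needy = 2"
| "kind_code Spare = 3"
| "kind_code Full = 4"
| "kind_code Full_Needy = 5"

section \<open>The bottom-up pass\<close>

definition kinds_pre :: com where
  "kinds_pre = Seq (Assign ''v'' (Get ''ord'' (Sub (Sub (Reg ''n'') (Const 1)) (Reg ''i''))))
     (Seq (Assign ''df'' (Const 0)) (Seq (Assign ''sp'' (Const 0)) (Seq (Assign ''fu'' (Const 0)) (Assign ''ad'' (Const 0)))))"

text \<open>The test \<open>ld w = w\<close> selects one child per block, so every block is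
  evaluated once. Parities are flipped by subtraction from 1, guided by the stored parity
  \<open>pr\<close>, because the machine has no division.\<close>

definition kinds_body :: com where
  "kinds_body = Cond (Conj (Equal (Get ''par'' (Reg ''w'')) (Reg ''v'')) (Equal (Get ''ld'' (Reg ''w'')) (Reg ''w'')))
     (Seq (Cond (Less (Get ''ce'' (Reg ''w'')) (Get ''cn'' (Reg ''w''))) (Assign ''df'' (Const 1))
            (Cond (Equal (Get ''pr'' (Reg ''w'')) (Const 1)) (Assign ''sp'' (Sub (Const 1) (Reg ''sp''))) Skip))
       (Cond (Equal (Get ''cc'' (Reg ''w'')) (Const 1)) (Assign ''ad'' (Const 1))
         (Cond (Equal (Get ''cu'' (Reg ''w'')) (Const 1)) (Assign ''fu'' (Const 1)) Skip))) Skip"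

definition kinds_choose :: com where
  "kinds_choose = Cond (Equal (Reg ''df'') (Const 1))
     (Cond (Equal (Reg ''sp'') (Const 1)) (Assign ''x'' (Const 5)) (Assign ''x'' (Const 4)))
     (Cond (Equal (Reg ''fu'') (Const 1))
       (Cond (Equal (Reg ''sp'') (Const 1)) (Assign ''x'' (Const 4)) (Assign ''x'' (Const 3)))
       (Cond (Equal (Reg ''sp'') (Const 1)) (Assign ''x'' (Const 2))
         (Cond (Equal (Reg ''ad'') (Const 1)) (Assign ''x'' (Const 1)) (Assign ''x'' (Const 0)))))"

definition kinds_record :: com where
  "kinds_record = Seq (Put ''ty'' (Reg ''v'') (Reg ''x'')) (Seq (Assign ''l'' (Get ''ld'' (Reg ''v'')))
    (Seq (Cond (Equal (Reg ''x'') (Const 0)) (Put ''cu'' (Reg ''l'') (Const 1)) Skip)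
    (Seq (Cond (Less (Const 2) (Reg ''x'')) (Put ''cc'' (Reg ''l'') (Const 1)) Skip)
    (Seq (Cond (Equal (Reg ''x'') (Const 3))
      (Seq (Put ''ce'' (Reg ''l'') (Add (Get ''ce'' (Reg ''l'')) (Const 1)))
        (Put ''pr'' (Reg ''l'') (Sub (Const 1) (Get ''pr'' (Reg ''l''))))) Skip)
    (Cond (Conj (Neg (Equal (Reg ''x'') (Const 2))) (Neg (Equal (Reg ''x'') (Const 5)))) Skip
      (Seq (Put ''cn'' (Reg ''l'') (Add (Get ''cn'' (Reg ''l'')) (Const 1)))
        (Put ''pr'' (Reg ''l'') (Sub (Const 1) (Get ''pr'' (Reg ''l''))))))))))"

definition kinds :: com where
  "kinds = sweep kinds_pre kinds_body (Seq kinds_choose kinds_record)"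

lemma step_choose:
  assumes "reg s ''df'' = of_bool d" "reg s ''fu'' = of_bool f" "reg s ''sp'' = of_bool p" "reg s ''ad'' = of_bool a"
  shows "step kinds_choose s = s\<lparr>reg := (reg s)(''x'' := kind_code (kind_of d f p a))\<rparr>"
  using assms by (simp add: kinds_choose_def kind_of_def)

lemma step_record:
  assumes "reg s ''x'' = kind_code k" "reg s ''v'' = v" "arr s ''ld'' v = l"
  shows "arr (step kinds_record s) ''ty'' = (arr s ''ty'')(v := kind_code k)"
    "arr (step kinds_record s) ''cu'' = (if k = Undominated then (arr s ''cu'')(l := 1) else arr s ''cu'')"
    "arr (step kinds_record s) ''cc'' = (if chosen k then (arr s ''cc'')(l := 1) else arr s ''cc'')"
    "arr (step kinds_record s) ''ce'' = (if k = Spare then (arr s ''ce'')(l := arr s ''ce'' l + 1) else arr s ''ce'')"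
    "arr (step kinds_record s) ''cn'' = (if needy k then (arr s ''cn'')(l := arr s ''cn'' l + 1) else arr s ''cn'')"
    "arr (step kinds_record s) ''pr'' =
       (if k = Spare \<or> needy k then (arr s ''pr'')(l := 1 - arr s ''pr'' l) else arr s ''pr'')"
    "arr (step kinds_record s) ''ord'' = arr s ''ord''"
    "arr (step kinds_record s) ''par'' = arr s ''par''"
    "arr (step kinds_record s) ''ld'' = arr s ''ld''"
  using assms by (cases k; simp add: kinds_record_def chosen_def needy_def)+

locale block_run = adjacency adj + search_tree "length adj" A ord par
  for adj :: "nat list list" and A ord par +
  assumes A_N: "u < length adj \<Longrightarrow> A u = set (adj ! u)"
begin

definition tree_store :: "store \<Rightarrow> bool" where
  "tree_store s \<longleftrightarrow> arr s ''ord'' = ord \<and> arr s ''par'' = par \<and> (\<forall>u<n. arr s ''ld'' u = ld u)"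

definition counts :: "nat set \<Rightarrow> store \<Rightarrow> bool" where
  "counts U s \<longleftrightarrow> (\<forall>l. 0 < l \<and> l < n \<longrightarrow>
     arr s ''ce'' l = card {c \<in> blk l \<inter> U. ty c = Spare} \<and>
     arr s ''cn'' l = card {c \<in> blk l \<inter> U. needy (ty c)} \<and>
     arr s ''cu'' l = of_bool (\<exists>c \<in> blk l \<inter> U. ty c = Undominated) \<and>
     arr s ''cc'' l = of_bool (\<exists>c \<in> blk l \<inter> U. chosen (ty c)) \<and>
     arr s ''pr'' l = (arr s ''ce'' l + arr s ''cn'' l) mod 2)"

text \<open>Vertices are handled in reverse order of discovery; the condition on \<open>pos\<close>
  says that \<open>U\<close> consists of the last \<open>card U\<close> of them.\<close>

definition kinds_inv :: "nat set \<Rightarrow> store \<Rightarrow> bool" where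
  "kinds_inv U s \<longleftrightarrow> U = {u. u < n \<and> n \<le> pos u + card U} \<and> tree_store s \<and>
     (\<forall>u \<in> U. arr s ''ty'' u = kind_code (ty u)) \<and> counts U s"

definition scan_inv :: "nat \<Rightarrow> nat set \<Rightarrow> store \<Rightarrow> bool" where
  "scan_inv v X s \<longleftrightarrow>
     reg s ''df'' = of_bool (\<exists>l \<in> leads v \<inter> X. ecount ty l < ncount ty l) \<and>
     reg s ''sp'' = (\<Sum>l \<in> leads v \<inter> X. ecount ty l - ncount ty l) mod 2 \<and>
     reg s ''fu'' = of_bool (\<exists>l \<in> leads v \<inter> X. (\<exists>c \<in> blk l. ty c = Undominated) \<and> (\<forall>c \<in> blk l. \<not> chosen (ty c))) \<and>
     reg s ''ad'' = of_bool (\<exists>l \<in> leads v \<inter> X. \<exists>c \<in> blk l. chosen (ty c))"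

lemma leads_sub: "leads v \<subseteq> A v"
  using kids_A by (auto simp: leads_def)

lemma leads_mem: "w < n \<Longrightarrow> v < n \<Longrightarrow> w \<in> leads v \<longleftrightarrow> par w = v \<and> ld w = w"
  using par_root by (cases "w = 0") (auto simp: leads_def kids_def)

lemma counts_block:
  assumes "counts U s" "l \<in> leads v" "blk l \<subseteq> U"
  shows "arr s ''ce'' l = ecount ty l" "arr s ''cn'' l = ncount ty l"
    "arr s ''cu'' l = of_bool (\<exists>c \<in> blk l. ty c = Undominated)"
    "arr s ''cc'' l = of_bool (\<exists>c \<in> blk l. chosen (ty c))"
    "arr s ''pr'' l = (ecount ty l + ncount ty l) mod 2"
proof -
  have "0 < l \<and> l < n" using assms(2) by (auto simp: leads_def kids_def)
  moreover have B: "blk l \<inter> U = blk l" using assms(3) by blast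
  ultimately have c: "arr s ''ce'' l = card {c \<in> blk l. ty c = Spare} \<and>
     arr s ''cn'' l = card {c \<in> blk l. needy (ty c)} \<and>
     arr s ''cu'' l = of_bool (\<exists>c \<in> blk l. ty c = Undominated) \<and>
     arr s ''cc'' l = of_bool (\<exists>c \<in> blk l. chosen (ty c)) \<and>
     arr s ''pr'' l = (arr s ''ce'' l + arr s ''cn'' l) mod 2"
    using assms(1)[unfolded counts_def, rule_format, of l] unfolding B by blast
  then show "arr s ''ce'' l = ecount ty l" "arr s ''cn'' l = ncount ty l"
    "arr s ''cu'' l = of_bool (\<exists>c \<in> blk l. ty c = Undominated)"
    "arr s ''cc'' l = of_bool (\<exists>c \<in> blk l. chosen (ty c))"
    "arr s ''pr'' l = (ecount ty l + ncount ty l) mod 2"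
    unfolding ecount_def ncount_def by simp_all
qed

text \<open>If the truncated subtraction does not cut off, \<open>e - m\<close> and
  \<open>e + m\<close> have the same parity, and the parity of the sum is what \<open>pr\<close>
  maintains.\<close>

lemma toggle_mod2: "(a::nat) < 2 \<Longrightarrow> (a + (e - m)) mod 2 = (if e < m then a else if (e + m) mod 2 = 1 then 1 - a else a)"
proof (cases "e < m")
  case False
  define d where "d = e - m"
  assume "a < 2"
  have e: "e = m + d" using False by (simp add: d_def)
  have "e + m = d + 2 * m" using e by simp
  then have "(e + m) mod 2 = d mod 2" by (simp only: mod_mult_self2)
  moreover have "(a + d) mod 2 = (if d mod 2 = 1 then 1 - a else a)"
    using \<open>a < 2\<close> by (cases "a = 0") (auto simp: mod_Suc less_2_cases_iff)
  ultimately show ?thesis using False by (simp add: d_def)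
qed simp

lemma scan_body:
  assumes inv: "scan_inv v X s" and t: "tree_store s" and c: "counts U s" and U: "kids v \<subseteq> U"
    and v: "v < n" "reg s ''v'' = v" and w: "w < n" "reg s ''w'' = w" "w \<notin> X" and X: "finite X"
  shows "scan_inv v (insert w X) (step kinds_body s)"
proof -
  have par: "arr s ''par'' w = par w" "arr s ''ld'' w = ld w" using t w by (auto simp: tree_store_def)
  show ?thesis
  proof (cases "w \<in> leads v")
    case False
    then have "leads v \<inter> insert w X = leads v \<inter> X" by blast
    moreover have "\<not> (par w = v \<and> ld w = w)" using False leads_mem w v by blast
    ultimately show ?thesis using inv par v w by (auto simp: kinds_body_def scan_inv_def)
  next
    case True
    have "blk w \<subseteq> U" using blk_kids[OF True] U by blast
    note cb = counts_block[OF c True this]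
    have ins: "leads v \<inter> insert w X = insert w (leads v \<inter> X)" using True by blast
    have test: "par w = v" "ld w = w" using True leads_mem w v by auto
    have sum: "(\<Sum>l \<in> insert w (leads v \<inter> X). ecount ty l - ncount ty l) mod 2 =
       ((\<Sum>l \<in> leads v \<inter> X. ecount ty l - ncount ty l) mod 2 + (ecount ty w - ncount ty w)) mod 2"
      using w X by (simp add: mod_simps add.commute)
    have sp: "(\<Sum>l \<in> insert w (leads v \<inter> X). ecount ty l - ncount ty l) mod 2 =
       (if ecount ty w < ncount ty w then reg s ''sp''
        else if (ecount ty w + ncount ty w) mod 2 = 1 then 1 - reg s ''sp'' else reg s ''sp'')"
      unfolding sum using inv by (subst toggle_mod2) (auto simp: scan_inv_def)
    have st: "reg (step kinds_body s) ''df'' = (if arr s ''ce'' w < arr s ''cn'' w then 1 else reg s ''df'')"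
      "reg (step kinds_body s) ''sp'' = (if arr s ''ce'' w < arr s ''cn'' w then reg s ''sp''
         else if arr s ''pr'' w = 1 then 1 - reg s ''sp'' else reg s ''sp'')"
      "reg (step kinds_body s) ''fu'' = (if arr s ''cc'' w \<noteq> 1 \<and> arr s ''cu'' w = 1 then 1 else reg s ''fu'')"
      "reg (step kinds_body s) ''ad'' = (if arr s ''cc'' w = 1 then 1 else reg s ''ad'')"
      by (simp_all add: kinds_body_def par v w test)
    have "reg s ''df'' = of_bool (\<exists>l \<in> leads v \<inter> X. ecount ty l < ncount ty l)"
      "reg s ''fu'' = of_bool (\<exists>l \<in> leads v \<inter> X. (\<exists>c \<in> blk l. ty c = Undominated) \<and> (\<forall>c \<in> blk l. \<not> chosen (ty c)))"
      "reg s ''ad'' = of_bool (\<exists>l \<in> leads v \<inter> X. \<exists>c \<in> blk l. chosen (ty c))"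
      using inv unfolding scan_inv_def by blast+
    then show ?thesis
      unfolding scan_inv_def ins sp st cb bex_simps by (simp del: Int_iff)
  qed
qed

lemma counts_record:
  assumes c: "counts U s" and v: "v < n" "v \<notin> U" and U: "finite U"
    and x: "reg s ''x'' = kind_code (ty v)" "reg s ''v'' = v" "arr s ''ld'' v = ld v"
  shows "counts (insert v U) (step kinds_record s)"
  unfolding counts_def
proof (intro allI impI)
  fix l assume l: "0 < l \<and> l < n"
  note sr = step_record[OF x]
  have old: "arr s ''ce'' l = card {c \<in> blk l \<inter> U. ty c = Spare}" "arr s ''cn'' l = card {c \<in> blk l \<inter> U. needy (ty c)}"
     "arr s ''cu'' l = of_bool (\<exists>c \<in> blk l \<inter> U. ty c = Undominated)"
     "arr s ''cc'' l = of_bool (\<exists>c \<in> blk l \<inter> U. chosen (ty c))"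
     "arr s ''pr'' l = (arr s ''ce'' l + arr s ''cn'' l) mod 2" using c l unfolding counts_def by blast+
  show "arr (step kinds_record s) ''ce'' l = card {c \<in> blk l \<inter> insert v U. ty c = Spare} \<and>
     arr (step kinds_record s) ''cn'' l = card {c \<in> blk l \<inter> insert v U. needy (ty c)} \<and>
     arr (step kinds_record s) ''cu'' l = of_bool (\<exists>c \<in> blk l \<inter> insert v U. ty c = Undominated) \<and>
     arr (step kinds_record s) ''cc'' l = of_bool (\<exists>c \<in> blk l \<inter> insert v U. chosen (ty c)) \<and>
     arr (step kinds_record s) ''pr'' l =
       (arr (step kinds_record s) ''ce'' l + arr (step kinds_record s) ''cn'' l) mod 2"
  proof (cases "ld v = l")
    case False
    then have "blk l \<inter> insert v U = blk l \<inter> U" by (auto simp: blk_def)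
    then show ?thesis using sr old False by simp
  next
    case True
    then have "0 < v" using l root_props(2) by (cases "v = 0") auto
    then have vb: "v \<in> blk l" using True v by (simp add: blk_def)
    have card: "card {c \<in> blk l \<inter> insert v U. P c} = (if P v then Suc (card {c \<in> blk l \<inter> U. P c}) else card {c \<in> blk l \<inter> U. P c})" for P
    proof -
      have "{c \<in> blk l \<inter> insert v U. P c} = (if P v then insert v {c \<in> blk l \<inter> U. P c} else {c \<in> blk l \<inter> U. P c})"
        using vb by auto
      then show ?thesis using U v(2) by auto
    qed
    have ex: "(\<exists>c \<in> blk l \<inter> insert v U. P c) \<longleftrightarrow> P v \<or> (\<exists>c \<in> blk l \<inter> U. P c)" for P using vb by auto
    have "\<not> (ty v = Spare \<and> needy (ty v))" by (auto simp: needy_def)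
    then show ?thesis unfolding card ex sr using old True by (auto simp: mod_Suc)
  qed
qed

text \<open>Children are discovered after their parent, so in the reverse order their kinds are
  known when the parent is reached.\<close>

lemma kids_processed:
  assumes "U = {u. u < n \<and> n \<le> pos u + card U}" "pos v = n - 1 - card U" "card U < n"
  shows "kids v \<subseteq> U"
proof
  fix c assume "c \<in> kids v"
  then have "c < n" "pos v < pos c" using pos_par by (auto simp: kids_def)
  then have "n \<le> pos c + card U" using assms(2,3) by linarith
  then show "c \<in> U" using \<open>c < n\<close> by (subst assms(1)) simp
qed

lemma kinds_correct:
  assumes lay: "layout adj s" and t: "tree_store s"
    and z: "\<And>a. a \<in> {''ce'', ''cn'', ''cu'', ''cc'', ''pr''} \<Longrightarrow> arr s a = (\<lambda>_. 0)"
  shows "runs kinds s (200 * (2 * n + length (concat adj) + 1)) (\<lambda>s'. layout adj s' \<and> tree_store s' \<and>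
     (\<forall>u<n. arr s' ''ty'' u = kind_code (ty u)) \<and>
     (\<forall>l. 0 < l \<and> l < n \<longrightarrow> arr s' ''ce'' l = ecount ty l \<and> arr s' ''cn'' l = ncount ty l))"
proof -
  let ?J = "\<lambda>U v X s. kinds_inv U s \<and> card U < n \<and> finite X \<and> pos v = n - 1 - card U \<and> scan_inv v X s"
  have "runs kinds s (200 * (2 * n + length (concat adj) + 1)) (\<lambda>s'. layout adj s' \<and> kinds_inv {..<n} s')"
    unfolding kinds_def
  proof (rule runs_sweep[where J = ?J])
    show "layout adj s" by (rule lay)
    have "counts {} s" using z by (simp add: counts_def)
    moreover have "{} = {u. u < n \<and> n \<le> pos u + card ({} :: nat set)}" using pos_less by force
    ultimately show "kinds_inv {} s" unfolding kinds_inv_def using t by simp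
    show "straight kinds_pre" "straight kinds_body" "straight (Seq kinds_choose kinds_record)"
      "{''n'', ''i'', ''k'', ''w''} \<inter> wregs kinds_pre = {}" "{''n'', ''i'', ''v'', ''k''} \<inter> wregs kinds_body = {}"
      "{''n'', ''i'', ''k'', ''w''} \<inter> wregs (Seq kinds_choose kinds_record) = {}"
      "{''off'', ''nbr''} \<inter> (warrs kinds_pre \<union> warrs kinds_body \<union> warrs (Seq kinds_choose kinds_record)) = {}"
      by (simp_all add: kinds_pre_def kinds_body_def kinds_choose_def kinds_record_def)
    show "distinct (adj ! v)" if "v < n" for v by (rule dist[OF that])
    show "(time kinds_pre + time kinds_body + time (Seq kinds_choose kinds_record) + 30) * (2 * n + length (concat adj) + 1)
        \<le> 200 * (2 * n + length (concat adj) + 1)"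
      by (rule mult_le_mono1) (simp add: kinds_pre_def kinds_body_def kinds_choose_def kinds_record_def)
    show "kinds_inv U (s\<lparr>reg := (reg s)(''i'' := i)\<rparr>)" if "kinds_inv U s" for U s i
      using that by (simp add: kinds_inv_def tree_store_def counts_def)
    show "?J U v X (s\<lparr>reg := (reg s)(''k'' := k)\<rparr>) \<and> ?J U v X (s\<lparr>reg := (reg s)(''w'' := w)\<rparr>)"
      if "?J U v X s" for U v X s k w
      using that by (simp add: kinds_inv_def tree_store_def counts_def scan_inv_def)
  next
    fix U s
    assume U: "U \<subseteq> {..<n}" "card U < n" and lay: "layout adj s" and i: "reg s ''i'' = card U" and inv: "kinds_inv U s"
    define j where "j = n - 1 - card U"
    have j: "j < n" "n - Suc 0 - card U = j" using U(2) by (auto simp: j_def)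
    have v: "reg (step kinds_pre s) ''v'' = ord j"
      using inv lay i j by (simp add: kinds_pre_def kinds_inv_def tree_store_def layout_def)
    have "ord j < n" using ord_bij j by (auto simp: bij_betw_def)
    moreover have "ord j \<notin> U"
    proof
      assume "ord j \<in> U"
      moreover have "U = {u. u < n \<and> n \<le> pos u + card U}" using inv unfolding kinds_inv_def by blast
      ultimately have "n \<le> pos (ord j) + card U" by blast
      then show False using j U(2) by (simp add: j_def)
    qed
    moreover have "kinds_inv U (step kinds_pre s)"
      using inv by (simp add: kinds_pre_def kinds_inv_def tree_store_def counts_def)
    moreover have "scan_inv (ord j) {} (step kinds_pre s)"
      by (simp add: kinds_pre_def scan_inv_def)
    ultimately show "reg (step kinds_pre s) ''v'' < n \<and> reg (step kinds_pre s) ''v'' \<notin> U \<and>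
        ?J U (reg (step kinds_pre s) ''v'') {} (step kinds_pre s)"
      unfolding v using U(2) j by (simp add: j_def)
  next
    fix U v X w s
    assume v: "v < n" and w: "w \<in> N v" "w \<notin> X" and regs: "reg s ''v'' = v" "reg s ''w'' = w" and J: "?J U v X s"
    have U: "U = {u. u < n \<and> n \<le> pos u + card U}" and t: "tree_store s" and c: "counts U s"
      using J unfolding kinds_inv_def by blast+
    have "scan_inv v (insert w X) (step kinds_body s)"
      by (rule scan_body[OF _ t c kids_processed[OF U] v regs(1) _ regs(2) w(2)]) (use J w v range in auto)
    moreover have "warrs kinds_body = {}" by (simp add: kinds_body_def)
    then have "arr (step kinds_body s) = arr s" using step_frame(2)[of _ kinds_body s] by auto
    then have "kinds_inv U (step kinds_body s)"
      using J by (simp add: kinds_inv_def tree_store_def counts_def)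
    ultimately show "?J U v (insert w X) (step kinds_body s)" using J by simp
  next
    fix U v s
    assume Us: "U \<subseteq> {..<n}" and v: "v < n" "v \<notin> U" and regs: "reg s ''v'' = v" and J: "?J U v (N v) s"
    have U: "U = {u. u < n \<and> n \<le> pos u + card U}" and t: "tree_store s" and c: "counts U s"
      and tyU: "\<forall>u \<in> U. arr s ''ty'' u = kind_code (ty u)"
      using J unfolding kinds_inv_def by blast+
    have finite_parts: "finite U" using Us finite_subset by blast
    have lN: "leads v \<inter> N v = leads v" using leads_sub[of v] A_N[OF v(1)] by blast
    have sc: "scan_inv v (N v) s" using J by blast
    have ad: "(\<exists>l \<in> leads v. \<exists>c \<in> blk l. chosen (ty c)) \<longleftrightarrow> child_chosen ty v"
      by (auto simp: child_chosen_def kids_Union)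
    have x: "step kinds_choose s = s\<lparr>reg := (reg s)(''x'' := kind_code (ty v))\<rparr>"
    proof -
      have "ty v = kind_of (lacking ty v) (forced ty v) (odd (surplus ty v)) (child_chosen ty v)"
        using ty_eq[of v] unfolding kind_rule_def .
      moreover have "step kinds_choose s = s\<lparr>reg := (reg s)(''x'' :=
          kind_code (kind_of (lacking ty v) (forced ty v) (odd (surplus ty v)) (child_chosen ty v)))\<rparr>"
        by (rule step_choose) (use sc in \<open>simp_all add: scan_inv_def lN lacking_def forced_def surplus_def ad
          mod_2_eq_odd\<close>)
      ultimately show ?thesis by simp
    qed
    define s1 where "s1 = s\<lparr>reg := (reg s)(''x'' := kind_code (ty v))\<rparr>"
    have s1: "counts U s1" "reg s1 ''x'' = kind_code (ty v)" "reg s1 ''v'' = v" "arr s1 ''ld'' v = ld v"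
      using c regs t v by (simp_all add: s1_def counts_def tree_store_def)
    note sr = step_record[OF s1(2-4)]
    have pv: "pos v + card U = n - 1" using J by simp
    have "u \<in> insert v U \<longleftrightarrow> u < n \<and> n \<le> pos u + Suc (card U)" for u
    proof -
      have "u \<in> U \<longleftrightarrow> u < n \<and> n \<le> pos u + card U" using U by blast
      moreover have "u = v \<longleftrightarrow> u < n \<and> pos u + card U = n - 1"
        using pos_inj[of u v] v(1) pv by auto
      ultimately show ?thesis using v(1) by auto
    qed
    then have "insert v U = {u. u < n \<and> n \<le> pos u + Suc (card U)}" by blast
    moreover have "card (insert v U) = Suc (card U)" using finite_parts v(2) by simp
    ultimately have "insert v U = {u. u < n \<and> n \<le> pos u + card (insert v U)}" by (simp only:)
    moreover have "tree_store (step kinds_record s1)" using t sr by (simp add: tree_store_def s1_def)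
    moreover have "\<forall>u \<in> insert v U. arr (step kinds_record s1) ''ty'' u = kind_code (ty u)"
      using tyU sr by (simp add: s1_def)
    moreover have "counts (insert v U) (step kinds_record s1)" by (rule counts_record[OF s1(1) v finite_parts s1(2-4)])
    ultimately show "kinds_inv (insert v U) (step (Seq kinds_choose kinds_record) s)"
      unfolding kinds_inv_def step.simps x s1_def[symmetric] by blast
  qed
  then show ?thesis
  proof (rule runs_weaken)
    fix s' assume s': "layout adj s' \<and> kinds_inv {..<n} s'"
    then have c: "counts {..<n} s'" "tree_store s'" "\<forall>u \<in> {..<n}. arr s' ''ty'' u = kind_code (ty u)"
      unfolding kinds_inv_def by blast+
    have B: "blk l \<inter> {..<n} = blk l" for l by (auto simp: blk_def)
    have "\<forall>l. 0 < l \<and> l < n \<longrightarrow> arr s' ''ce'' l = ecount ty l \<and> arr s' ''cn'' l = ncount ty l"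
      using c(1) unfolding counts_def B ecount_def ncount_def by blast
    then show "layout adj s' \<and> tree_store s' \<and> (\<forall>u<n. arr s' ''ty'' u = kind_code (ty u)) \<and>
     (\<forall>l. 0 < l \<and> l < n \<longrightarrow> arr s' ''ce'' l = ecount ty l \<and> arr s' ''cn'' l = ncount ty l)"
      using s' c(2,3) by simp
  qed simp
qed

end

section \<open>The top-down pass\<close>

definition mark_root :: com where
  "mark_root = Cond (Conj (Neg (Equal (Get ''ty'' (Const 0)) (Const 2))) (Neg (Equal (Get ''ty'' (Const 0)) (Const 5))))
     Skip (Put ''fx'' (Const 0) (Const 1))"

definition select_pre :: com where
  "select_pre = Seq (Assign ''v'' (Get ''ord'' (Reg ''i''))) (Seq (Assign ''x'' (Get ''ty'' (Reg ''v'')))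
     (Seq (Cond (Less (Const 2) (Reg ''x'')) (Put ''out'' (Reg ''v'') (Const 1))
        (Cond (Conj (Equal (Reg ''x'') (Const 2)) (Equal (Get ''fx'' (Reg ''v'')) (Const 1)))
          (Put ''out'' (Reg ''v'') (Const 1)) Skip))
      (Cond (Conj (Neg (Equal (Reg ''x'') (Const 4)))
          (Neg (Conj (Equal (Reg ''x'') (Const 5)) (Equal (Get ''fx'' (Reg ''v'')) (Const 0)))))
        (Assign ''av'' (Const 0)) (Assign ''av'' (Const 1)))))"

text \<open>As long as \<open>ce < cn\<close> in its block, a needy child cannot rely on a spare
  token: it receives the token of the parent if this is still available and is fixed otherwise.
  Lowering \<open>cn\<close> ends this as soon as the spare tokens suffice for the needy vertices
  left.\<close>

definition select_body :: com where
  "select_body = Cond (Conj (Equal (Get ''par'' (Reg ''w'')) (Reg ''v''))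
       (Neg (Conj (Neg (Equal (Get ''ty'' (Reg ''w'')) (Const 2))) (Neg (Equal (Get ''ty'' (Reg ''w'')) (Const 5))))))
     (Seq (Assign ''l'' (Get ''ld'' (Reg ''w''))) (Cond (Less (Get ''ce'' (Reg ''l'')) (Get ''cn'' (Reg ''l'')))
       (Seq (Put ''cn'' (Reg ''l'') (Sub (Get ''cn'' (Reg ''l'')) (Const 1)))
         (Cond (Equal (Reg ''av'') (Const 1)) (Assign ''av'' (Const 0)) (Put ''fx'' (Reg ''w'') (Const 1)))) Skip)) Skip"

definition select :: com where
  "select = sweep select_pre select_body Skip"

definition find_extra :: com where
  "find_extra = Cond (Equal (Get ''out'' (Reg ''w'')) (Const 0)) (Assign ''z'' (Reg ''w'')) Skip"

definition finish :: com where
  "finish = Cond (Conj (Neg (Equal (Get ''ty'' (Const 0)) (Const 0))) (Neg (Equal (Get ''ty'' (Const 0)) (Const 3)))) Skip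
     (Seq (Seq (Assign ''v'' (Const 0)) (Assign ''z'' (Const 0)))
       (Seq (scan find_extra) (Seq (Put ''out'' (Const 0) (Const 1)) (Put ''out'' (Reg ''z'') (Const 1)))))"

lemma code_tests [simp]:
  "2 < kind_code k \<longleftrightarrow> chosen k" "Suc (Suc 0) < kind_code k \<longleftrightarrow> chosen k"
  "kind_code k = 0 \<longleftrightarrow> k = Undominated" "kind_code k = 2 \<longleftrightarrow> k = Needy" "kind_code k = 3 \<longleftrightarrow> k = Spare"
  "kind_code k = 4 \<longleftrightarrow> k = Full" "kind_code k = 5 \<longleftrightarrow> k = Full_Needy"
  by (cases k; simp add: chosen_def)+

context block_run begin

text \<open>How many needy children of the block have been served by the parent or by a fix once
  \<open>X\<close> has been scanned: the first ones that occur, up to the deficit. The later ones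
  are left to the spare tokens.\<close>

definition cut :: "nat \<Rightarrow> nat set \<Rightarrow> nat" where
  "cut l X = min (ncount ty l - ecount ty l) (card {c \<in> blk l \<inter> X. needy (ty c)})"

definition cuts :: "nat \<Rightarrow> nat set \<Rightarrow> nat" where
  "cuts v X = (\<Sum>l \<in> leads v. cut l X)"

text \<open>A \<open>Full\<close> vertex that is merely forced is included. It has no deficit, so
  its token is never requested and stays at home.\<close>

definition lends :: "(nat \<Rightarrow> nat) \<Rightarrow> nat \<Rightarrow> bool" where
  "lends F v \<longleftrightarrow> ty v = Full \<or> ty v = Full_Needy \<and> F v = 0"

definition flags :: "(nat \<Rightarrow> nat) \<Rightarrow> bool" where
  "flags F \<longleftrightarrow> (\<forall>u. F u \<le> 1) \<and> (\<forall>u. F u = 1 \<longrightarrow> u < n \<and> needy (ty u)) \<and> (needy (ty 0) \<longrightarrow> F 0 = 1)"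

definition settled :: "(nat \<Rightarrow> nat) \<Rightarrow> nat \<Rightarrow> bool" where
  "settled F q \<longleftrightarrow> (\<forall>l \<in> leads q. card {c \<in> blk l. F c = 1} \<le> ncount ty l - ecount ty l) \<and>
     card {c \<in> kids q. F c = 1} + of_bool (lacking ty q \<and> F q \<noteq> 1) = deficit ty q"

definition fresh :: "(nat \<Rightarrow> nat) \<Rightarrow> (nat \<Rightarrow> nat) \<Rightarrow> nat \<Rightarrow> bool" where
  "fresh F C q \<longleftrightarrow> (\<forall>c \<in> kids q. F c = 0) \<and> (\<forall>l \<in> leads q. C l = ncount ty l)"

text \<open>The first served child takes the token of the parent if there is one, and all others are
  fixed. Hence the fixed children fall short of the served ones by one exactly when the token has
  been spent.\<close>

definition partial :: "nat \<Rightarrow> nat set \<Rightarrow> (nat \<Rightarrow> nat) \<Rightarrow> (nat \<Rightarrow> nat) \<Rightarrow> nat \<Rightarrow> bool" where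
  "partial v X F C a \<longleftrightarrow> (\<forall>c \<in> kids v - X. F c = 0) \<and>
     (\<forall>l \<in> leads v. C l + cut l X = ncount ty l \<and> card {c \<in> blk l. F c = 1} \<le> cut l X) \<and>
     card {c \<in> kids v. F c = 1} + of_bool (lends F v \<and> 0 < cuts v X) = cuts v X \<and>
     a = of_bool (lends F v \<and> cuts v X = 0)"

lemma cut_insert:
  assumes "w \<notin> X"
  shows "cut l (insert w X) = (if w \<in> blk l \<and> needy (ty w)
    then min (ncount ty l - ecount ty l) (Suc (card {c \<in> blk l \<inter> X. needy (ty c)})) else cut l X)"
proof -
  have "{c \<in> blk l \<inter> insert w X. needy (ty c)} =
    (if w \<in> blk l \<and> needy (ty w) then insert w {c \<in> blk l \<inter> X. needy (ty c)} else {c \<in> blk l \<inter> X. needy (ty c)})"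
    by auto
  moreover have "finite {c \<in> blk l \<inter> X. needy (ty c)}" by simp
  ultimately show ?thesis using assms by (simp add: cut_def)
qed

lemma partial_start:
  assumes "fresh F C v"
  shows "partial v {} F C (of_bool (lends F v))"
proof -
  have "cut l {} = 0" for l by (simp add: cut_def)
  moreover have "{c \<in> blk l. F c = 1} = {}" if "l \<in> leads v" for l
    using assms blk_kids[OF that] by (auto simp: fresh_def)
  moreover have "{c \<in> kids v. F c = 1} = {}" using assms by (auto simp: fresh_def)
  ultimately show ?thesis using assms by (simp add: partial_def cuts_def fresh_def)
qed

text \<open>Once all children have been scanned, \<open>cut\<close> equals the deficit of every
  block, since a block has at least as many needy vertices as missing tokens.\<close>

lemma partial_end:
  assumes p: "partial v X F C a" and X: "kids v \<subseteq> X" and F: "flags F"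
  shows "settled F v"
proof -
  have cut: "cut l X = ncount ty l - ecount ty l" if "l \<in> leads v" for l
  proof -
    have "blk l \<inter> X = blk l" using X blk_kids[OF that] by blast
    then have "{c \<in> blk l \<inter> X. needy (ty c)} = {c \<in> blk l. needy (ty c)}" by simp
    then show ?thesis by (simp add: cut_def ncount_def)
  qed
  then have cuts: "cuts v X = deficit ty v" by (simp add: cuts_def deficit_def)
  have "lends F v \<longleftrightarrow> F v \<noteq> 1" if "lacking ty v"
  proof -
    have "ty v = Full \<or> ty v = Full_Needy" using kind_cases(1,2)[OF that] by blast
    moreover have "F v \<le> 1" "F v = 1 \<longrightarrow> needy (ty v)" using F by (auto simp: flags_def)
    ultimately show ?thesis by (cases "F v = 0") (auto simp: lends_def needy_def)
  qed
  then have b: "(lends F v \<and> 0 < deficit ty v) = (lacking ty v \<and> F v \<noteq> 1)"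
    using deficit_pos[of ty v] by auto
  have "card {c \<in> kids v. F c = 1} + of_bool (lends F v \<and> 0 < deficit ty v) = deficit ty v"
    using p unfolding partial_def cuts by blast
  moreover have "card {c \<in> blk l. F c = 1} \<le> ncount ty l - ecount ty l" if "l \<in> leads v" for l
    using p that unfolding partial_def cut[OF that, symmetric] by blast
  ultimately show ?thesis unfolding settled_def b by blast
qed

lemma partial_skip:
  assumes p: "partial v X F C a" and w: "w \<notin> X" "\<not> (w \<in> kids v \<and> needy (ty w))"
  shows "partial v (insert w X) F C a"
proof -
  have "cut l (insert w X) = cut l X" if "l \<in> leads v" for l
    using w blk_kids[OF that] by (auto simp: cut_insert)
  then have "cuts v (insert w X) = cuts v X" by (simp add: cuts_def)
  then show ?thesis
    using p \<open>\<And>l. l \<in> leads v \<Longrightarrow> cut l (insert w X) = cut l X\<close> by (auto simp: partial_def)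
qed

lemma partial_kid:
  assumes p: "partial v X F C a" and w: "w \<notin> X" "w \<in> kids v" "needy (ty w)" and l: "l = ld w"
  shows "\<not> ecount ty l < C l \<Longrightarrow> partial v (insert w X) F C a"
    "ecount ty l < C l \<Longrightarrow> a = 1 \<Longrightarrow> partial v (insert w X) F (C(l := C l - 1)) 0"
    "ecount ty l < C l \<Longrightarrow> a \<noteq> 1 \<Longrightarrow> partial v (insert w X) (F(w := 1)) (C(l := C l - 1)) a"
proof -
  have L: "l \<in> leads v" "w \<in> blk l" using ld_leads[OF w(2)] l by auto
  define k where "k = card {c \<in> blk l \<inter> X. needy (ty c)}"
  have ck: "cut l X = min (ncount ty l - ecount ty l) k" "cut l (insert w X) = min (ncount ty l - ecount ty l) (Suc k)"
    using cut_insert[OF w(1), of l] L w(3) by (simp_all add: cut_def k_def)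
  have co: "cut l' (insert w X) = cut l' X" if "l' \<noteq> l" for l'
    using cut_insert[OF w(1), of l'] that L(2) by (auto simp: blk_def)
  have C: "C l + cut l X = ncount ty l" using p L(1) unfolding partial_def by blast
  have sum: "cuts v Y = cut l Y + (\<Sum>l \<in> leads v - {l}. cut l Y)" for Y
    unfolding cuts_def by (rule sum.remove) (use L in auto)
  have so: "(\<Sum>l \<in> leads v - {l}. cut l (insert w X)) = (\<Sum>l \<in> leads v - {l}. cut l X)"
    by (rule sum.cong) (use co in auto)
  have wv: "w \<noteq> v" using w(2) kids_notself by blast
  {
    assume "\<not> ecount ty l < C l"
    then have "cut l (insert w X) = cut l X" using C unfolding ck by auto
    then have ce: "cut l' (insert w X) = cut l' X" for l' using co by (cases "l' = l") auto
    then show "partial v (insert w X) F C a"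
      using p by (auto simp: partial_def cuts_def)
  next
    assume lt: "ecount ty l < C l"
    have cs: "cut l (insert w X) = Suc (cut l X)" using C lt unfolding ck by (auto simp: min_def)
    have css: "cuts v (insert w X) = Suc (cuts v X)" unfolding sum so cs by simp
    have Cl: "(C(l := C l - 1)) l' + cut l' (insert w X) = ncount ty l'" if "l' \<in> leads v" for l'
    proof (cases "l' = l")
      case True
      then show ?thesis using C cs lt by simp
    next
      case False
      then show ?thesis using p that co by (simp add: partial_def)
    qed
    have le: "cut l' X \<le> cut l' (insert w X)" for l' using cs co by (cases "l' = l") auto
    {
      assume a: "a = 1"
      moreover have "a = of_bool (lends F v \<and> cuts v X = 0)" using p unfolding partial_def by blast
      ultimately have len: "lends F v" "cuts v X = 0" by (cases "lends F v \<and> cuts v X = 0"; simp)+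
      have "\<forall>l \<in> leads v. card {c \<in> blk l. F c = 1} \<le> cut l (insert w X)"
        using p le unfolding partial_def by (meson order_trans)
      then show "partial v (insert w X) F (C(l := C l - 1)) 0"
        using p Cl len css unfolding partial_def by simp
    next
      assume a: "a \<noteq> 1"
      moreover have "a = of_bool (lends F v \<and> cuts v X = 0)" using p unfolding partial_def by blast
      ultimately have len: "\<not> (lends F v \<and> cuts v X = 0)" "a = 0" by (cases "lends F v \<and> cuts v X = 0"; simp)+
      have Fw: "F w = 0" using p w by (auto simp: partial_def)
      have lF: "lends (F(w := 1)) v \<longleftrightarrow> lends F v" using wv by (simp add: lends_def)
      have kidsF: "{c \<in> kids v. (F(w := 1)) c = 1} = insert w {c \<in> kids v. F c = 1}" using w(2) by auto
      have "card {c \<in> kids v. (F(w := 1)) c = 1} = Suc (card {c \<in> kids v. F c = 1})"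
        unfolding kidsF using Fw by simp
      moreover have "card {c \<in> blk l'. (F(w := 1)) c = 1} \<le> cut l' (insert w X)" if "l' \<in> leads v" for l'
      proof (cases "l' = l")
        case True
        have "{c \<in> blk l. (F(w := 1)) c = 1} = insert w {c \<in> blk l. F c = 1}" using L(2) by auto
        then have "card {c \<in> blk l. (F(w := 1)) c = 1} = Suc (card {c \<in> blk l. F c = 1})" using Fw by simp
        moreover have "card {c \<in> blk l. F c = 1} \<le> cut l X" using p L(1) unfolding partial_def by blast
        ultimately show ?thesis using True cs by simp
      next
        case False
        then have "w \<notin> blk l'" using L(2) by (auto simp: blk_def)
        then have "{c \<in> blk l'. (F(w := 1)) c = 1} = {c \<in> blk l'. F c = 1}" by auto
        then show ?thesis using p that co[OF False] by (simp add: partial_def)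
      qed
      moreover have "card {c \<in> kids v. F c = 1} + of_bool (lends F v \<and> 0 < cuts v X) = cuts v X"
        using p unfolding partial_def by blast
      moreover have "\<forall>c \<in> kids v - insert w X. (F(w := 1)) c = 0" using p unfolding partial_def by auto
      ultimately show "partial v (insert w X) (F(w := 1)) (C(l := C l - 1)) a"
        using Cl len css unfolding partial_def lF by (cases "lends F v") simp_all
    }
  }
qed

definition in_core :: "(nat \<Rightarrow> nat) \<Rightarrow> nat \<Rightarrow> bool" where
  "in_core F u \<longleftrightarrow> chosen (ty u) \<or> ty u = Needy \<and> F u = 1"

text \<open>Two sets are needed because \<open>v\<close> is half done while its neighbours are
  scanned: \<open>V = insert v U\<close> already has final \<open>out\<close> values, but only the
  vertices in \<open>U\<close> have settled children.\<close>

definition select_common :: "nat set \<Rightarrow> nat set \<Rightarrow> store \<Rightarrow> bool" where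
  "select_common U V s \<longleftrightarrow> tree_store s \<and> (\<forall>u<n. arr s ''ty'' u = kind_code (ty u)) \<and>
     (\<forall>l. 0 < l \<and> l < n \<longrightarrow> arr s ''ce'' l = ecount ty l) \<and> flags (arr s ''fx'') \<and>
     (\<forall>q \<in> U. settled (arr s ''fx'') q) \<and> (\<forall>q \<in> {..<n} - V. fresh (arr s ''fx'') (arr s ''cn'') q) \<and>
     (\<forall>u<n. arr s ''out'' u = of_bool (u \<in> V \<and> in_core (arr s ''fx'') u))"

definition select_inv :: "nat set \<Rightarrow> store \<Rightarrow> bool" where
  "select_inv U s \<longleftrightarrow> U = {u. u < n \<and> pos u < card U} \<and> select_common U U s"

lemma common_local: "select_common U V (s\<lparr>reg := r\<rparr>) = select_common U V s"
  by (simp add: select_common_def tree_store_def)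

lemma select_pre_step:
  assumes c: "select_common U U s" and i: "reg s ''i'' = j" and v: "v = ord j" "v < n" "v \<notin> U" and U: "U \<subseteq> {..<n}"
  shows "reg (step select_pre s) ''v'' = v" "select_common U (insert v U) (step select_pre s)"
    "partial v {} (arr (step select_pre s) ''fx'') (arr (step select_pre s) ''cn'') (reg (step select_pre s) ''av'')"
proof -
  have t: "arr s ''ord'' = ord" "arr s ''ty'' v = kind_code (ty v)" "flags (arr s ''fx'')"
    using c v(2) by (auto simp: select_common_def tree_store_def)
  show r: "reg (step select_pre s) ''v'' = v" using i v t by (simp add: select_pre_def)
  have out: "arr (step select_pre s) ''out'' = (if in_core (arr s ''fx'') v then (arr s ''out'')(v := 1) else arr s ''out'')"
    using i v(1) t by (simp add: select_pre_def in_core_def)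
  have fr: "arr (step select_pre s) a = arr s a" if "a \<noteq> ''out''" for a
    by (rule step_frame) (use that in \<open>simp add: select_pre_def\<close>)
  have "arr s ''fx'' v \<le> 1" using t(3) by (simp add: flags_def)
  then have av: "reg (step select_pre s) ''av'' = of_bool (lends (arr s ''fx'') v)"
    using i v(1) t by (simp add: select_pre_def lends_def)
  have "arr s ''out'' v = 0" using c v(2,3) by (simp add: select_common_def)
  then show "select_common U (insert v U) (step select_pre s)"
    using c v(2) unfolding select_common_def tree_store_def out by (auto simp: fr)
  have "fresh (arr s ''fx'') (arr s ''cn'') v" using c v(2,3) by (simp add: select_common_def)
  then show "partial v {} (arr (step select_pre s) ''fx'') (arr (step select_pre s) ''cn'') (reg (step select_pre s) ''av'')"
    using partial_start av fr by simp
qed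

text \<open>A flag at \<open>w\<close> matters for \<open>settled\<close> and \<open>fresh\<close>
  only at its parent \<open>v\<close> and for \<open>settled\<close> at \<open>w\<close> itself. As
  neither is in \<open>U\<close>, the handled vertices remain settled.\<close>

lemma common_update:
  assumes c: "select_common U (insert v U) s" and w: "w \<in> kids v" "needy (ty w)" "w \<notin> U" and U: "v \<notin> U"
    and s': "arr s' ''fx'' = (arr s ''fx'')(w := b)" "arr s' ''cn'' = (arr s ''cn'')(ld w := d)" "b \<le> 1" "arr s ''fx'' w \<le> b"
      "\<And>a. a \<notin> {''fx'', ''cn''} \<Longrightarrow> arr s' a = arr s a"
  shows "select_common U (insert v U) s'"
proof -
  define F F' where "F = arr s ''fx''" and "F' = F(w := b)"
  have w0: "0 < w" "w < n" "w \<noteq> v" using kids_less[OF w(1)] kids_notself[OF w(1)] by auto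
  have wk: "w \<notin> kids q" if "q \<noteq> v" for q using w(1) that by (auto simp: kids_def)
  have eqk: "F' c = F c" if "c \<in> kids q" "q \<noteq> v" for c q using that wk by (auto simp: F'_def)
  have "settled F' q = settled F q" if "q \<in> U" for q
  proof -
    have q: "q \<noteq> v" "q \<noteq> w" using that U w(3) by auto
    then have Fq: "F' q = F q" by (simp add: F'_def)
    have "{c \<in> kids q. F' c = 1} = {c \<in> kids q. F c = 1}" using eqk[OF _ q(1)] by auto
    moreover have "{c \<in> blk l. F' c = 1} = {c \<in> blk l. F c = 1}" if "l \<in> leads q" for l
      using eqk[OF _ q(1)] blk_kids[OF that] by auto
    ultimately show ?thesis unfolding settled_def Fq by simp
  qed
  moreover have "fresh F' ((arr s ''cn'')(ld w := d)) q = fresh F (arr s ''cn'') q" if "q \<notin> insert v U" for q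
  proof -
    have q: "q \<noteq> v" using that by simp
    have "ld w \<notin> leads q" using q ld_leads[OF w(1)] by (auto simp: leads_def kids_def)
    then show ?thesis using eqk[OF _ q] unfolding fresh_def by (metis fun_upd_other)
  qed
  moreover have "flags F'"
    using c s'(3) w0 w(2) unfolding select_common_def flags_def F'_def F_def by auto
  moreover have "(u \<in> insert v U \<and> in_core F' u) = (u \<in> insert v U \<and> in_core F u)" for u
    using w(3) w0(3) by (auto simp: in_core_def F'_def)
  moreover have "arr s' ''ord'' = arr s ''ord''" "arr s' ''par'' = arr s ''par''" "arr s' ''ld'' = arr s ''ld''"
    "arr s' ''ty'' = arr s ''ty''" "arr s' ''ce'' = arr s ''ce''" "arr s' ''out'' = arr s ''out''"
    "arr s' ''fx'' = F'" by (simp_all add: s' F'_def F_def)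
  ultimately show ?thesis
    using c unfolding select_common_def tree_store_def s'(2) F_def[symmetric] by simp
qed

lemma select_body_step:
  assumes c: "select_common U (insert v U) s" and p: "partial v X (arr s ''fx'') (arr s ''cn'') (reg s ''av'')"
    and v: "v < n" "v \<notin> U" "reg s ''v'' = v" and w: "w < n" "w \<notin> X" "reg s ''w'' = w" and wU: "w \<in> kids v \<Longrightarrow> w \<notin> U"
  shows "select_common U (insert v U) (step select_body s)"
    "partial v (insert w X) (arr (step select_body s) ''fx'') (arr (step select_body s) ''cn'') (reg (step select_body s) ''av'')"
proof -
  have t: "arr s ''par'' = par" "arr s ''ld'' w = ld w" "arr s ''ty'' w = kind_code (ty w)"
    using c w by (auto simp: select_common_def tree_store_def)
  have kid: "w \<in> kids v \<longleftrightarrow> par w = v" using w(1) v(1) par_root by (cases "w = 0") (auto simp: kids_def)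
  have "select_common U (insert v U) (step select_body s) \<and>
    partial v (insert w X) (arr (step select_body s) ''fx'') (arr (step select_body s) ''cn'') (reg (step select_body s) ''av'')"
  proof (cases "w \<in> kids v \<and> needy (ty w)")
    case False
    then have "step select_body s = s" using t kid v w by (auto simp: select_body_def needy_def)
    then show ?thesis using c partial_skip[OF p w(2)] False by simp
  next
    case True
    define l where "l = ld w"
    have L: "l \<in> leads v" "0 < l \<and> l < n" using ld_leads[of w v] True by (auto simp: l_def leads_def kids_def)
    have ce: "arr s ''ce'' l = ecount ty l" using c L(2) by (simp add: select_common_def)
    note pk = partial_kid[OF p w(2) _ _ l_def]
    have fxw: "arr s ''fx'' w = 0" using p True w(2) by (simp add: partial_def)
    have test: "bval (Conj (Equal (Get ''par'' (Reg ''w'')) (Reg ''v''))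
       (Neg (Conj (Neg (Equal (Get ''ty'' (Reg ''w'')) (Const 2))) (Neg (Equal (Get ''ty'' (Reg ''w'')) (Const 5)))))) s"
      using True t kid v w by (auto simp: needy_def)
    show ?thesis
    proof (cases "ecount ty l < arr s ''cn'' l")
      case False
      then have "step select_body s = s\<lparr>reg := (reg s)(''l'' := l)\<rparr>"
        unfolding select_body_def using test t w ce by (simp add: l_def)
      then show ?thesis using c pk(1) True False by (simp add: common_local)
    next
      case lt: True
      let ?s' = "step select_body s"
      have st: "arr ?s' ''cn'' = (arr s ''cn'')(l := arr s ''cn'' l - 1)"
        "arr ?s' ''fx'' = (if reg s ''av'' = 1 then arr s ''fx'' else (arr s ''fx'')(w := 1))"
        "reg ?s' ''av'' = (if reg s ''av'' = 1 then 0 else reg s ''av'')"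
        unfolding select_body_def using test t w ce lt by (simp_all add: l_def)
      have fr: "arr ?s' a = arr s a" if "a \<notin> {''fx'', ''cn''}" for a
        by (rule step_frame) (use that in \<open>simp add: select_body_def\<close>)
      have "select_common U (insert v U) ?s'"
        by (rule common_update[OF c _ _ _ v(2), where w = w and b = "of_bool (reg s ''av'' \<noteq> 1)" and d = "arr s ''cn'' l - 1"])
          (use True wU st fr fxw in \<open>auto simp: l_def fun_upd_idem\<close>)
      then show ?thesis using pk(2,3) True lt unfolding st by (auto split: if_splits)
    qed
  qed
  then show "select_common U (insert v U) (step select_body s)"
    "partial v (insert w X) (arr (step select_body s) ''fx'') (arr (step select_body s) ''cn'') (reg (step select_body s) ''av'')"
    by auto
qed

lemma select_correct:
  assumes lay: "layout adj s" and inv: "select_inv {} s"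
  shows "runs select s (150 * (2 * n + length (concat adj) + 1)) (\<lambda>s'. layout adj s' \<and> select_common {..<n} {..<n} s')"
proof -
  let ?J = "\<lambda>U v X s. U = {u. u < n \<and> pos u < card U} \<and> pos v = card U \<and> select_common U (insert v U) s \<and>
     partial v X (arr s ''fx'') (arr s ''cn'') (reg s ''av'')"
  have "runs select s (150 * (2 * n + length (concat adj) + 1)) (\<lambda>s'. layout adj s' \<and> select_inv {..<n} s')"
    unfolding select_def
  proof (rule runs_sweep[where J = ?J])
    show "layout adj s" "select_inv {} s" by (rule lay, rule inv)
    show "straight select_pre" "straight select_body" "straight Skip"
      "{''n'', ''i'', ''k'', ''w''} \<inter> wregs select_pre = {}" "{''n'', ''i'', ''v'', ''k''} \<inter> wregs select_body = {}"
      "{''n'', ''i'', ''k'', ''w''} \<inter> wregs Skip = {}"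
      "{''off'', ''nbr''} \<inter> (warrs select_pre \<union> warrs select_body \<union> warrs Skip) = {}"
      by (simp_all add: select_pre_def select_body_def)
    show "distinct (adj ! v)" if "v < n" for v by (rule dist[OF that])
    show "(time select_pre + time select_body + time Skip + 30) * (2 * n + length (concat adj) + 1)
        \<le> 150 * (2 * n + length (concat adj) + 1)"
      by (rule mult_le_mono1) (simp add: select_pre_def select_body_def)
    show "select_inv U (s\<lparr>reg := (reg s)(''i'' := i)\<rparr>)" if "select_inv U s" for U s i
      using that by (simp add: select_inv_def common_local)
    show "?J U v X (s\<lparr>reg := (reg s)(''k'' := k)\<rparr>) \<and> ?J U v X (s\<lparr>reg := (reg s)(''w'' := w)\<rparr>)"
      if "?J U v X s" for U v X s k w
      using that unfolding common_local by simp
  next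
    fix U s
    assume U: "U \<subseteq> {..<n}" "card U < n" and i: "reg s ''i'' = card U" and inv: "select_inv U s"
    define v where "v = ord (card U)"
    have v: "v < n" "pos v = card U" using U(2) ord_bij by (auto simp: v_def bij_betw_def)
    have Ueq: "U = {u. u < n \<and> pos u < card U}" and c: "select_common U U s"
      using inv unfolding select_inv_def by blast+
    have vU: "v \<notin> U"
    proof
      assume "v \<in> U"
      then have "pos v < card U" using Ueq by blast
      then show False using v by simp
    qed
    note sp = select_pre_step[OF c i v_def v(1) vU U(1)]
    show "reg (step select_pre s) ''v'' < n \<and> reg (step select_pre s) ''v'' \<notin> U \<and>
      ?J U (reg (step select_pre s) ''v'') {} (step select_pre s)"
      unfolding sp(1) using v vU Ueq sp(2,3) by blast
  next
    fix U v X w s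
    assume U: "U \<subseteq> {..<n}" and v: "v < n" "v \<notin> U" and w: "w \<in> N v" "w \<notin> X"
      and regs: "reg s ''v'' = v" "reg s ''w'' = w" and J: "?J U v X s"
    have wn: "w < n" using w v range by auto
    have "w \<notin> U" if "w \<in> kids v"
    proof
      assume "w \<in> U"
      then have "pos w < card U" using J by blast
      moreover have "pos v < pos w" using that pos_par by (auto simp: kids_def)
      ultimately show False using J by simp
    qed
    then show "?J U v (insert w X) (step select_body s)"
      using select_body_step[of U v s X w] J v w(2) wn regs by blast
  next
    fix U v s
    assume U: "U \<subseteq> {..<n}" and v: "v < n" "v \<notin> U" and J: "?J U v (N v) s"
    have Ueq: "U = {u. u < n \<and> pos u < card U}" and c: "select_common U (insert v U) s" and pv: "pos v = card U"
      and p: "partial v (N v) (arr s ''fx'') (arr s ''cn'') (reg s ''av'')" using J by blast+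
    have "kids v \<subseteq> N v" using kids_A A_N[OF v(1)] by auto
    then have "settled (arr s ''fx'') v"
      by (rule partial_end[OF p]) (use c in \<open>simp add: select_common_def\<close>)
    then have c': "select_common (insert v U) (insert v U) s" using c by (simp add: select_common_def)
    have finite_parts: "finite U" using U finite_subset by blast
    have cd: "card (insert v U) = Suc (card U)" using finite_parts v(2) by simp
    have "u \<in> insert v U \<longleftrightarrow> u < n \<and> pos u < Suc (card U)" for u
    proof -
      have "u \<in> U \<longleftrightarrow> u < n \<and> pos u < card U" using Ueq by blast
      moreover have "u = v \<longleftrightarrow> u < n \<and> pos u = card U" using pos_inj[of u v] v(1) pv by auto
      ultimately show ?thesis by auto
    qed
    then have "insert v U = {u. u < n \<and> pos u < Suc (card U)}" by blast
    then show "select_inv (insert v U) (step Skip s)" unfolding select_inv_def cd step.simps using c' by blast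
  qed
  then show ?thesis by (rule runs_weaken[OF _ order_refl]) (unfold select_inv_def, blast)
qed

end

section \<open>Correction at the root and optimality of the output\<close>

context adjacency begin

definition paired :: "nat set \<Rightarrow> bool" where
  "paired D \<longleftrightarrow> D \<subseteq> {..<n} \<and> (\<forall>v<n. v \<in> D \<or> (\<exists>u \<in> D. u \<in> N v)) \<and>
     (\<exists>f. (\<forall>x \<in> D. f x = x \<or> f x \<in> N x) \<and> (\<forall>z<n. even (card {x \<in> D. f x = z})))"

definition optimal :: "nat set \<Rightarrow> bool" where
  "optimal D \<longleftrightarrow> paired D \<and> (\<forall>D'. paired D' \<longrightarrow> card D \<le> card D')"

end

context block_run begin

lemma optimum_le_paired:
  assumes "paired D"
  shows "optimum \<le> card D"
proof -
  have D: "D \<subseteq> {..<n}" and dom: "\<And>v. v < n \<Longrightarrow> v \<in> D \<or> (\<exists>u \<in> D. u \<in> N v)"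
    using assms unfolding paired_def by blast+
  obtain f where f: "\<And>x. x \<in> D \<Longrightarrow> f x = x \<or> f x \<in> N x" "\<And>z. z < n \<Longrightarrow> even (card {x \<in> D. f x = z})"
    using assms unfolding paired_def by blast
  have "f x = x \<or> f x \<in> A x" if "x \<in> D" for x using f(1)[OF that] A_N[of x] that D by auto
  then interpret meeting_places n A par ld pos D f
    using D by unfold_locales
  show ?thesis by (rule optimum_le[OF f(2)]) (use dom A_N in auto)
qed

lemma finish_correct:
  assumes lay: "layout adj s" and c: "select_common {..<n} {..<n} s"
  shows "runs finish s (60 * (length (concat adj) + 2)) (\<lambda>s'. optimal {v. v < n \<and> arr s' ''out'' v = 1})"
proof -
  have n0: "0 < n" using two_le by linarith
  define F where "F = arr s ''fx''"
  have fl: "flags F" and set: "\<And>q. q < n \<Longrightarrow> settled F q" and ty: "arr s ''ty'' 0 = kind_code (ty 0)"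
    and out: "\<And>u. u < n \<Longrightarrow> arr s ''out'' u = of_bool (in_core F u)"
    using c n0 unfolding select_common_def F_def by auto
  define fx where "fx u \<longleftrightarrow> F u = 1" for u
  interpret fixing n A par ld pos fx
  proof unfold_locales
    show "needy (ty v)" if "v < n" "fx v" for v using fl that by (simp add: flags_def fx_def)
    show "fx 0" if "needy (ty 0)" using fl that by (simp add: flags_def fx_def)
    show "card {c \<in> blk l. fx c} \<le> ncount ty l - ecount ty l" if "l \<in> leads v" for l v
    proof -
      have "v < n" using that kids_less[of l v] by (auto simp: leads_def)
      then show ?thesis using set that unfolding settled_def fx_def by blast
    qed
    show "card {c \<in> kids v. fx c} + of_bool (lacking ty v \<and> \<not> fx v) = deficit ty v" if "v < n" for v
      using set[OF that] unfolding settled_def fx_def by blast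
  qed
  have core: "v \<in> core \<longleftrightarrow> v < n \<and> arr s ''out'' v = 1" for v
    using out[of v] by (cases "v < n") (simp_all add: core_def in_core_def fx_def)
  have opt: "optimal D" if w: "ty 0 = Undominated \<or> ty 0 = Spare \<Longrightarrow> w \<in> kids 0 \<and> w \<notin> core"
    and D: "D = (if ty 0 = Undominated \<or> ty 0 = Spare then insert 0 (insert w core) else core)" for w D
  proof -
    have fo: "card D = optimum" "v < n \<Longrightarrow> v \<in> D \<or> (\<exists>u \<in> D. u \<in> A v)" "D \<subseteq> {..<n}"
      "\<exists>f. (\<forall>x \<in> D. f x = x \<or> f x \<in> A x) \<and> (\<forall>z<n. even (card {x \<in> D. f x = z}))" for v
      using fixing_optimal[of w D] w D by blast+
    have D: "D \<subseteq> {..<n}" by (rule fo(3))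
    have "v \<in> D \<or> (\<exists>u \<in> D. u \<in> N v)" if "v < n" for v using fo(2)[OF that] A_N[OF that] by simp
    moreover obtain f where f: "\<forall>x \<in> D. f x = x \<or> f x \<in> A x" "\<forall>z<n. even (card {x \<in> D. f x = z})"
      using fo(4) by blast
    have "f x = x \<or> f x \<in> N x" if "x \<in> D" for x using f(1) that D A_N[of x] by auto
    ultimately have "paired D" unfolding paired_def using D f(2) by blast
    then show ?thesis unfolding optimal_def fo(1) using optimum_le_paired by blast
  qed
  show ?thesis
  proof (cases "ty 0 = Undominated \<or> ty 0 = Spare")
    case False
    have "optimal {v. v < n \<and> arr s ''out'' v = 1}"
      by (rule opt) (use False core in auto)
    then show ?thesis unfolding finish_def
      by (intro runs_Cond[where T = 1]) (use False ty in \<open>auto intro!: runs_step\<close>)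
  next
    case True
    \<comment> \<open>The value 0 of \<open>z\<close> means that no vertex has been found yet; it
      cannot be confused with a hit, since the root is not its own neighbour.\<close>
    let ?J = "\<lambda>X (s'::store). arr s' ''out'' = arr s ''out'' \<and>
      (reg s' ''z'' = 0 \<and> (\<forall>x \<in> X. arr s ''out'' x \<noteq> 0) \<or> reg s' ''z'' \<in> X \<and> arr s ''out'' (reg s' ''z'') = 0)"
    let ?init = "Seq (Assign ''v'' (Const 0)) (Assign ''z'' (Const 0))"
    let ?final = "Seq (Put ''out'' (Const 0) (Const 1)) (Put ''out'' (Reg ''z'') (Const 1))"
    let ?S = "(length (adj ! 0) + 1) * (time find_extra + 16)"
    have "runs (Seq ?init (Seq (scan find_extra) ?final)) s (4 + (?S + 6))
       (\<lambda>s'. optimal {v. v < n \<and> arr s' ''out'' v = 1})"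
    proof (rule runs_Seq[OF _ _ order_refl])
      show "runs ?init s 4 (\<lambda>s'. s' = step ?init s)" by (rule runs_step) auto
    next
      fix s1 assume "s1 = step ?init s"
      then have s1: "layout adj s1" "reg s1 ''v'' = 0" "reg s1 ''z'' = 0" "arr s1 ''out'' = arr s ''out''"
        using lay by (auto simp: layout_def)
      show "runs (Seq (scan find_extra) ?final) s1 (?S + 6) (\<lambda>s'. optimal {v. v < n \<and> arr s' ''out'' v = 1})"
      proof (rule runs_Seq[OF _ _ order_refl])
        show "runs (scan find_extra) s1 ?S (?J (N 0))"
        proof (rule runs_scan[OF s1(1,2) n0])
          show "straight find_extra" "{''n'', ''v'', ''k''} \<inter> wregs find_extra = {}"
            "{''off'', ''nbr''} \<inter> warrs find_extra = {}"
            by (simp_all add: find_extra_def)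
          show "distinct (adj ! 0)" by (rule dist[OF n0])
          show "?J {} s1" using s1 by simp
        next
          fix X s' w assume "reg s' ''w'' = w" "?J X s'"
          then show "?J (insert w X) (step find_extra s')"
            by (cases "arr s ''out'' w = 0") (auto simp: find_extra_def)
        qed auto
      next
        fix s2 assume J: "?J (N 0) s2"
        define z where "z = reg s2 ''z''"
        obtain w where w: "w \<in> kids 0" "w \<notin> core" using exists_extra[OF True] by blast
        then have "w \<in> N 0" "w < n" using kids_A[OF w(1)] A_N[OF n0] kids_less[OF w(1)] by auto
        then have "arr s ''out'' w = 0" using w(2) core[of w] out[of w] by auto
        then have z: "z \<in> N 0" "arr s ''out'' z = 0" using J \<open>w \<in> N 0\<close> by (auto simp: z_def)
        then have "z \<in> kids 0" using A_split[of z 0] A_N[OF n0] by auto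
        moreover have "z \<notin> core" using z core by simp
        moreover have "{v. v < n \<and> arr (step ?final s2) ''out'' v = 1} = insert 0 (insert z core)"
          using J core n0 kids_less[OF \<open>z \<in> kids 0\<close>] by (auto simp: z_def)
        ultimately have "optimal {v. v < n \<and> arr (step ?final s2) ''out'' v = 1}"
          using True by (intro opt[of z]) auto
        then show "runs ?final s2 6 (\<lambda>s'. optimal {v. v < n \<and> arr s' ''out'' v = 1})"
          by (intro runs_step) auto
      qed
    qed
    moreover have "length (adj ! 0) \<le> length (concat adj)"
      using n0 by (cases adj) auto
    then have "1 + 15 + (4 + (?S + 6)) \<le> 60 * (length (concat adj) + 2)"
      by (simp add: find_extra_def)
    ultimately show ?thesis unfolding finish_def
      by (intro runs_Cond[where T = "4 + (?S + 6)"]) (use True ty in auto)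
  qed
qed

end

section \<open>Composition of the passes\<close>

definition program :: com where
  "program = Seq bfs (Seq leads_of (Seq kinds (Seq mark_root (Seq select finish))))"

locale clique_adjacency = adjacency +
  fixes A :: "nat \<Rightarrow> nat set"
  assumes A_N: "u < length adj \<Longrightarrow> A u = set (adj ! u)"
    and A_range: "v \<in> A u \<Longrightarrow> u < length adj \<and> v < length adj"
    and A_sym: "v \<in> A u \<Longrightarrow> u \<in> A v"
    and A_irrefl: "v \<notin> A v"
    and cycle_clique: "\<lbrakk>distinct cs; 3 \<le> length cs; successively (\<lambda>u v. v \<in> A u) cs; hd cs \<in> A (last cs);
       u \<in> set cs; v \<in> set cs; u \<noteq> v\<rbrakk> \<Longrightarrow> v \<in> A u"
begin

lemma program_correct:
  "runs program (input_store adj) (700 * (2 * n + length (concat adj) + 1))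
     (\<lambda>s. optimal {v. v < n \<and> arr s ''out'' v = 1})"
proof -
  let ?T = "2 * n + length (concat adj) + 1" and ?Q = "\<lambda>s. optimal {v. v < n \<and> arr s ''out'' v = 1}"
  let ?zs = "{''ce'', ''cn'', ''cu'', ''cc'', ''pr'', ''fx'', ''out''}"
  let ?s0 = "input_store adj"
  have lay0: "layout adj ?s0" by (simp add: layout_def input_store_def)
  have z0: "arr ?s0 a = (\<lambda>_. 0)" if "a \<in> insert ''vis'' (insert ''ord'' ?zs)" for a
    using that by (auto simp: input_store_def)
  have wa: "a \<notin> warrs bfs" "a \<notin> warrs leads_of" if "a \<in> ?zs" for a
    using that by (auto simp: bfs_def bfs_init_def bfs_pre_def bfs_body_def leads_of_def lead_pre_def
        lead_body_def lead_post_def)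
  have wl: "''ord'' \<notin> warrs leads_of" "''par'' \<notin> warrs leads_of"
    by (simp_all add: leads_of_def lead_pre_def lead_body_def lead_post_def)
  have wk: "''fx'' \<notin> warrs kinds" "''out'' \<notin> warrs kinds"
    by (simp_all add: kinds_def kinds_pre_def kinds_body_def kinds_choose_def kinds_record_def)
  show ?thesis
    unfolding program_def
  proof (rule runs_Seq)
    show "runs bfs ?s0 (100 * ?T) (\<lambda>s1. (layout adj s1 \<and>
     bij_betw (arr s1 ''ord'') {..<n} {..<n} \<and> arr s1 ''ord'' 0 = 0 \<and> arr s1 ''par'' 0 = n \<and>
     (\<forall>k<n. 0 < k \<longrightarrow> first_parent (arr s1 ''ord'') (arr s1 ''par'') k)) \<and>
     (\<forall>x. x \<notin> wregs bfs \<longrightarrow> reg s1 x = reg ?s0 x) \<and> (\<forall>a. a \<notin> warrs bfs \<longrightarrow> arr s1 a = arr ?s0 a))"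
      by (rule runs_frame[OF bfs_correct[OF lay0]]) (use z0 in auto)
  next
    fix s1 assume h1: "(layout adj s1 \<and>
     bij_betw (arr s1 ''ord'') {..<n} {..<n} \<and> arr s1 ''ord'' 0 = 0 \<and> arr s1 ''par'' 0 = n \<and>
     (\<forall>k<n. 0 < k \<longrightarrow> first_parent (arr s1 ''ord'') (arr s1 ''par'') k)) \<and>
     (\<forall>x. x \<notin> wregs bfs \<longrightarrow> reg s1 x = reg ?s0 x) \<and> (\<forall>a. a \<notin> warrs bfs \<longrightarrow> arr s1 a = arr ?s0 a)"
    define ord par where "ord = arr s1 ''ord''" and "par = arr s1 ''par''"
    have z1: "arr s1 a = (\<lambda>_. 0)" if "a \<in> ?zs" for a
      using h1 z0[of a] wa(1)[OF that] that by auto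
    interpret R: block_run adj A ord par
    proof unfold_locales
      show "bij_betw ord {..<n} {..<n}" "ord 0 = 0" "par 0 = n" using h1 by (simp_all add: ord_def par_def)
      show "\<exists>j<k. par (ord k) = ord j \<and> ord k \<in> A (ord j) \<and> (\<forall>i<j. ord k \<notin> A (ord i))" if k: "0 < k" "k < n" for k
      proof -
        have o: "ord j < n" if "j < n" for j using h1 that by (auto simp: ord_def bij_betw_def)
        obtain j where "j < k" "par (ord k) = ord j" "ord k \<in> N (ord j)" "\<forall>i<j. ord k \<notin> N (ord i)"
          using h1 k unfolding first_parent_def ord_def par_def by blast
        then show ?thesis using k A_N[OF o] by (intro exI[of _ j]) auto
      qed
    qed (fact two_le A_range A_sym A_irrefl cycle_clique A_N)+
    show "runs (Seq leads_of (Seq kinds (Seq mark_root (Seq select finish)))) s1 (70 * ?T + (200 * ?T + (30 + (150 * ?T + 60 * (length (concat adj) + 2))))) ?Q"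
    proof (rule runs_Seq[OF _ _ order_refl])
      show "runs leads_of s1 (70 * ?T) (\<lambda>s2. (layout adj s2 \<and>
         (\<forall>u<n. arr s2 ''ld'' u = Min (insert u {w \<in> N u. arr s1 ''par'' w = arr s1 ''par'' u}))) \<and>
         (\<forall>x. x \<notin> wregs leads_of \<longrightarrow> reg s2 x = reg s1 x) \<and> (\<forall>a. a \<notin> warrs leads_of \<longrightarrow> arr s2 a = arr s1 a))"
        by (rule runs_frame[OF leads_of_correct]) (use h1 in blast)
    next
      fix s2 assume h2: "(layout adj s2 \<and>
         (\<forall>u<n. arr s2 ''ld'' u = Min (insert u {w \<in> N u. arr s1 ''par'' w = arr s1 ''par'' u}))) \<and>
         (\<forall>x. x \<notin> wregs leads_of \<longrightarrow> reg s2 x = reg s1 x) \<and> (\<forall>a. a \<notin> warrs leads_of \<longrightarrow> arr s2 a = arr s1 a)"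
      have z2: "arr s2 a = (\<lambda>_. 0)" if "a \<in> ?zs" for a
        using h2 z1[OF that] wa(2)[OF that] by auto
      have "arr s2 ''ld'' u = R.ld u" if u: "u < n" for u
      proof -
        \<comment> \<open>The program compares parents only, whereas \<open>sibs\<close> also asks
          for non-root vertices. The two agree because \<open>par 0 = n\<close> differs from the
          parent of every other vertex.\<close>
        have "par w \<noteq> par u" if "w = 0 \<or> u = 0" "w \<noteq> u" "w \<in> N u" for w
        proof -
          have "w < n" using that(3) u range by auto
          show ?thesis using R.par_props(2)[of u] R.par_props(2)[of w] that(1,2) u \<open>w < n\<close> R.par_root
            by (cases "w = 0"; cases "u = 0") simp_all
        qed
        moreover have "u \<notin> N u" using A_irrefl A_N[OF u] by blast
        ultimately have "insert u {w \<in> N u. par w = par u} = R.sibs u"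
          unfolding R.sibs_def A_N[OF u] by (auto intro: gr0I)
        moreover have "arr s2 ''ld'' u = Min (insert u {w \<in> N u. par w = par u})"
          using h2 u unfolding par_def by blast
        ultimately show ?thesis by (simp only: R.ld_def)
      qed
      then have tree: "R.tree_store s2" unfolding R.tree_store_def using h2 wl by (simp add: ord_def par_def)
      show "runs (Seq kinds (Seq mark_root (Seq select finish))) s2 (200 * ?T + (30 + (150 * ?T + 60 * (length (concat adj) + 2)))) ?Q"
      proof (rule runs_Seq[OF _ _ order_refl])
        show "runs kinds s2 (200 * ?T) (\<lambda>s3. (layout adj s3 \<and> R.tree_store s3 \<and>
          (\<forall>u<n. arr s3 ''ty'' u = kind_code (R.ty u)) \<and>
          (\<forall>l. 0 < l \<and> l < n \<longrightarrow> arr s3 ''ce'' l = R.ecount R.ty l \<and> arr s3 ''cn'' l = R.ncount R.ty l)) \<and>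
          (\<forall>x. x \<notin> wregs kinds \<longrightarrow> reg s3 x = reg s2 x) \<and> (\<forall>a. a \<notin> warrs kinds \<longrightarrow> arr s3 a = arr s2 a))"
          by (rule runs_frame[OF R.kinds_correct[OF _ tree z2]]) (use h2 in auto)
      next
        fix s3 assume h3: "(layout adj s3 \<and> R.tree_store s3 \<and>
          (\<forall>u<n. arr s3 ''ty'' u = kind_code (R.ty u)) \<and>
          (\<forall>l. 0 < l \<and> l < n \<longrightarrow> arr s3 ''ce'' l = R.ecount R.ty l \<and> arr s3 ''cn'' l = R.ncount R.ty l)) \<and>
          (\<forall>x. x \<notin> wregs kinds \<longrightarrow> reg s3 x = reg s2 x) \<and> (\<forall>a. a \<notin> warrs kinds \<longrightarrow> arr s3 a = arr s2 a)"
        have z3: "arr s3 ''fx'' = (\<lambda>_. 0)" "arr s3 ''out'' = (\<lambda>_. 0)" using h3 wk z2 by auto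
        have n0: "0 < n" using two_le by linarith
        define s4 where "s4 = step mark_root s3"
        have t0: "arr s3 ''ty'' 0 = kind_code (R.ty 0)" using h3 n0 by blast
        have fx: "arr s4 ''fx'' = (\<lambda>u. of_bool (u = 0 \<and> needy (R.ty 0)))"
          using z3 t0 by (auto simp: s4_def mark_root_def needy_def fun_eq_iff)
        have fr: "arr s4 a = arr s3 a" if "a \<noteq> ''fx''" for a
          unfolding s4_def by (rule step_frame) (use that in \<open>simp add: mark_root_def\<close>)
        have frr: "reg s4 x = reg s3 x" for x
          unfolding s4_def by (rule step_frame) (simp add: mark_root_def)
        have lay4: "layout adj s4" using h3 by (simp add: layout_def fr frr)
        have "R.select_common {} {} s4"
        proof -
          have "R.flags (arr s4 ''fx'')" using n0 by (auto simp: R.flags_def fx)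
          moreover have "R.fresh (arr s4 ''fx'') (arr s4 ''cn'') q" for q
            using h3 by (auto simp: R.fresh_def fx fr R.kids_def R.leads_def)
          ultimately show ?thesis using h3 z3 by (simp add: R.select_common_def R.tree_store_def fr)
        qed
        then have inv: "R.select_inv {} s4" by (simp add: R.select_inv_def)
        show "runs (Seq mark_root (Seq select finish)) s3 (30 + (150 * ?T + 60 * (length (concat adj) + 2))) ?Q"
        proof (rule runs_Seq[OF _ _ order_refl])
          show "runs mark_root s3 30 (\<lambda>s. s = s4)"
            by (rule runs_step) (simp_all add: s4_def, simp_all add: mark_root_def)
        next
          fix s assume s: "s = s4"
          show "runs (Seq select finish) s (150 * ?T + 60 * (length (concat adj) + 2)) ?Q"
            unfolding s by (rule runs_Seq[OF R.select_correct[OF lay4 inv] _ order_refl]) (use R.finish_correct in blast)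
        qed
      qed
    qed
  qed simp
qed

end

section \<open>Transfer to graphs, and the final time and word bounds\<close>

lemma card_arcs_ends_le:
  fixes G :: "(nat, 'b) pre_digraph"
  assumes "graph G"
  shows "card (arcs_ends G) \<le> 2 * card (edges G)"
proof -
  interpret graph G by fact
  have finite_parts: "finite (arcs_ends G)" by (simp add: arcs_ends_def)
  \<comment> \<open>The Boolean component distinguishes the two orientations of an edge.\<close>
  have inj: "inj_on (\<lambda>(u, v). ({u, v}, u < v)) (arcs_ends G)"
    by (rule inj_onI) (auto simp: doubleton_eq_iff split: prod.splits)
  have "(\<lambda>(u, v). ({u, v}, u < v)) ` arcs_ends G \<subseteq> edges G \<times> (UNIV :: bool set)"
    by (auto simp: edges_def image_iff)
  from card_inj_on_le[OF inj this] show ?thesis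
    using finite_parts by (simp add: edges_def card_cartesian_product)
qed

lemma length_concat_adjacency_lists:
  assumes "graph G" "adjacency_lists G adj"
  shows "length (concat adj) = card (arcs_ends G)"
proof -
  interpret graph G by fact
  have V: "verts G = {..<length adj}" and adj: "\<And>u. u < length adj \<Longrightarrow> distinct (adj ! u) \<and> set (adj ! u) = {v. u \<rightarrow>\<^bsub>G\<^esub> v}"
    using assms(2) by (auto simp: adjacency_lists_def)
  have "length (concat adj) = (\<Sum>v<length adj. card (set (adj ! v)))"
    unfolding sum_deg[symmetric]
  proof (rule sum.cong)
    show "length (adj ! v) = card (set (adj ! v))" if "v \<in> {..<length adj}" for v
      using adj[of v] that distinct_card[of "adj ! v"] by simp
  qed simp
  also have "\<dots> = card (SIGMA v:{..<length adj}. set (adj ! v))" by simp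
  also have "(SIGMA v:{..<length adj}. set (adj ! v)) = arcs_ends G"
    using adj V adj_in_verts(1) by auto
  finally show ?thesis .
qed

lemma cinc_program: "cinc 8 program"
  by (simp add: program_def bfs_def bfs_init_def bfs_pre_def bfs_body_def leads_of_def lead_pre_def lead_body_def
      lead_post_def kinds_def kinds_pre_def kinds_body_def kinds_choose_def kinds_record_def mark_root_def
      select_def select_pre_def select_body_def finish_def find_extra_def sweep_def scan_def)

theorem program_min_semipaired_dominating:
  fixes G :: "(nat, 'b) pre_digraph"
  assumes bg: "block_graph G" and al: "adjacency_lists G adj"
    and n: "n = card (verts G)" and m: "m = card (edges G)" and "2 \<le> n"
  shows "\<exists>t s. exec ((n + m) ^ 10) program (input_store adj) t s \<and> t \<le> 2100 * (n + m) \<and>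
    min_semipaired_dominating G (output_set G s)"
proof -
  interpret graph G using bg by (simp add: block_graph_def)
  have gr: "graph G" by unfold_locales
  have conn: "Digraph_Component.connected G" using bg by (simp add: block_graph_def)
  have V: "verts G = {..<length adj}" and adj: "\<And>u. u < length adj \<Longrightarrow> distinct (adj ! u) \<and> set (adj ! u) = {v. u \<rightarrow>\<^bsub>G\<^esub> v}"
    using al by (auto simp: adjacency_lists_def)
  have len: "length adj = n" using V n by simp
  have sym: "u \<rightarrow>\<^bsub>G\<^esub> v \<Longrightarrow> v \<rightarrow>\<^bsub>G\<^esub> u" for u v using sym_arcs by (simp add: symmetric_def symD)
  interpret C: clique_adjacency adj "\<lambda>u. {v. u \<rightarrow>\<^bsub>G\<^esub> v}"
  proof unfold_locales
    show "2 \<le> length adj" using len assms(5) by simp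
    show "set (adj ! u) \<subseteq> {..<length adj}" if "u < length adj" for u
      using adj[OF that] V adj_in_verts(2) by auto
    show "S = {..<length adj}" if "0 \<in> S" "S \<subseteq> {..<length adj}" "\<And>u. u \<in> S \<Longrightarrow> set (adj ! u) \<subseteq> S" for S
    proof -
      have "S = verts G"
      proof (rule connected_closed_eq_verts[OF gr conn that(1)])
        show "S \<subseteq> verts G" using that(2) V by simp
        show "v \<in> S" if "u \<in> S" "u \<rightarrow>\<^bsub>G\<^esub> v" for u v
        proof -
          have "u < length adj" using that(1) \<open>S \<subseteq> {..<length adj}\<close> by auto
          then have "v \<in> set (adj ! u)" using adj that(2) by simp
          then show ?thesis using \<open>\<And>u. u \<in> S \<Longrightarrow> set (adj ! u) \<subseteq> S\<close> that(1) by blast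
        qed
      qed
      then show ?thesis using V by simp
    qed
    show "v \<in> {v. u \<rightarrow>\<^bsub>G\<^esub> v}" if "distinct cs" "3 \<le> length cs" "successively (\<lambda>u v. v \<in> {v. u \<rightarrow>\<^bsub>G\<^esub> v}) cs"
      "hd cs \<in> {v. last cs \<rightarrow>\<^bsub>G\<^esub> v}" "u \<in> set cs" "v \<in> set cs" "u \<noteq> v" for cs u v
      using block_graph_cycle_clique[OF bg that(1,2) _ _ that(5-7)] that(3,4) by simp
    show "v \<notin> {u. v \<rightarrow>\<^bsub>G\<^esub> u}" for v using adj_not_same by blast
    show "v < length adj \<and> u < length adj" if "u \<in> {u. v \<rightarrow>\<^bsub>G\<^esub> u}" for u v
      using that adj_in_verts V by auto
    show "u \<in> {v. w \<rightarrow>\<^bsub>G\<^esub> v}" if "w \<in> {v. u \<rightarrow>\<^bsub>G\<^esub> v}" for u w using that sym by simp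
  qed (use adj in auto)
  have paired: "C.paired D \<longleftrightarrow> semipaired_dominating G D" for D
    unfolding C.paired_def semipaired_dominating_iff[OF gr] V
  proof -
    have "(\<forall>x \<in> D. f x = x \<or> f x \<in> set (adj ! x)) = (\<forall>x \<in> D. f x = x \<or> x \<rightarrow>\<^bsub>G\<^esub> f x)"
      if "D \<subseteq> {..<length adj}" for f
      using adj that by (intro ball_cong refl) auto
    moreover have "(\<forall>v<length adj. v \<in> D \<or> (\<exists>u \<in> D. u \<in> set (adj ! v))) =
        (\<forall>v \<in> {..<length adj}. v \<in> D \<or> (\<exists>u \<in> D. v \<rightarrow>\<^bsub>G\<^esub> u))"
      using adj by (simp add: Ball_def)
    moreover have "(\<forall>z<length adj. P z) = (\<forall>z \<in> {..<length adj}. P z)" for P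
      by (simp add: Ball_def)
    ultimately show "(D \<subseteq> {..<length adj} \<and> (\<forall>v<length adj. v \<in> D \<or> (\<exists>u \<in> D. u \<in> set (adj ! v))) \<and>
      (\<exists>f. (\<forall>x \<in> D. f x = x \<or> f x \<in> set (adj ! x)) \<and> (\<forall>z<length adj. even (card {x \<in> D. f x = z})))) =
      (D \<subseteq> {..<length adj} \<and> (\<forall>v \<in> {..<length adj}. v \<in> D \<or> (\<exists>u \<in> D. v \<rightarrow>\<^bsub>G\<^esub> u)) \<and>
      (\<exists>f. (\<forall>x \<in> D. f x = x \<or> x \<rightarrow>\<^bsub>G\<^esub> f x) \<and> (\<forall>z \<in> {..<length adj}. even (card {x \<in> D. f x = z}))))"
      by (cases "D \<subseteq> {..<length adj}") (simp_all only: simp_thms)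
  qed
  have lc: "length (concat adj) \<le> 2 * m"
    using length_concat_adjacency_lists[OF gr al] card_arcs_ends_le[OF gr] m by simp
  \<comment> \<open>The adjacency lists have total length at most \<open>2 * m\<close>, and
    \<open>2 * n + 2 * m + 1\<close> is at most \<open>3 * (n + m)\<close>; this gives 2100 as 3
    times 700.\<close>
  have "700 * (2 * length adj + length (concat adj) + 1) \<le> 2100 * (n + m)"
    using lc len assms(5) by simp
  from runs_weaken[OF C.program_correct this]
  have r: "runs program (input_store adj) (2100 * (n + m)) (\<lambda>s. C.optimal {v. v < length adj \<and> arr s ''out'' v = 1})" .
  \<comment> \<open>A connected graph with at least two vertices has an edge: otherwise the set of
    vertex 0 alone would be closed under neighbours.\<close>
  have sum: "3 \<le> n + m"
  proof -
    have "m \<noteq> 0"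
    proof
      assume "m = 0"
      then have "length (concat adj) = 0" using lc by simp
      moreover have "adj ! 0 \<in> set adj" using len assms(5) by (intro nth_mem) linarith
      ultimately have "adj ! 0 = []" by simp
      then have "set (adj ! u) \<subseteq> {0}" if "u \<in> {0}" for u using that by simp
      then have "{0} = {..<length adj}" using C.reach[of "{0}"] len assms(5) by auto
      then have "1 \<in> ({0} :: nat set)" using len assms(5) by auto
      then show False by simp
    qed
    then show ?thesis using assms(5) by simp
  qed
  \<comment> \<open>One bound for everything present initially: the offsets, which are at most
    \<open>2 * m\<close>, the vertices, and the constants of the program, which are at most
    8.\<close>
  define M where "M = 10 * (n + m)"
  have below: "below M (input_store adj)"
  proof -
    have "length (concat (take u adj)) \<le> M" for u
    proof -
      have "length (concat (take u adj)) \<le> length (concat adj)"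
        by (metis append_take_drop_id concat_append le_add1 length_append)
      also note lc
      finally show ?thesis by (simp add: M_def)
    qed
    moreover have "concat adj ! i \<le> M" if i: "i < length (concat adj)" for i
    proof -
      obtain xs where "xs \<in> set adj" "concat adj ! i \<in> set xs" using nth_mem[OF i] by auto
      then obtain u where "u < length adj" "concat adj ! i \<in> set (adj ! u)" by (metis in_set_conv_nth)
      then have "concat adj ! i < n" using C.range len by auto
      then show ?thesis by (simp add: M_def)
    qed
    ultimately show ?thesis using len by (auto simp: below_def input_store_def M_def)
  qed
  \<comment> \<open>\<open>runs_within\<close> asks for a word limit above \<open>M\<close> plus the
    time bound, that is above \<open>2110 * (n + m)\<close>. Since \<open>n + m\<close> is at least
    3 and \<open>3 ^ 9 = 19683\<close>, the tenth power is large enough.\<close>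
  have "M + 2100 * (n + m) < (n + m) ^ 10"
  proof -
    have "(3::nat) ^ 9 \<le> (n + m) ^ 9" by (rule power_mono[OF sum]) simp
    then have "2110 < (n + m) ^ 9" by simp
    then have "2110 * (n + m) < (n + m) ^ 9 * (n + m)" using sum by (intro mult_strict_right_mono) auto
    also have "\<dots> = (n + m) ^ 10" by (simp add: power_Suc2[symmetric] numeral_eq_Suc)
    finally show ?thesis by (simp add: M_def)
  qed
  then obtain t s where e: "exec ((n + m) ^ 10) program (input_store adj) t s" "t \<le> 2100 * (n + m)"
    "C.optimal {v. v < length adj \<and> arr s ''out'' v = 1}"
    using runs_within[OF r _ below, of "(n + m) ^ 10"] cinc_mono[OF cinc_program, of M] sum by (auto simp: M_def)
  have "{v. v < length adj \<and> arr s ''out'' v = 1} = output_set G s" by (auto simp: output_set_def V)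
  then have "min_semipaired_dominating G (output_set G s)"
    using e(3) unfolding C.optimal_def paired by (intro min_semipaired_dominatingI) auto
  then show ?thesis using e by blast
qed

theorem theorem7:
  shows "\<exists>(P :: com) (k :: nat) (c :: nat).
    \<forall>(G :: nat pair_pre_digraph) (adj :: nat list list) (n :: nat) (m :: nat).
      block_graph (with_proj G) \<and> adjacency_lists (with_proj G) adj \<and>
      n = card (verts (with_proj G)) \<and> m = card (edges (with_proj G)) \<and> n \<ge> 2
      \<longrightarrow> (\<exists>t s. exec ((n + m) ^ k) P (input_store adj) t s \<and>
                 t \<le> c * (n + m) \<and>
                 min_semipaired_dominating (with_proj G) (output_set (with_proj G) s))"
  using program_min_semipaired_dominating by blast

end
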